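(* Let $\Omega\subset\mathbb{R}^n$ be a bounded Lipschitz domain. Any $u\in d^1(\Omega)$ is a $bmo_r(\Omega)$ function, and there exists $C>0$ such that $$\|u\|_{bmo_r(\Omega)}\le C\,\|u\|_{d^1(\Omega)}\qquad\text{for all }u\in d^1(\Omega).$$
   Context: Notation: $\mathcal{D}(\Omega)$ is the space of smooth functions compactly supported in $\Omega$, $\mathcal{D}'(\Omega)$ the space of distributions on $\Omega$, and $\mathcal{D}^k(\Omega)$ the space of $k$-differential forms $\Phi=\sum_{|I|=k}\phi_I\,dx^I$ (sum over increasing multi-indices) with components $\phi_I\in\mathcal{D}(\Omega)$. For such a form, $\|\Phi\|_{L^1_k(\Omega)}=\sum_{|I|=k}\|\phi_I\|_{L^1(\Omega)}$ and $\|\Phi\|_{\Upsilon^1_k(\Omega)}=\|\Phi\|_{L^1_k(\Omega)}+\|d\Phi\|_{L^1_{k+1}(\Omega)}$, where $d$ is the exterior derivative. For $1\le k\le n$, $d^k(\Omega)$ is the space of $u\in\mathcal{D}'(\Omega)$ for which there is $C>0$ with $|u(\phi_I)|\le C\|\Phi\|_{\Upsilon^1_k(\Omega)}$ for all $\Phi=\sum_{|I|=k}\phi_I dx^I\in\mathcal{D}^k(\Omega)$ and all $I$, with norm $$\|u\|_{d^k(\Omega)}:=\sup\{|u(\phi_I)|:\Phi\in\mathcal{D}^k(\Omega),\ \|\Phi\|_{\Upsilon^1_k(\Omega)}\le 1,\ |I|=k\}.$$ $bmo_r(\Omega)$ is the space of $g\in L^1_{loc}(\Omega)$ with $$\|g\|_{bmo_r(\Omega)}=\sup_{|Q|\le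 1}\frac1{|Q|}\int_Q|g(x)-g_Q|\,dx+\sup_{|Q|>1}\frac1{|Q|}\int_Q|g(x)|\,dx<\infty,$$ where the suprema are over cubes $Q\subset\Omega$ with sides parallel to the axes, $|Q|$ is the Lebesgue measure, and $g_Q=\frac1{|Q|}\int_Q g$ (a supremum over an empty family is $0$). *)

theory Defs
  imports "HOL-Analysis.Analysis"
begin

section \<open>Test functions and distributions\<close>

definition partial_deriv :: "'n::finite \<Rightarrow> (real^'n \<Rightarrow> real) \<Rightarrow> real^'n \<Rightarrow> real" where
  "partial_deriv i f x = frechet_derivative f (at x) (axis i 1)"

fun iter_partial :: "'n::finite list \<Rightarrow> (real^'n \<Rightarrow> real) \<Rightarrow> real^'n \<Rightarrow> real" where
  "iter_partial [] f = f"
| "iter_partial (i # is) f = partial_deriv i (iter_partial is f)"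

text \<open>Differentiability of every iterated partial derivative also gives its continuity, so this
  is \<open>C\<^sup>\<infinity>\<close>.\<close>

definition smooth :: "(real^'n::finite \<Rightarrow> real) \<Rightarrow> bool" where
  "smooth f \<longleftrightarrow> (\<forall>is x. iter_partial is f differentiable (at x))"

text \<open>Elements of \<open>\<D>(\<Omega>)\<close> are represented by their extension by zero to the whole space.\<close>

definition test_functions :: "(real^'n::finite) set \<Rightarrow> (real^'n \<Rightarrow> real) set" where
  "test_functions \<Omega> = {\<phi>. smooth \<phi> \<and> compact (closure {x. \<phi> x \<noteq> 0}) \<and> closure {x. \<phi> x \<noteq> 0} \<subseteq> \<Omega>}"

text \<open>A distribution is a total HOL function of which only the values on \<open>\<D>(\<Omega>)\<close> are meaningful.
  Continuity is expressed by the usual seminorm estimates on compact subsets; the lists of length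
  at most \<open>N\<close> enumerate, with repetitions, the derivatives of order at most \<open>N\<close>.\<close>

definition distributions :: "(real^'n::finite) set \<Rightarrow> ((real^'n \<Rightarrow> real) \<Rightarrow> real) set" where
  "distributions \<Omega> = {u.
     (\<forall>\<phi>\<in>test_functions \<Omega>. \<forall>\<psi>\<in>test_functions \<Omega>. u (\<lambda>x. \<phi> x + \<psi> x) = u \<phi> + u \<psi>) \<and>
     (\<forall>c. \<forall>\<phi>\<in>test_functions \<Omega>. u (\<lambda>x. c * \<phi> x) = c * u \<phi>) \<and>
     (\<forall>K. compact K \<and> K \<subseteq> \<Omega> \<longrightarrow>
       (\<exists>C N. \<forall>\<phi>\<in>test_functions \<Omega>. closure {x. \<phi> x \<noteq> 0} \<subseteq> K \<longrightarrow>
          \<bar>u \<phi>\<bar> \<le> C * (\<Sum>is | length is \<le> N. SUP x. \<bar>iter_partial is \<phi> x\<bar>)))}"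


section \<open>Differential forms and the spaces \<open>d\<^sup>k(\<Omega>)\<close>\<close>

text \<open>The coordinates are indexed by a finite linearly ordered type, so an increasing multi-index
  of length \<open>k\<close> is the same as a set \<open>I\<close> with \<open>card I = k\<close>. A \<open>k\<close>-form is the family of its
  components; entries at sets of another cardinality are never used.\<close>

definition test_forms ::
    "nat \<Rightarrow> (real^'n::{finite,linorder}) set \<Rightarrow> ('n set \<Rightarrow> real^'n::{finite,linorder} \<Rightarrow> real) set" where
  "test_forms k \<Omega> = {\<Phi>. \<forall>I. card I = k \<longrightarrow> \<Phi> I \<in> test_functions \<Omega>}"

text \<open>Moving \<open>dx\<^sup>j\<close> into its place in \<open>dx\<^sup>j \<and> dx\<^sup>I\<close>, where \<open>J = I \<union> {j}\<close>, takes as many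
  transpositions as there are elements of \<open>J\<close> below \<open>j\<close>.\<close>

definition ext_deriv ::
    "('n set \<Rightarrow> real^'n::{finite,linorder} \<Rightarrow> real) \<Rightarrow> 'n set \<Rightarrow> real^'n::{finite,linorder} \<Rightarrow> real" where
  "ext_deriv \<Phi> J x = (\<Sum>j\<in>J. (-1) ^ card {i\<in>J. i < j} * partial_deriv j (\<Phi> (J - {j})) x)"

definition form_L1_norm ::
    "nat \<Rightarrow> (real^'n::{finite,linorder}) set \<Rightarrow> ('n set \<Rightarrow> real^'n::{finite,linorder} \<Rightarrow> real) \<Rightarrow> real" where
  "form_L1_norm k \<Omega> \<Phi> = (\<Sum>I | card I = k. LINT x:\<Omega>|lebesgue. \<bar>\<Phi> I x\<bar>)"

definition form_Upsilon1_norm ::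
    "nat \<Rightarrow> (real^'n::{finite,linorder}) set \<Rightarrow> ('n set \<Rightarrow> real^'n::{finite,linorder} \<Rightarrow> real) \<Rightarrow> real" where
  "form_Upsilon1_norm k \<Omega> \<Phi> = form_L1_norm k \<Omega> \<Phi> + form_L1_norm (k + 1) \<Omega> (ext_deriv \<Phi>)"

text \<open>Both notions below are meant for \<open>1 \<le> k \<le> CARD('n)\<close>.\<close>

definition d_space ::
    "nat \<Rightarrow> (real^'n::{finite,linorder}) set \<Rightarrow> ((real^'n::{finite,linorder} \<Rightarrow> real) \<Rightarrow> real) set" where
  "d_space k \<Omega> = {u \<in> distributions \<Omega>.
     \<exists>C>0. \<forall>\<Phi>\<in>test_forms k \<Omega>. \<forall>I. card I = k \<longrightarrow> \<bar>u (\<Phi> I)\<bar> \<le> C * form_Upsilon1_norm k \<Omega> \<Phi>}"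

definition d_norm ::
    "nat \<Rightarrow> (real^'n::{finite,linorder}) set \<Rightarrow> ((real^'n::{finite,linorder} \<Rightarrow> real) \<Rightarrow> real) \<Rightarrow> ennreal" where
  "d_norm k \<Omega> u =
     (SUP (\<Phi>, I) \<in> {(\<Phi>, I). \<Phi> \<in> test_forms k \<Omega> \<and> form_Upsilon1_norm k \<Omega> \<Phi> \<le> 1 \<and> card I = k}.
        ennreal \<bar>u (\<Phi> I)\<bar>)"


section \<open>The space \<open>bmo\<^sub>r(\<Omega>)\<close>\<close>

definition L1_loc :: "(real^'n::finite) set \<Rightarrow> (real^'n \<Rightarrow> real) set" where
  "L1_loc \<Omega> = {g. \<forall>K. compact K \<and> K \<subseteq> \<Omega> \<longrightarrow> set_integrable lebesgue K g}"

text \<open>Cubes are closed, so that a cube inside \<open>\<Omega>\<close> is a compact subset of \<open>\<Omega>\<close>, on which every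
  locally integrable function is integrable.\<close>

definition cubes_in :: "(real^'n::finite) set \<Rightarrow> (real^'n) set set" where
  "cubes_in \<Omega> = {Q. \<exists>a s. s > 0 \<and> Q = cbox a (\<chi> i. a $ i + s) \<and> Q \<subseteq> \<Omega>}"

definition average :: "(real^'n::finite) set \<Rightarrow> (real^'n \<Rightarrow> real) \<Rightarrow> real" where
  "average Q g = (1 / measure lebesgue Q) * (LINT x:Q|lebesgue. g x)"

text \<open>The suprema are taken in \<open>[0, \<infinity>]\<close>, where the supremum of the empty family is \<open>0\<close>.\<close>

definition bmo_norm :: "(real^'n::finite) set \<Rightarrow> (real^'n \<Rightarrow> real) \<Rightarrow> ennreal" where
  "bmo_norm \<Omega> g =
     (SUP Q \<in> {Q \<in> cubes_in \<Omega>. measure lebesgue Q \<le> 1}.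
        ennreal (average Q (\<lambda>x. \<bar>g x - average Q g\<bar>))) +
     (SUP Q \<in> {Q \<in> cubes_in \<Omega>. measure lebesgue Q > 1}.
        ennreal (average Q (\<lambda>x. \<bar>g x\<bar>)))"

definition bmo_space :: "(real^'n::finite) set \<Rightarrow> (real^'n \<Rightarrow> real) set" where
  "bmo_space \<Omega> = {g \<in> L1_loc \<Omega>. bmo_norm \<Omega> g < \<infinity>}"

definition represents ::
    "(real^'n::finite) set \<Rightarrow> (real^'n \<Rightarrow> real) \<Rightarrow> ((real^'n \<Rightarrow> real) \<Rightarrow> real) \<Rightarrow> bool" where
  "represents \<Omega> g u \<longleftrightarrow> (\<forall>\<phi>\<in>test_functions \<Omega>. u \<phi> = (LINT x:\<Omega>|lebesgue. g x * \<phi> x))"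


section \<open>Lipschitz domains\<close>

text \<open>Near each boundary point, \<open>\<Omega>\<close> is the strict epigraph, in some unit direction \<open>\<nu>\<close>, of a
  Lipschitz function \<open>\<gamma>\<close> on the hyperplane orthogonal to \<open>\<nu>\<close>; \<open>x - (x \<bullet> \<nu>) *\<^sub>R \<nu>\<close> is the
  projection of \<open>x\<close> to that hyperplane.\<close>

definition lipschitz_domain :: "(real^'n::finite) set \<Rightarrow> bool" where
  "lipschitz_domain \<Omega> \<longleftrightarrow> open \<Omega> \<and> connected \<Omega> \<and> \<Omega> \<noteq> {} \<and>
     (\<forall>p\<in>frontier \<Omega>. \<exists>\<nu> r L \<gamma>. norm \<nu> = 1 \<and> r > 0 \<and> L-lipschitz_on {y. y \<bullet> \<nu> = 0} \<gamma> \<and>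
        \<Omega> \<inter> ball p r = {x \<in> ball p r. x \<bullet> \<nu> > (\<gamma> (x - (x \<bullet> \<nu>) *\<^sub>R \<nu>) :: real)})"

end

theory Submission
  imports Defs
begin

text \<open>
  For \<open>k = 1\<close>, testing \<open>u\<close> with an exact form \<open>d\<psi>\<close> gives \<open>\<bar>u (\<partial>\<^sub>i \<psi>)\<bar> \<le> D \<Sum>\<^sub>j \<parallel>\<partial>\<^sub>j \<psi>\<parallel>\<close> in \<open>L\<^sup>1\<close>, where
  \<open>D\<close> is the norm of \<open>u\<close>. To bound \<open>u a\<close>, up to a multiple of \<open>\<integral>a\<close>, write \<open>a - (\<integral>a) \<rho>\<close> as the
  divergence of a compactly supported field whose derivatives are controlled by \<open>a\<close> in \<open>L\<^sup>2\<close>. With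
  \<open>T\<^sub>i[f, g](x) = \<integral> y\<^sub>i g(y) \<integral>\<^sub>0\<^sup>1 f(x - t y) dt dy\<close> one has \<open>div T[f, g] = f \<integral>g - f * g\<close>, so that
  \<open>T[a, \<rho>] - T[\<rho>, a]\<close> is such a field. For radial \<open>\<rho>\<close> the field \<open>T[a, \<rho>]\<close> is a gradient, hence its
  derivatives have the \<open>L\<^sup>2\<close> norm of its divergence \<open>a - a * \<rho>\<close>, and no singular integral is needed.

  This gives an \<open>L\<^sup>2\<close> density of \<open>u\<close> and the mean oscillation bound on cubes with some room around
  them inside \<open>\<Omega>\<close>. An arbitrary cube is divided into a fine grid; its central part has room, and the
  contribution of the boundary cells is absorbed by induction on the scale. On large cubes the mean
  is controlled by testing with forms that have a single component.
\<close>

section \<open>Calculus of smooth functions\<close>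

text \<open>The bound obtained from exact forms is an L^1 bound, but the derivatives of a field with
  prescribed divergence are singular integrals of that divergence, and such operators are bounded
  neither on L^1 nor on L^infinity. L^2 suffices all the same: by duality the oscillation of a
  density over a cube only needs test functions with values in [-1, 1], whose energy is at most the
  volume. Energies enter squared, in the form \<open>1 + L2_sq a\<close> or a rescaling of it, so
  that no square root has to be handled.

  The obstacle is the support. The field built for a function on a cube lives on a larger cube, and
  a cube inside \<Omega> may come so close to the boundary that no proportional enlargement stays
  inside. The induction on the scale starts from a size that depends on the cube, yet its constant
  does not: the grid is chosen so fine that the boundary cells account for half of the constant, and
  the central part pays for the other half.\<close>

lemma partial_derivI:
  assumes "(f has_derivative D) (at x)"
  shows "partial_deriv i f x = D (axis i 1)"
  using frechet_derivative_at[OF assms] by (simp add: partial_deriv_def)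

lemma iter_partial_append: "iter_partial (is @ [i]) f = iter_partial is (partial_deriv i f)"
  by (induction "is") auto

lemma smooth_differentiable: "smooth f \<Longrightarrow> f differentiable (at x)"
  unfolding smooth_def by (metis iter_partial.simps(1))

lemma smooth_partial: "smooth f \<Longrightarrow> smooth (partial_deriv i f)"
  unfolding smooth_def by (metis iter_partial_append)

text \<open>Smoothness is proved by exhibiting a class of differentiable functions that is invariant
  under partial derivatives, so that no formula for a higher derivative is needed.\<close>

lemma smooth_coinduct:
  assumes P: "P f"
    and step: "\<And>g. P g \<Longrightarrow> (\<forall>x. g differentiable (at x)) \<and> (\<forall>i. P (partial_deriv i g))"
  shows "smooth f"
proof -
  have "P (iter_partial is f)" for "is"
    using P step by (induction "is") auto
  then show ?thesis
    using step by (auto simp: smooth_def)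
qed

lemma smooth_has_derivative:
  fixes f :: "real^'n::finite \<Rightarrow> real"
  assumes "smooth f"
  shows "(f has_derivative (\<lambda>v. v \<bullet> (\<chi> i. partial_deriv i f x))) (at x)"
proof -
  let ?D = "frechet_derivative f (at x)"
  have D: "(f has_derivative ?D) (at x)"
    using smooth_differentiable[OF assms] frechet_derivative_works by blast
  then have lin: "linear ?D"
    by (rule has_derivative_linear)
  have "?D v = v \<bullet> (\<chi> i. partial_deriv i f x)" for v
  proof -
    have "?D v = ?D (\<Sum>i\<in>UNIV. v $ i *\<^sub>R axis i 1)"
      by (simp add: basis_expansion scalar_mult_eq_scaleR[symmetric])
    also have "\<dots> = (\<Sum>i\<in>UNIV. v $ i * ?D (axis i 1))"
      by (simp add: linear_sum[OF lin] linear_cmul[OF lin])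
    finally show ?thesis
      by (simp add: inner_vec_def partial_deriv_def)
  qed
  then have "?D = (\<lambda>v. v \<bullet> (\<chi> i. partial_deriv i f x))" by auto
  then show ?thesis using D by simp
qed

lemma smooth_continuous_on [continuous_intros]:
  fixes f :: "real^'n::finite \<Rightarrow> real"
  assumes "smooth f" "continuous_on S g"
  shows "continuous_on S (\<lambda>x. f (g x))"
proof -
  have "continuous_on UNIV f"
    using smooth_has_derivative[OF assms(1)] has_derivative_continuous
    by (force simp: continuous_on_eq_continuous_within)
  then show ?thesis
    using assms(2) continuous_on_compose2 by blast
qed

section \<open>Smooth functions of one variable and closure properties of smooth functions\<close>

definition smooth_real :: "(real \<Rightarrow> real) \<Rightarrow> bool" where
  "smooth_real h \<longleftrightarrow> (\<forall>k x. (deriv ^^ k) h field_differentiable (at x))"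

lemma smooth_real_DERIV:
  assumes "smooth_real h"
  shows "(h has_field_derivative deriv h x) (at x)"
  using assms unfolding smooth_real_def
  by (metis DERIV_deriv_iff_field_differentiable funpow_0)

lemma smooth_real_deriv:
  assumes "smooth_real h"
  shows "smooth_real (deriv h)"
  using assms unfolding smooth_real_def by (metis comp_apply funpow_Suc_right)

lemma smooth_real_coinduct:
  assumes P: "P f"
    and step: "\<And>g. P g \<Longrightarrow> \<exists>g'. P g' \<and> (\<forall>x. (g has_field_derivative g' x) (at x))"
  shows "smooth_real f"
proof -
  have *: "P (deriv g) \<and> (\<forall>x. g field_differentiable (at x))" if "P g" for g
  proof -
    obtain g' where g': "P g'" "\<And>x. (g has_field_derivative g' x) (at x)"
      using step[OF \<open>P g\<close>] by blast
    then have "deriv g = g'" by (auto intro: DERIV_imp_deriv)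
    then show ?thesis using g' by (auto simp: field_differentiable_def)
  qed
  have "P ((deriv ^^ k) f)" for k
    using P * by (induction k) auto
  then show ?thesis using * by (auto simp: smooth_real_def)
qed

text \<open>The closure of the smooth functions under all these operations is stable under partial
  derivatives as a whole, so coinduction gives all the closure properties at once.\<close>

inductive smooth_alg :: "(real^'n::finite \<Rightarrow> real) \<Rightarrow> bool" where
  base: "smooth f \<Longrightarrow> smooth_alg f"
| add: "smooth_alg f \<Longrightarrow> smooth_alg g \<Longrightarrow> smooth_alg (\<lambda>x. f x + g x)"
| mult: "smooth_alg f \<Longrightarrow> smooth_alg g \<Longrightarrow> smooth_alg (\<lambda>x. f x * g x)"
| recip: "smooth_alg f \<Longrightarrow> (\<forall>x. f x > 0) \<Longrightarrow> smooth_alg (\<lambda>x. inverse (f x))"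
| comp: "smooth_alg f \<Longrightarrow> smooth_real h \<Longrightarrow> smooth_alg (\<lambda>x. h (f x))"

lemma smooth_constI: "smooth (\<lambda>x. c)"
proof (rule smooth_coinduct[where P = "\<lambda>f. \<exists>c. f = (\<lambda>x. c)"])
  fix g :: "real^'n::finite \<Rightarrow> real" assume "\<exists>c. g = (\<lambda>x. c)"
  then obtain c where g: "g = (\<lambda>x. c)" by blast
  have "(g has_derivative (\<lambda>v. 0)) (at x)" for x unfolding g by simp
  then have "partial_deriv i g = (\<lambda>x. 0)" for i
    using partial_derivI by blast
  then show "(\<forall>x. g differentiable (at x)) \<and> (\<forall>i. \<exists>c. partial_deriv i g = (\<lambda>x. c))"
    using g by auto
qed blast

lemma partial_deriv_linear:
  assumes "bounded_linear f"
  shows "partial_deriv i f = (\<lambda>x. f (axis i 1))"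
  using partial_derivI[OF bounded_linear_imp_has_derivative[OF assms]] by blast

lemma smooth_linear:
  fixes f :: "real^'n::finite \<Rightarrow> real"
  assumes "bounded_linear f"
  shows "smooth f"
proof (rule smooth_coinduct[where P = "\<lambda>f. bounded_linear f \<or> smooth f"])
  fix g :: "real^'n::finite \<Rightarrow> real" assume "bounded_linear g \<or> smooth g"
  then show "(\<forall>x. g differentiable (at x)) \<and> (\<forall>i. bounded_linear (partial_deriv i g) \<or> smooth (partial_deriv i g))"
  proof
    assume g: "bounded_linear g"
    then show ?thesis
      using partial_deriv_linear[OF g] smooth_constI
      by (auto intro: bounded_linear_imp_differentiable)
  qed (auto simp: smooth_differentiable smooth_partial)
qed (use assms in blast)

lemma frechet_derivative_worksI: "f differentiable F \<Longrightarrow> (f has_derivative frechet_derivative f F) F"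
  using frechet_derivative_works by blast

lemma smooth_alg_step:
  assumes "smooth_alg g"
  shows "(\<forall>x. g differentiable (at x)) \<and> (\<forall>i. smooth_alg (partial_deriv i g))"
  using assms
proof (induction rule: smooth_alg.induct)
  case (base f)
  then show ?case by (simp add: smooth_differentiable smooth_partial smooth_alg.base)
next
  case (add f g)
  let ?D = "\<lambda>f x. frechet_derivative f (at x)"
  have d: "((\<lambda>x. f x + g x) has_derivative (\<lambda>v. ?D f x v + ?D g x v)) (at x)" for x
    using add.IH frechet_derivative_worksI by (intro has_derivative_add) blast+
  from partial_derivI[OF this]
  have "partial_deriv i (\<lambda>x. f x + g x) = (\<lambda>x. partial_deriv i f x + partial_deriv i g x)" for i
    by (auto simp: partial_deriv_def)
  moreover have "smooth_alg (\<lambda>x. partial_deriv i f x + partial_deriv i g x)" for i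
    using add by (intro smooth_alg.add) auto
  ultimately show ?case using d unfolding differentiable_def by (metis (no_types, lifting))
next
  case (mult f g)
  let ?D = "\<lambda>f x. frechet_derivative f (at x)"
  have d: "((\<lambda>x. f x * g x) has_derivative (\<lambda>v. f x * ?D g x v + ?D f x v * g x)) (at x)" for x
    using mult.IH frechet_derivative_worksI by (intro has_derivative_mult) blast+
  from partial_derivI[OF this]
  have "partial_deriv i (\<lambda>x. f x * g x) = (\<lambda>x. f x * partial_deriv i g x + partial_deriv i f x * g x)" for i
    by (auto simp: partial_deriv_def)
  moreover have "smooth_alg (\<lambda>x. f x * partial_deriv i g x + partial_deriv i f x * g x)" for i
    using mult by (intro smooth_alg.add smooth_alg.mult) auto
  ultimately show ?case using d unfolding differentiable_def by (metis (no_types, lifting))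
next
  case (recip f)
  let ?D = "\<lambda>f x. frechet_derivative f (at x)"
  have d: "((\<lambda>x. inverse (f x)) has_derivative (\<lambda>v. - (inverse (f x) * ?D f x v * inverse (f x)))) (at x)" for x
  proof (rule Deriv.has_derivative_inverse)
    show "f x \<noteq> 0" using recip(2) by (metis less_irrefl)
    show "(f has_derivative ?D f x) (at x)" using recip.IH frechet_derivative_worksI by blast
  qed
  from partial_derivI[OF this]
  have "partial_deriv i (\<lambda>x. inverse (f x)) = (\<lambda>x. (-1) * (inverse (f x) * partial_deriv i f x * inverse (f x)))" for i
    by (auto simp: partial_deriv_def)
  moreover have "smooth_alg (\<lambda>x. (-1) * (inverse (f x) * partial_deriv i f x * inverse (f x)))" for i
    using recip by (intro smooth_alg.mult smooth_alg.recip) (auto intro: smooth_alg.base smooth_constI)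
  ultimately show ?case using d unfolding differentiable_def by (metis (no_types, lifting))
next
  case (comp f h)
  let ?D = "\<lambda>f x. frechet_derivative f (at x)"
  have d: "((\<lambda>x. h (f x)) has_derivative (\<lambda>v. deriv h (f x) * ?D f x v)) (at x)" for x
  proof -
    have "(f has_derivative ?D f x) (at x)" using comp.IH frechet_derivative_worksI by blast
    moreover have "(h has_derivative (*) (deriv h (f x))) (at (f x))"
      using smooth_real_DERIV[OF comp(2), of "f x"] by (simp add: has_field_derivative_def)
    ultimately show ?thesis by (rule has_derivative_compose)
  qed
  from partial_derivI[OF this]
  have "partial_deriv i (\<lambda>x. h (f x)) = (\<lambda>x. deriv h (f x) * partial_deriv i f x)" for i
    by (auto simp: partial_deriv_def)
  moreover have "smooth_alg (\<lambda>x. deriv h (f x) * partial_deriv i f x)" for i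
    using smooth_alg.mult[OF smooth_alg.comp[OF comp(1) smooth_real_deriv[OF comp(2)]]] comp.IH by blast
  ultimately show ?case using d unfolding differentiable_def by (metis (no_types, lifting))
qed

lemma smooth_alg_eq: "smooth_alg f \<longleftrightarrow> smooth f"
  using smooth_coinduct[of smooth_alg, OF _ smooth_alg_step] smooth_alg.base by blast

lemmas smooth_add = smooth_alg.add[unfolded smooth_alg_eq]
lemmas smooth_mult = smooth_alg.mult[unfolded smooth_alg_eq]
lemmas smooth_inverse = smooth_alg.recip[unfolded smooth_alg_eq]
lemmas smooth_compose_real = smooth_alg.comp[unfolded smooth_alg_eq]

lemma smooth_cmult: "smooth f \<Longrightarrow> smooth (\<lambda>x. c * f x)"
  by (intro smooth_mult smooth_constI)

lemma smooth_diff: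
  assumes "smooth f" "smooth g" shows "smooth (\<lambda>x. f x - g x)"
  using smooth_add[OF assms(1) smooth_cmult[OF assms(2), of "-1"]] by simp

lemma smooth_sum: "(\<And>k. k \<in> A \<Longrightarrow> smooth (f k)) \<Longrightarrow> smooth (\<lambda>x. \<Sum>k\<in>A. f k x)"
  by (induction A rule: infinite_finite_induct) (auto intro: smooth_constI smooth_add)

lemma smooth_prod: "(\<And>k. k \<in> A \<Longrightarrow> smooth (f k)) \<Longrightarrow> smooth (\<lambda>x. \<Prod>k\<in>A. f k x)"
  by (induction A rule: infinite_finite_induct) (auto intro: smooth_constI smooth_mult)

lemma smooth_power: "smooth f \<Longrightarrow> smooth (\<lambda>x. f x ^ k)"
  by (induction k) (auto intro: smooth_constI smooth_mult)

lemma smooth_component: "smooth (\<lambda>x::real^'n::finite. x $ i)"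
  by (rule smooth_linear) (rule bounded_linear_vec_nth)

lemma smooth_real_polynomial:
  fixes p :: "real^'n::finite \<Rightarrow> real"
  assumes "real_polynomial_function p" shows "smooth p"
  using assms
  by induction (auto intro: smooth_constI smooth_add smooth_mult smooth_linear)

lemmas smooth_intros = smooth_add smooth_mult smooth_inverse smooth_diff
  smooth_sum smooth_prod smooth_power smooth_component smooth_constI smooth_partial

lemma smooth_affine:
  fixes f :: "real^'n::finite \<Rightarrow> real"
  assumes "smooth f"
  shows "smooth (\<lambda>x. f (b + c *\<^sub>R x))"
    and partial_deriv_affine: "partial_deriv i (\<lambda>x. f (b + c *\<^sub>R x)) = (\<lambda>x. c * partial_deriv i f (b + c *\<^sub>R x))"
proof -
  have d: "((\<lambda>x. f (b + c *\<^sub>R x)) has_derivative (\<lambda>v. (c *\<^sub>R v) \<bullet> (\<chi> i. partial_deriv i f (b + c *\<^sub>R x)))) (at x)"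
    if "smooth f" for f :: "real^'n \<Rightarrow> real" and x
  proof -
    have "((\<lambda>x. b + c *\<^sub>R x) has_derivative (\<lambda>v. c *\<^sub>R v)) (at x)"
      by (auto intro!: derivative_eq_intros)
    from has_derivative_compose[OF this smooth_has_derivative[OF that]] show ?thesis .
  qed
  have pd: "partial_deriv i (\<lambda>x. f (b + c *\<^sub>R x)) = (\<lambda>x. c * partial_deriv i f (b + c *\<^sub>R x))"
    if "smooth f" for i and f :: "real^'n \<Rightarrow> real"
    using partial_derivI[OF d[OF that]] by (auto simp: inner_axis' mult.commute)
  show "smooth (\<lambda>x. f (b + c *\<^sub>R x))"
  \<comment> \<open>Each derivative produces a factor \<open>c\<close>, so the invariant class has
    to allow a scalar multiple \<open>c'\<close>.\<close>
  proof (rule smooth_coinduct[where P = "\<lambda>g. \<exists>f c'. smooth f \<and> g = (\<lambda>x. c' * f (b + c *\<^sub>R x))"])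
    show "\<exists>f' c'. smooth f' \<and> (\<lambda>x. f (b + c *\<^sub>R x)) = (\<lambda>x. c' * f' (b + c *\<^sub>R x))"
      using assms by (intro exI[of _ f] exI[of _ 1]) auto
    fix g :: "real^'n \<Rightarrow> real" assume "\<exists>f c'. smooth f \<and> g = (\<lambda>x. c' * f (b + c *\<^sub>R x))"
    then obtain f c' where f: "smooth f" and g: "g = (\<lambda>x. c' * f (b + c *\<^sub>R x))" by blast
    have g': "(g has_derivative (\<lambda>v. c' * ((c *\<^sub>R v) \<bullet> (\<chi> i. partial_deriv i f (b + c *\<^sub>R x))))) (at x)" for x
      unfolding g by (intro has_derivative_mult_right d f)
    have "partial_deriv i g = (\<lambda>x. c' * (c * partial_deriv i f (b + c *\<^sub>R x)))" for i
      using partial_derivI[OF g'] by (auto simp: inner_axis' mult.commute)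
    then have "\<exists>f c'. smooth f \<and> partial_deriv i g = (\<lambda>x. c' * f (b + c *\<^sub>R x))" for i
      using smooth_partial[OF f] by (intro exI[of _ "partial_deriv i f"] exI[of _ "c' * c"]) (auto simp: mult.assoc)
    then show "(\<forall>x. g differentiable (at x)) \<and> (\<forall>i. \<exists>f c'. smooth f \<and> partial_deriv i g = (\<lambda>x. c' * f (b + c *\<^sub>R x)))"
      using g' by (auto simp: differentiable_def)
  qed
  show "partial_deriv i (\<lambda>x. f (b + c *\<^sub>R x)) = (\<lambda>x. c * partial_deriv i f (b + c *\<^sub>R x))"
    by (rule pd[OF assms])
qed

section \<open>Rules for partial derivatives and their symmetry\<close>

lemma partial_deriv_mult:
  fixes f :: "real^'n::finite \<Rightarrow> real"
  assumes "smooth f" "smooth g"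
  shows "partial_deriv i (\<lambda>x. f x * g x) = (\<lambda>x. f x * partial_deriv i g x + partial_deriv i f x * g x)"
  using partial_derivI[OF has_derivative_mult[OF smooth_has_derivative[OF assms(1)] smooth_has_derivative[OF assms(2)]]]
  by (auto simp: inner_axis')

lemma partial_deriv_const: "partial_deriv i (\<lambda>x. c) = (\<lambda>x. 0)"
  using partial_derivI[OF has_derivative_const] by auto

lemma partial_deriv_cmult:
  fixes f :: "real^'n::finite \<Rightarrow> real"
  assumes "smooth f"
  shows "partial_deriv i (\<lambda>x. c * f x) = (\<lambda>x. c * partial_deriv i f x)"
  using partial_deriv_mult[OF smooth_constI assms, of i c] by (simp add: partial_deriv_const)

lemma partial_deriv_diff:
  fixes f :: "real^'n::finite \<Rightarrow> real"
  assumes "smooth f" "smooth g"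
  shows "partial_deriv i (\<lambda>x. f x - g x) = (\<lambda>x. partial_deriv i f x - partial_deriv i g x)"
  using partial_derivI[OF has_derivative_diff[OF smooth_has_derivative[OF assms(1)] smooth_has_derivative[OF assms(2)]]]
  by (auto simp: inner_axis')

lemma partial_deriv_compose_real:
  fixes f :: "real^'n::finite \<Rightarrow> real"
  assumes "smooth f" "smooth_real h"
  shows "partial_deriv i (\<lambda>x. h (f x)) = (\<lambda>x. deriv h (f x) * partial_deriv i f x)"
proof
  fix x
  have "((\<lambda>x. h (f x)) has_derivative (\<lambda>v. deriv h (f x) * (v \<bullet> (\<chi> i. partial_deriv i f x)))) (at x)"
    using has_derivative_compose[OF smooth_has_derivative[OF assms(1)]] smooth_real_DERIV[OF assms(2), of "f x"]
    by (auto simp: has_field_derivative_def)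
  from partial_derivI[OF this] show "partial_deriv i (\<lambda>x. h (f x)) x = deriv h (f x) * partial_deriv i f x"
    by (simp add: inner_axis')
qed

lemma partial_deriv_zero_outside:
  fixes f :: "real^'n::finite \<Rightarrow> real"
  assumes "closed K" "\<And>x. x \<notin> K \<Longrightarrow> f x = 0" "x \<notin> K"
  shows "partial_deriv i f x = 0"
proof -
  have "(f has_derivative (\<lambda>v. 0)) (at x)"
    using assms by (intro has_derivative_transform_within_open[OF has_derivative_const, of "- K"]) auto
  then show ?thesis by (rule partial_derivI)
qed

lemma smooth_line_DERIV:
  fixes f :: "real^'n::finite \<Rightarrow> real"
  assumes "smooth f"
  shows "((\<lambda>t. f (x + t *\<^sub>R axis i 1)) has_field_derivative partial_deriv i f (x + t *\<^sub>R axis i 1)) (at t)"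
proof -
  have "((\<lambda>t. x + t *\<^sub>R axis i (1::real)) has_derivative (\<lambda>t. t *\<^sub>R axis i 1)) (at t)"
    by (auto intro!: derivative_eq_intros)
  from has_derivative_compose[OF this smooth_has_derivative[OF assms]]
  show ?thesis
    by (simp add: has_field_derivative_def inner_axis' mult_commute_abs)
qed

text \<open>The increment of \<open>f\<close> over a step h in direction i is the integral of its
  i-th derivative. Differentiating this in direction j, once under the integral and once directly,
  and then differentiating in h at 0 gives the two mixed derivatives.\<close>

lemma partial_deriv_commute:
  fixes f :: "real^'n::finite \<Rightarrow> real"
  assumes f: "smooth f"
  shows "partial_deriv i (partial_deriv j f) x = partial_deriv j (partial_deriv i f) x"
proof -
  let ?e = "\<lambda>i. axis i (1::real) :: real^'n"
  define G where "G = (\<lambda>s. partial_deriv j (partial_deriv i f) (x + s *\<^sub>R ?e i))"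
  have contG: "continuous_on S G" for S
    unfolding G_def by (intro continuous_intros smooth_partial f)
  have ftc: "integral (cbox 0 h) (\<lambda>s. partial_deriv i f (y + s *\<^sub>R ?e i)) = f (y + h *\<^sub>R ?e i) - f y"
    if "h \<ge> 0" for h y
  proof -
    have "((\<lambda>s. partial_deriv i f (y + s *\<^sub>R ?e i)) has_integral f (y + h *\<^sub>R ?e i) - f (y + 0 *\<^sub>R ?e i)) {0..h}"
    proof (rule fundamental_theorem_of_calculus[OF that])
      fix s
      show "((\<lambda>s. f (y + s *\<^sub>R ?e i)) has_vector_derivative partial_deriv i f (y + s *\<^sub>R ?e i)) (at s within {0..h})"
        using smooth_line_DERIV[OF f, of y i s]
        by (simp add: has_real_derivative_iff_has_vector_derivative has_vector_derivative_at_within)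
    qed
    from integral_unique[OF this] show ?thesis by simp
  qed
  have key: "integral {0..h} G = partial_deriv j f (x + h *\<^sub>R ?e i) - partial_deriv j f x" if "h \<ge> 0" for h
  proof -
    have "((\<lambda>t. integral (cbox 0 h) (\<lambda>s. partial_deriv i f ((x + s *\<^sub>R ?e i) + t *\<^sub>R ?e j)))
        has_field_derivative integral (cbox 0 h) (\<lambda>s. partial_deriv j (partial_deriv i f) ((x + s *\<^sub>R ?e i) + 0 *\<^sub>R ?e j))) (at 0 within UNIV)"
    proof (rule leibniz_rule_field_derivative)
      show "((\<lambda>t. partial_deriv i f (x + s *\<^sub>R ?e i + t *\<^sub>R ?e j)) has_field_derivative
          partial_deriv j (partial_deriv i f) (x + s *\<^sub>R ?e i + t *\<^sub>R ?e j)) (at t within UNIV)" for t s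
        using smooth_line_DERIV[OF smooth_partial[OF f]] .
      show "(\<lambda>s. partial_deriv i f (x + s *\<^sub>R ?e i + t *\<^sub>R ?e j)) integrable_on cbox 0 h" for t
        by (intro integrable_continuous continuous_intros smooth_partial f)
      show "continuous_on (UNIV \<times> cbox 0 h) (\<lambda>(t, s). partial_deriv j (partial_deriv i f) (x + s *\<^sub>R ?e i + t *\<^sub>R ?e j))"
        unfolding split_beta by (intro continuous_intros smooth_partial f)
    qed auto
    moreover have "(\<lambda>t. integral (cbox 0 h) (\<lambda>s. partial_deriv i f ((x + s *\<^sub>R ?e i) + t *\<^sub>R ?e j)))
       = (\<lambda>t. f ((x + h *\<^sub>R ?e i) + t *\<^sub>R ?e j) - f (x + t *\<^sub>R ?e j))"
      using ftc[OF that, of "x + t *\<^sub>R ?e j" for t] by (auto simp: algebra_simps)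
    ultimately have 1: "((\<lambda>t. f ((x + h *\<^sub>R ?e i) + t *\<^sub>R ?e j) - f (x + t *\<^sub>R ?e j)) has_field_derivative integral {0..h} G) (at 0)"
      by (simp add: G_def)
    have 2: "((\<lambda>t. f ((x + h *\<^sub>R ?e i) + t *\<^sub>R ?e j) - f (x + t *\<^sub>R ?e j)) has_field_derivative
       partial_deriv j f (x + h *\<^sub>R ?e i) - partial_deriv j f x) (at 0)"
      using DERIV_diff[OF smooth_line_DERIV[OF f, of "x + h *\<^sub>R ?e i" j 0] smooth_line_DERIV[OF f, of x j 0]] by simp
    show ?thesis using DERIV_unique[OF 1 2] .
  qed
  \<comment> \<open>The identity \<open>key\<close> holds for \<open>h \<ge> 0\<close> only, so the
    derivatives at 0 are compared from the right.\<close>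
  have 1: "((\<lambda>h. integral {0..h} G) has_field_derivative G 0) (at 0 within {0..1})"
    using integral_has_real_derivative[OF contG[of "{0..1}"], of 0] by simp
  have 2: "((\<lambda>h. partial_deriv j f (x + h *\<^sub>R ?e i) - partial_deriv j f x) has_field_derivative partial_deriv i (partial_deriv j f) x) (at 0 within {0..1})"
    using DERIV_diff[OF smooth_line_DERIV[OF smooth_partial[OF f, of j], of x i 0] DERIV_const, of "partial_deriv j f x"]
    by (simp add: has_field_derivative_at_within)
  have 3: "((\<lambda>h. integral {0..h} G) has_field_derivative partial_deriv i (partial_deriv j f) x) (at 0 within {0..1})"
    by (rule has_field_derivative_transform_within[OF 2, of 1]) (auto simp: key)
  have "at (0::real) within {0..1} \<noteq> bot"
    by (simp add: at_within_Icc_at_right)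
  from vector_derivative_unique_within[OF this 1[unfolded has_real_derivative_iff_has_vector_derivative]
      3[unfolded has_real_derivative_iff_has_vector_derivative]]
  have "G 0 = partial_deriv i (partial_deriv j f) x" .
  then show ?thesis by (simp add: G_def)
qed

section \<open>Bump functions\<close>

definition exp_bump :: "real \<Rightarrow> real" where
  "exp_bump t = (if t > 0 then exp (- inverse t) else 0)"

text \<open>All derivatives of exp(-1/t), extended by 0, are combinations of these functions.
  Treating the whole family at once settles differentiability at 0 for every order.\<close>

definition exp_bump_pow :: "nat \<Rightarrow> real \<Rightarrow> real" where
  "exp_bump_pow k t = (if t > 0 then inverse t ^ k * exp (- inverse t) else 0)"

lemma exp_bump_pow_DERIV:
  "(exp_bump_pow k has_field_derivative exp_bump_pow (k+2) t - real k * exp_bump_pow (k+1) t) (at t)"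
proof -
  consider "t > 0" | "t < 0" | "t = 0" by linarith
  then show ?thesis
  proof cases
    case 1
    have "((\<lambda>t. inverse t ^ k) has_field_derivative - real k * inverse t ^ (k + 1)) (at t)"
      using 1 DERIV_power[OF DERIV_inverse[of t UNIV], of k] by (cases k) (auto simp: algebra_simps)
    moreover have "((\<lambda>t. exp (- inverse t)) has_field_derivative inverse t ^ 2 * exp (- inverse t)) (at t)"
      using 1 by (auto intro!: derivative_eq_intros simp: power2_eq_square)
    ultimately have "((\<lambda>t. inverse t ^ k * exp (- inverse t)) has_field_derivative
        - real k * inverse t ^ (k + 1) * exp (- inverse t) + inverse t ^ 2 * exp (- inverse t) * inverse t ^ k) (at t)"
      by (rule DERIV_mult)
    moreover have "- real k * inverse t ^ (k + 1) * exp (- inverse t) + inverse t ^ 2 * exp (- inverse t) * inverse t ^ k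
        = exp_bump_pow (k+2) t - real k * exp_bump_pow (k+1) t"
      using 1 by (simp add: exp_bump_pow_def power2_eq_square algebra_simps)
    ultimately have "((\<lambda>t. inverse t ^ k * exp (- inverse t)) has_field_derivative
        exp_bump_pow (k+2) t - real k * exp_bump_pow (k+1) t) (at t)"
      by simp
    then show ?thesis
      by (rule has_field_derivative_transform_within_open[of _ _ _ "{0<..}"])
        (use 1 in \<open>auto simp: exp_bump_pow_def\<close>)
  next
    case 2
    have "((\<lambda>t. 0) has_field_derivative exp_bump_pow (k+2) t - real k * exp_bump_pow (k+1) t) (at t)"
      using 2 by (auto simp: exp_bump_pow_def)
    then show ?thesis
      by (rule has_field_derivative_transform_within_open[of _ _ _ "{..<0}"])
        (use 2 in \<open>auto simp: exp_bump_pow_def\<close>)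
  next
    case 3
    \<comment> \<open>In terms of s = 1/h this is s^(k+1) exp(-s) for s tending to infinity; it is
      the right-hand difference quotient at 0.\<close>
    have "((\<lambda>h. inverse h ^ Suc k * exp (- inverse h)) \<longlongrightarrow> 0) (at_right (0::real))"
      using filterlim_compose[OF tendsto_power_div_exp_0[of "Suc k"] filterlim_inverse_at_top_right]
      by (simp add: exp_minus divide_inverse)
    then have r: "((\<lambda>h. exp_bump_pow k h / h) \<longlongrightarrow> 0) (at_right 0)"
      by (rule Lim_transform_eventually)
        (auto simp: exp_bump_pow_def eventually_at_filter divide_inverse ac_simps)
    have l: "((\<lambda>h. exp_bump_pow k h / h) \<longlongrightarrow> 0) (at_left 0)"
      by (rule Lim_transform_eventually[OF tendsto_const])
        (auto simp: exp_bump_pow_def eventually_at_filter)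
    have "((\<lambda>h. exp_bump_pow k h / h) \<longlongrightarrow> 0) (at 0)"
      using filterlim_split_at[OF l r] .
    then show ?thesis
      using 3 by (simp add: DERIV_def exp_bump_pow_def)
  qed
qed

text \<open>The combination \<open>f x - c * g x\<close> has the shape of the derivative of
  \<open>exp_bump_pow k\<close>, which makes this class invariant under differentiation.\<close>

inductive exp_bump_span :: "(real \<Rightarrow> real) \<Rightarrow> bool" where
  "exp_bump_span (exp_bump_pow k)"
| "exp_bump_span f \<Longrightarrow> exp_bump_span g \<Longrightarrow> exp_bump_span (\<lambda>x. f x - c * g x)"

lemma smooth_real_exp_bump: "smooth_real exp_bump"
proof (rule smooth_real_coinduct[where P = exp_bump_span])
  have "exp_bump = exp_bump_pow 0" by (auto simp: exp_bump_def exp_bump_pow_def)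
  then show "exp_bump_span exp_bump" using exp_bump_span.intros(1)[of 0] by simp
  fix g assume "exp_bump_span g"
  then show "\<exists>g'. exp_bump_span g' \<and> (\<forall>x. (g has_field_derivative g' x) (at x))"
  proof induction
    case (1 k)
    have "exp_bump_span (\<lambda>t. exp_bump_pow (k+2) t - real k * exp_bump_pow (k+1) t)"
      by (rule exp_bump_span.intros(2)[OF exp_bump_span.intros(1) exp_bump_span.intros(1)])
    with exp_bump_pow_DERIV[of k] show ?case
      by (intro exI[of _ "\<lambda>t. exp_bump_pow (k+2) t - real k * exp_bump_pow (k+1) t"]) simp
  next
    case (2 f g c)
    then obtain f' g' where *: "exp_bump_span f'" "exp_bump_span g'"
      and d: "\<And>x. (f has_field_derivative f' x) (at x)" "\<And>x. (g has_field_derivative g' x) (at x)" by blast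
    have "((\<lambda>x. f x - c * g x) has_field_derivative f' x - c * g' x) (at x)" for x
      by (intro DERIV_diff DERIV_cmult d)
    with exp_bump_span.intros(2)[OF *, of c] show ?case
      by (intro exI[of _ "\<lambda>x. f' x - c * g' x"]) simp
  qed
qed

lemma exp_bump_pos_iff [simp]: "exp_bump t > 0 \<longleftrightarrow> t > 0"
  by (simp add: exp_bump_def)

lemma exp_bump_nonneg [simp]: "exp_bump t \<ge> 0"
  by (simp add: exp_bump_def)

lemma exp_bump_le_1: "exp_bump t \<le> 1"
  by (simp add: exp_bump_def)

lemma exp_bump_eq_0_iff [simp]: "exp_bump t = 0 \<longleftrightarrow> t \<le> 0"
  by (simp add: exp_bump_def)

definition box_bump :: "real^'n::finite \<Rightarrow> real^'n \<Rightarrow> real^'n \<Rightarrow> real" where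
  "box_bump a b x = (\<Prod>i\<in>UNIV. exp_bump (x $ i - a $ i) * exp_bump (b $ i - x $ i))"

lemma smooth_box_bump: "smooth (box_bump a b)"
  unfolding box_bump_def
  by (intro smooth_intros smooth_compose_real[OF _ smooth_real_exp_bump])

lemma box_bump_nonneg: "box_bump a b x \<ge> 0"
  unfolding box_bump_def by (intro prod_nonneg mult_nonneg_nonneg) auto

lemma box_bump_le_1: "box_bump a b x \<le> 1"
  unfolding box_bump_def by (intro prod_le_1 conjI mult_nonneg_nonneg mult_le_one) (auto simp: exp_bump_le_1)

lemma box_bump_pos_iff: "box_bump a b x > 0 \<longleftrightarrow> x \<in> box a b"
proof
  assume "box_bump a b x > 0"
  then have "box_bump a b x \<noteq> 0" by simp
  then have "(\<Prod>i\<in>UNIV. exp_bump (x $ i - a $ i) * exp_bump (b $ i - x $ i)) \<noteq> 0"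
    unfolding box_bump_def .
  then have "\<forall>i. exp_bump (x $ i - a $ i) * exp_bump (b $ i - x $ i) \<noteq> 0"
    by (subst (asm) prod_zero_iff) auto
  then show "x \<in> box a b"
    unfolding mem_box_cart mult_eq_0_iff exp_bump_eq_0_iff by (meson not_le diff_gt_0_iff_gt)
next
  assume "x \<in> box a b"
  then show "box_bump a b x > 0"
    unfolding box_bump_def by (intro prod_pos mult_pos_pos) (auto simp: mem_box_cart)
qed

section \<open>Integration of smooth functions with bounded support\<close>

abbreviation L1_norm :: "('a::euclidean_space \<Rightarrow> real) \<Rightarrow> real" where
  "L1_norm f \<equiv> LINT x|lborel. \<bar>f x\<bar>"

abbreviation L2_sq :: "('a::euclidean_space \<Rightarrow> real) \<Rightarrow> real" where
  "L2_sq f \<equiv> LINT x|lborel. (f x)\<^sup>2"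

abbreviation grad_L1 :: "(real^'n::finite \<Rightarrow> real) \<Rightarrow> real" where
  "grad_L1 f \<equiv> \<Sum>j\<in>UNIV. L1_norm (partial_deriv j f)"

text \<open>For closed \<open>K\<close> this says that the support lies in \<open>K\<close>, but
  pointwise, so that sums and products require no closures.\<close>

definition smooth_in :: "(real^'n::finite) set \<Rightarrow> (real^'n \<Rightarrow> real) set" where
  "smooth_in K = {f. smooth f \<and> (\<forall>x. x \<notin> K \<longrightarrow> f x = 0)}"

lemma smooth_inD: "f \<in> smooth_in K \<Longrightarrow> smooth f"
  by (simp add: smooth_in_def)

lemma smooth_in_outside: "f \<in> smooth_in K \<Longrightarrow> x \<notin> K \<Longrightarrow> f x = 0"
  by (simp add: smooth_in_def)

lemma smooth_in_mono: "f \<in> smooth_in K \<Longrightarrow> K \<subseteq> L \<Longrightarrow> f \<in> smooth_in L"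
  by (auto simp: smooth_in_def)

lemma smooth_in_partial: "closed K \<Longrightarrow> f \<in> smooth_in K \<Longrightarrow> partial_deriv i f \<in> smooth_in K"
  using partial_deriv_zero_outside by (auto simp: smooth_in_def smooth_partial)

lemma smooth_in_cmult: "f \<in> smooth_in K \<Longrightarrow> (\<lambda>x. c * f x) \<in> smooth_in K"
  by (auto simp: smooth_in_def smooth_cmult)

lemma smooth_in_add: "f \<in> smooth_in K \<Longrightarrow> g \<in> smooth_in K \<Longrightarrow> (\<lambda>x. f x + g x) \<in> smooth_in K"
  by (auto simp: smooth_in_def smooth_add)

lemma smooth_in_diff: "f \<in> smooth_in K \<Longrightarrow> g \<in> smooth_in K \<Longrightarrow> (\<lambda>x. f x - g x) \<in> smooth_in K"
  by (auto simp: smooth_in_def smooth_diff)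

lemma smooth_in_mult: "f \<in> smooth_in K \<Longrightarrow> smooth g \<Longrightarrow> (\<lambda>x. f x * g x) \<in> smooth_in K"
  by (auto simp: smooth_in_def smooth_mult)

lemma smooth_in_zero: "(\<lambda>x. 0) \<in> smooth_in K"
  by (auto simp: smooth_in_def smooth_constI)

lemma smooth_in_sum: "(\<And>k. k \<in> A \<Longrightarrow> f k \<in> smooth_in K) \<Longrightarrow> (\<lambda>x. \<Sum>k\<in>A. f k x) \<in> smooth_in K"
  by (auto simp: smooth_in_def smooth_sum intro!: sum.neutral)

lemma smooth_in_test_functions:
  assumes "compact K" "K \<subseteq> \<Omega>" "f \<in> smooth_in K"
  shows "f \<in> test_functions \<Omega>"
proof -
  have "closure {x. f x \<noteq> 0} \<subseteq> K"
    using assms by (intro closure_minimal) (auto simp: smooth_in_def compact_imp_closed)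
  then show ?thesis
    using assms compact_Int_closed[OF assms(1) closed_closure, of "{x. f x \<noteq> 0}"]
    by (auto simp: test_functions_def smooth_in_def Int_absorb1 simp del: compact_closure)
qed

lemma test_functions_smooth_in: "f \<in> test_functions \<Omega> \<Longrightarrow> f \<in> smooth_in (closure {x. f x \<noteq> 0})"
  using closure_subset by (force simp: test_functions_def smooth_in_def)

lemma continuous_support_integrable:
  fixes f :: "'a::euclidean_space \<Rightarrow> real"
  assumes "continuous_on UNIV f" "compact K" "\<And>x. x \<notin> K \<Longrightarrow> f x = 0"
  shows "integrable lborel f"
proof -
  have "integrable lborel (\<lambda>x. indicator K x *\<^sub>R f x)"
    using assms borel_integrable_compact continuous_on_subset by blast
  moreover have "(\<lambda>x. indicator K x *\<^sub>R f x) = f"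
    using assms(3) by (auto simp: indicator_def fun_eq_iff)
  ultimately show ?thesis by simp
qed

lemma smooth_in_integrable:
  fixes f :: "real^'n::finite \<Rightarrow> real"
  assumes "f \<in> smooth_in K" "compact K" "continuous_on UNIV g"
  shows "integrable lborel (\<lambda>x. f x * g x)"
proof (rule continuous_support_integrable[OF _ assms(2)])
  show "continuous_on UNIV (\<lambda>x. f x * g x)"
    using smooth_continuous_on[OF smooth_inD[OF assms(1)] continuous_on_id] assms(3) by (rule continuous_on_mult)
qed (simp add: smooth_in_outside[OF assms(1)])

lemma smooth_in_integrable1:
  fixes f :: "real^'n::finite \<Rightarrow> real"
  assumes "f \<in> smooth_in K" "compact K"
  shows "integrable lborel f"
  using smooth_in_integrable[OF assms continuous_on_const[of UNIV 1]] by simp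

lemma integral_eq_lborel:
  fixes f :: "'a::euclidean_space \<Rightarrow> real"
  assumes "continuous_on UNIV f" "\<And>x. x \<notin> cbox a b \<Longrightarrow> f x = 0"
  shows "integral (cbox a b) f = integral\<^sup>L lborel f"
proof -
  have "integral\<^sup>L lborel f = integral UNIV f"
    by (rule integral_lborel[symmetric]) (rule continuous_support_integrable[OF assms(1) compact_cbox assms(2)])
  also have "\<dots> = integral (cbox a b) f"
    using assms(2) by (intro integral_spike_set) (auto intro: negligible_subset[OF negligible_empty])
  finally show ?thesis ..
qed

lemma lborel_integral_affine:
  fixes f :: "'a::euclidean_space \<Rightarrow> real"
  assumes f: "f \<in> borel_measurable borel" and "c \<noteq> 0"
  shows "(LINT x|lborel. f x) = \<bar>c\<bar> ^ DIM('a) * (LINT x|lborel. f (t + c *\<^sub>R x))"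
proof -
  have "(LINT x|lborel. f x) = (LINT x|density (distr lborel borel (\<lambda>x. t + c *\<^sub>R x)) (\<lambda>_. \<bar>c\<bar> ^ DIM('a)). f x)"
    using lborel_affine[OF assms(2), of t] by simp
  also have "\<dots> = (LINT x|distr lborel borel (\<lambda>x. t + c *\<^sub>R x). \<bar>c\<bar> ^ DIM('a) *\<^sub>R f x)"
    using f by (intro integral_density) auto
  also have "\<dots> = (LINT x|lborel. \<bar>c\<bar> ^ DIM('a) *\<^sub>R f (t + c *\<^sub>R x))"
    using f by (intro integral_distr) auto
  finally show ?thesis by simp
qed

lemma smooth_borel_measurable:
  fixes f :: "real^'n::finite \<Rightarrow> real"
  shows "smooth f \<Longrightarrow> f \<in> borel_measurable borel"
  by (intro borel_measurable_continuous_onI smooth_continuous_on[where g="\<lambda>x. x", simplified])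

text \<open>The affine argument lets a single differentiation rule cover both \<open>x \<mapsto> f (x - t y)\<close> and \<open>y \<mapsto> f (x - t y)\<close>.\<close>

definition smear :: "'z::euclidean_space set \<Rightarrow> ('z \<Rightarrow> real) \<Rightarrow> ('z \<Rightarrow> real) \<Rightarrow> ('z \<Rightarrow> real^'n::finite) \<Rightarrow> (real^'n \<Rightarrow> real) \<Rightarrow> real^'n \<Rightarrow> real" where
  "smear S k s A f x = integral S (\<lambda>z. k z * f (A z + s z *\<^sub>R x))"

lemma smear_has_derivative:
  fixes f :: "real^'n::finite \<Rightarrow> real" and c d :: "'z::euclidean_space"
  assumes f: "smooth f" and k: "continuous_on UNIV k" and s: "continuous_on UNIV s" and A: "continuous_on UNIV A"
  shows "(smear (cbox c d) k s A f has_derivative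
     (\<lambda>v. v \<bullet> (\<chi> i. smear (cbox c d) (\<lambda>z. k z * s z) s A (partial_deriv i f) x))) (at x)"
proof -
  note cc = continuous_on_compose2[OF k _ subset_UNIV] continuous_on_compose2[OF s _ subset_UNIV]
    continuous_on_compose2[OF A _ subset_UNIV]
  define grad where "grad = (\<lambda>x. (\<chi> i. partial_deriv i f x) :: real^'n)"
  \<comment> \<open>The derivative in the vector parameter \<open>x\<close> as a bounded linear map:
    differentiation under the integral is done in one go, and the partial derivatives are read off
    afterwards.\<close>
  define fx where "fx = (\<lambda>x z. (k z * s z) *\<^sub>R blinfun_inner_left (grad (A z + s z *\<^sub>R x)))"
  have contg: "continuous_on S (\<lambda>x. grad (g x))" if "continuous_on S g" for S and g :: "'y::topological_space \<Rightarrow> real^'n"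
    unfolding grad_def using that by (intro continuous_on_vec_lambda smooth_continuous_on smooth_partial f)
  have cfx: "continuous_on (UNIV \<times> cbox c d) (\<lambda>(x, z). fx x z)"
    unfolding fx_def split_beta
    by (intro continuous_intros contg cc bounded_linear.continuous_on[OF bounded_linear_blinfun_inner_left])
  have cfx': "continuous_on (cbox c d) (fx x)" for x
    unfolding fx_def
    by (intro continuous_intros contg cc bounded_linear.continuous_on[OF bounded_linear_blinfun_inner_left])
  have "((\<lambda>x. integral (cbox c d) (\<lambda>z. k z * f (A z + s z *\<^sub>R x))) has_derivative integral (cbox c d) (fx x)) (at x within UNIV)"
  proof (rule leibniz_rule[OF _ _ cfx])
    show "((\<lambda>x. k z * f (A z + s z *\<^sub>R x)) has_derivative blinfun_apply (fx x z)) (at x within UNIV)" for x z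
    proof -
      have "((\<lambda>x. A z + s z *\<^sub>R x) has_derivative (\<lambda>v. s z *\<^sub>R v)) (at x)"
        by (auto intro!: derivative_eq_intros)
      from has_derivative_mult_right[OF has_derivative_compose[OF this smooth_has_derivative[OF f]], of "k z"]
      moreover have "blinfun_apply (fx x z) = (\<lambda>v. k z * ((s z *\<^sub>R v) \<bullet> grad (A z + s z *\<^sub>R x)))"
        by (auto simp: fx_def blinfun.scaleR_left)
      ultimately show ?thesis by (simp add: grad_def)
    qed
    show "(\<lambda>z. k z * f (A z + s z *\<^sub>R x)) integrable_on cbox c d" for x
      by (intro integrable_continuous continuous_intros smooth_continuous_on f cc)
  qed auto
  moreover have "blinfun_apply (integral (cbox c d) (fx x)) v
      = v \<bullet> (\<chi> i. smear (cbox c d) (\<lambda>z. k z * s z) s A (partial_deriv i f) x)" for v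
  proof -
    have "blinfun_apply (integral (cbox c d) (fx x)) v = integral (cbox c d) (\<lambda>z. blinfun_apply (fx x z) v)"
      by (rule blinfun_apply_integral[OF integrable_continuous[OF cfx']])
    also have "\<dots> = integral (cbox c d) (\<lambda>z. \<Sum>i\<in>UNIV. v $ i * (k z * s z * partial_deriv i f (A z + s z *\<^sub>R x)))"
      by (simp add: fx_def grad_def blinfun.scaleR_left inner_vec_def sum_distrib_left ac_simps)
    also have "\<dots> = (\<Sum>i\<in>UNIV. integral (cbox c d) (\<lambda>z. v $ i * (k z * s z * partial_deriv i f (A z + s z *\<^sub>R x))))"
      by (intro integral_sum integrable_continuous continuous_intros smooth_continuous_on smooth_partial f cc) auto
    also have "\<dots> = v \<bullet> (\<chi> i. smear (cbox c d) (\<lambda>z. k z * s z) s A (partial_deriv i f) x)"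
      by (simp add: smear_def inner_vec_def)
    finally show ?thesis .
  qed
  then have "blinfun_apply (integral (cbox c d) (fx x))
      = (\<lambda>v. v \<bullet> (\<chi> i. smear (cbox c d) (\<lambda>z. k z * s z) s A (partial_deriv i f) x))"
    by (rule ext)
  ultimately show ?thesis by (simp add: smear_def[abs_def])
qed

lemma partial_deriv_smear:
  fixes f :: "real^'n::finite \<Rightarrow> real" and c d :: "'z::euclidean_space"
  assumes "smooth f" "continuous_on UNIV k" "continuous_on UNIV s" "continuous_on UNIV A"
  shows "partial_deriv i (smear (cbox c d) k s A f) = smear (cbox c d) (\<lambda>z. k z * s z) s A (partial_deriv i f)"
  using partial_derivI[OF smear_has_derivative[OF assms]] by (auto simp: inner_axis')

text \<open>A derivative multiplies the kernel by \<open>s\<close> and differentiates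
  \<open>f\<close>. With \<open>s\<close> and \<open>A\<close> fixed and \<open>k\<close>,
  \<open>f\<close> arbitrary, the smears therefore form an invariant class.\<close>

lemma smooth_smear:
  fixes f :: "real^'n::finite \<Rightarrow> real" and c d :: "'z::euclidean_space"
  assumes "smooth f" "continuous_on UNIV k" and s: "continuous_on UNIV s" and A: "continuous_on UNIV A"
  shows "smooth (smear (cbox c d) k s A f)"
proof (rule smooth_coinduct[where P = "\<lambda>g. \<exists>k f. continuous_on UNIV k \<and> smooth f \<and> g = smear (cbox c d) k s A f"])
  fix g assume "\<exists>k f. continuous_on UNIV k \<and> smooth f \<and> g = smear (cbox c d) k s A f"
  then obtain k f where k: "continuous_on UNIV k" and f: "smooth f" and g: "g = smear (cbox c d) k s A f" by blast
  have "continuous_on UNIV (\<lambda>z. k z * s z)" by (intro continuous_intros k s)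
  with smooth_partial[OF f] have "\<exists>k f. continuous_on UNIV k \<and> smooth f \<and> partial_deriv i g = smear (cbox c d) k s A f" for i
    unfolding g partial_deriv_smear[OF f k s A] by blast
  moreover have "g differentiable (at x)" for x
    unfolding g differentiable_def using smear_has_derivative[OF f k s A] by blast
  ultimately show "(\<forall>x. g differentiable (at x)) \<and>
      (\<forall>i. \<exists>k f. continuous_on UNIV k \<and> smooth f \<and> partial_deriv i g = smear (cbox c d) k s A f)"
    by blast
qed (use assms in blast)

section \<open>Translation invariance and integration by parts\<close>

lemma lborel_integral_translate:
  fixes f :: "'a::euclidean_space \<Rightarrow> real"
  assumes "f \<in> borel_measurable borel"
  shows "(LINT x|lborel. f (t + x)) = (LINT x|lborel. f x)"
  using lborel_integral_affine[OF assms, of 1 t] by simp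

text \<open>The integral of a translate of \<open>f\<close> does not depend on the translation, and
  its derivative in direction i is the integral of the partial derivative.\<close>

lemma integral_partial_deriv_eq_0:
  fixes f :: "real^'n::finite \<Rightarrow> real"
  assumes f: "f \<in> smooth_in K" and K: "compact K"
  shows "(LINT x|lborel. partial_deriv i f x) = 0"
proof -
  let ?e = "axis i (1::real) :: real^'n"
  obtain a where a: "K \<subseteq> cbox (-a) a"
    using bounded_subset_cbox_symmetric[OF compact_imp_bounded[OF K]] by blast
  \<comment> \<open>One unit of extra room on each side keeps all translates with |t| \<le> 1 in a
    single box, so that the Leibniz rule applies there.\<close>
  define b where "b = a + 1"
  have sub: "x \<in> cbox (-b) b" if "x + t *\<^sub>R ?e \<in> K" "\<bar>t\<bar> \<le> 1" for x t
  proof -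
    have *: "- a $ j \<le> x $ j + t * ?e $ j \<and> x $ j + t * ?e $ j \<le> a $ j" for j
      using a that(1) by (auto simp: mem_box_cart)
    have "- b $ j \<le> x $ j \<and> x $ j \<le> b $ j" for j
    proof (cases "j = i")
      case True then show ?thesis using *[of j] that(2) by (auto simp: b_def)
    next
      case False then show ?thesis using *[of j] by (simp add: b_def axis_def)
    qed
    then show ?thesis by (simp add: mem_box_cart)
  qed
  have sf: "smooth f" using f by (rule smooth_inD)
  have const: "integral (cbox (-b) b) (\<lambda>x. f (x + t *\<^sub>R ?e)) = integral\<^sup>L lborel f" if "\<bar>t\<bar> \<le> 1" for t
  proof -
    have "integral (cbox (-b) b) (\<lambda>x. f (x + t *\<^sub>R ?e)) = (LINT x|lborel. f (x + t *\<^sub>R ?e))"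
      using sub[OF _ that] smooth_in_outside[OF f]
      by (intro integral_eq_lborel continuous_intros smooth_continuous_on sf) blast
    also have "\<dots> = integral\<^sup>L lborel f"
      using lborel_integral_translate[OF smooth_borel_measurable[OF sf], of "t *\<^sub>R ?e"] by (simp add: add.commute)
    finally show ?thesis .
  qed
  have "((\<lambda>t. integral (cbox (-b) b) (\<lambda>x. f (x + t *\<^sub>R ?e))) has_field_derivative
      integral (cbox (-b) b) (\<lambda>x. partial_deriv i f (x + 0 *\<^sub>R ?e))) (at 0 within UNIV)"
  proof (rule leibniz_rule_field_derivative)
    show "((\<lambda>t. f (x + t *\<^sub>R ?e)) has_field_derivative partial_deriv i f (x + t *\<^sub>R ?e)) (at t within UNIV)" for t x
      using smooth_line_DERIV[OF sf] .
    show "(\<lambda>x. f (x + t *\<^sub>R ?e)) integrable_on cbox (-b) b" for t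
      by (intro integrable_continuous continuous_intros smooth_continuous_on sf)
    show "continuous_on (UNIV \<times> cbox (-b) b) (\<lambda>(t, x). partial_deriv i f (x + t *\<^sub>R ?e))"
      unfolding split_beta by (intro continuous_intros smooth_continuous_on smooth_partial sf)
  qed auto
  moreover have "((\<lambda>t. integral (cbox (-b) b) (\<lambda>x. f (x + t *\<^sub>R ?e))) has_field_derivative 0) (at 0)"
    by (rule has_field_derivative_transform_within_open[OF DERIV_const, of "{-1<..<1}"]) (auto simp: const)
  ultimately have "integral (cbox (-b) b) (partial_deriv i f) = 0"
    using DERIV_unique by fastforce
  moreover have "integral (cbox (-b) b) (partial_deriv i f) = integral\<^sup>L lborel (partial_deriv i f)"
  proof (rule integral_eq_lborel)
    show "continuous_on UNIV (partial_deriv i f)"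
      using smooth_continuous_on[OF smooth_partial[OF sf] continuous_on_id] .
    show "partial_deriv i f x = 0" if "x \<notin> cbox (-b) b" for x
      using smooth_in_outside[OF smooth_in_partial[OF compact_imp_closed[OF K] f]] sub[of x 0] that by fastforce
  qed
  ultimately show ?thesis by simp
qed

lemma integral_by_parts_partial:
  fixes f :: "real^'n::finite \<Rightarrow> real"
  assumes f: "f \<in> smooth_in K" and K: "compact K" and g: "smooth g"
  shows "(LINT x|lborel. f x * partial_deriv i g x) = - (LINT x|lborel. partial_deriv i f x * g x)"
proof -
  have f': "partial_deriv i f \<in> smooth_in K"
    using smooth_in_partial[OF compact_imp_closed[OF K] f] .
  have cg: "continuous_on UNIV g" "continuous_on UNIV (partial_deriv i g)"
    using smooth_continuous_on[OF g continuous_on_id] smooth_continuous_on[OF smooth_partial[OF g] continuous_on_id] by auto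
  have "0 = (LINT x|lborel. f x * partial_deriv i g x + partial_deriv i f x * g x)"
    using integral_partial_deriv_eq_0[OF smooth_in_mult[OF f g] K, of i]
    by (simp add: partial_deriv_mult[OF smooth_inD[OF f] g])
  also have "\<dots> = (LINT x|lborel. f x * partial_deriv i g x) + (LINT x|lborel. partial_deriv i f x * g x)"
    by (intro Bochner_Integration.integral_add smooth_in_integrable[OF f K] smooth_in_integrable[OF f' K] cg)
  finally show ?thesis by simp
qed

text \<open>Two integrations by parts: both sides equal minus the integral of the j-th derivative of
  \<open>w\<close> against a third derivative taken twice in direction i and once in direction j.
  Summed over i and j, the Hessian has the same L^2 norm as the Laplacian.\<close>

lemma integral_hessian:
  fixes w :: "real^'n::finite \<Rightarrow> real"
  assumes w: "w \<in> smooth_in K" and K: "compact K"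
  shows "L2_sq (partial_deriv i (partial_deriv j w))
       = (LINT x|lborel. partial_deriv i (partial_deriv i w) x * partial_deriv j (partial_deriv j w) x)"
proof -
  note C = compact_imp_closed[OF K]
  note p = smooth_in_partial[OF C w]
  note pp = smooth_in_partial[OF C p]
  note s = smooth_inD[OF w]
  have comm: "partial_deriv i (partial_deriv j w) = partial_deriv j (partial_deriv i w)"
    using partial_deriv_commute[OF s] by blast
  have comm2: "partial_deriv i (partial_deriv j (partial_deriv i w)) = partial_deriv j (partial_deriv i (partial_deriv i w))"
    using partial_deriv_commute[OF smooth_partial[OF s]] by blast
  have "(LINT x|lborel. partial_deriv j w x * partial_deriv i (partial_deriv j (partial_deriv i w)) x)
     = - (LINT x|lborel. partial_deriv i (partial_deriv j w) x * partial_deriv j (partial_deriv i w) x)"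
    by (rule integral_by_parts_partial[OF p K]) (intro smooth_partial s)
  moreover have "(LINT x|lborel. partial_deriv j w x * partial_deriv j (partial_deriv i (partial_deriv i w)) x)
     = - (LINT x|lborel. partial_deriv j (partial_deriv j w) x * partial_deriv i (partial_deriv i w) x)"
    by (rule integral_by_parts_partial[OF p K]) (intro smooth_partial s)
  ultimately show ?thesis
    by (simp add: comm comm2 power2_eq_square mult.commute)
qed

section \<open>The homotopy operator\<close>

definition cube :: "real \<Rightarrow> (real^'n::finite) set" where
  "cube r = cbox (\<chi> i. - r) (\<chi> i. r)"

lemma mem_cube: "x \<in> cube r \<longleftrightarrow> (\<forall>i. \<bar>x $ i\<bar> \<le> r)"
  by (auto simp: cube_def mem_box_cart abs_le_iff minus_le_iff)

lemma compact_cube [simp]: "compact (cube r)"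
  by (simp add: cube_def compact_cbox)

lemma closed_cube [simp]: "closed (cube r)"
  by (simp add: cube_def closed_cbox)

lemma cube_mono: "r \<le> s \<Longrightarrow> cube r \<subseteq> cube s"
  by (meson mem_cube order_trans subsetI)

abbreviation ray_box :: "((real^'n::finite) \<times> real) set" where
  "ray_box \<equiv> cbox ((\<chi> i. - 1), 0) ((\<chi> i. 1), 1)"

abbreviation ray_smear :: "((real^'n::finite) \<times> real \<Rightarrow> real) \<Rightarrow> (real^'n \<Rightarrow> real) \<Rightarrow> real^'n \<Rightarrow> real" where
  "ray_smear k \<equiv> smear ray_box k (\<lambda>z. 1) (\<lambda>z. - snd z *\<^sub>R fst z)"

lemma ray_smear_iterated:
  fixes f :: "real^'n::finite \<Rightarrow> real"
  assumes f: "continuous_on UNIV f" and k: "continuous_on UNIV k"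
  shows "ray_smear k f x = integral (cube 1) (\<lambda>y. integral {0..1} (\<lambda>t. k (y, t) * f (x - t *\<^sub>R y)))"
proof -
  have "continuous_on ray_box (\<lambda>z. k z * f (- snd z *\<^sub>R fst z + 1 *\<^sub>R x))"
    by (intro continuous_intros continuous_on_compose2[OF f _ subset_UNIV] continuous_on_subset[OF k subset_UNIV])
  from integral_prod_continuous[OF this] show ?thesis
    by (simp add: smear_def cube_def)
qed

text \<open>For \<open>g\<close> vanishing outside \<open>cube 1\<close> this is the operator
  T_i[f, g]. The variable y ranges over a fixed box, whence the hypothesis
  \<open>g \<in> smooth_in (cube 1)\<close> in the divergence formula.\<close>

definition flux :: "(real^'n::finite \<Rightarrow> real) \<Rightarrow> (real^'n \<Rightarrow> real) \<Rightarrow> 'n \<Rightarrow> real^'n \<Rightarrow> real" where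
  "flux f g i = ray_smear (\<lambda>z. fst z $ i * g (fst z)) f"

lemma flux_kernel_continuous:
  fixes g :: "real^'n::finite \<Rightarrow> real"
  assumes "smooth g"
  shows "continuous_on S (\<lambda>z::(real^'n) \<times> real. fst z $ i * g (fst z))"
  using assms by (intro continuous_intros)

lemma partial_deriv_ray_smear:
  fixes f :: "real^'n::finite \<Rightarrow> real"
  assumes "smooth f" "continuous_on UNIV k"
  shows "partial_deriv j (ray_smear k f) = ray_smear k (partial_deriv j f)"
  using partial_deriv_smear[OF assms, of "\<lambda>z. 1" "\<lambda>z. - snd z *\<^sub>R fst z"] by (simp add: continuous_intros)

lemma smooth_ray_smear:
  fixes f :: "real^'n::finite \<Rightarrow> real"
  assumes "smooth f" "continuous_on UNIV k"
  shows "smooth (ray_smear k f)"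
  by (rule smooth_smear[OF assms]) (intro continuous_intros)+

text \<open>If \<open>y\<close> lies in \<open>cube q\<close>, x - t y in \<open>cube p\<close> and
  0 \<le> t \<le> 1, then \<open>x\<close> lies in \<open>cube (p + q)\<close>. This spreading of
  the support is the origin of the room demanded around cubes.\<close>

lemma ray_smear_smooth_in:
  fixes f :: "real^'n::finite \<Rightarrow> real"
  assumes f: "f \<in> smooth_in (cube p)" and k: "continuous_on UNIV k"
    and k0: "\<And>y t. y \<notin> cube q \<Longrightarrow> k (y, t) = 0"
  shows "ray_smear k f \<in> smooth_in (cube (p + q))"
proof -
  have "ray_smear k f x = 0" if x: "x \<notin> cube (p + q)" for x
  proof -
    have z0: "k z * f (- snd z *\<^sub>R fst z + 1 *\<^sub>R x) = 0" if z: "z \<in> ray_box" for z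
    proof (cases "fst z \<in> cube q")
      case False
      then show ?thesis using k0[of "fst z" "snd z"] by simp
    next
      case True
      have t: "0 \<le> snd z" "snd z \<le> 1" using z by (auto simp: cbox_Pair_eq mem_Times_iff)
      from x obtain i where i: "\<bar>x $ i\<bar> > p + q" by (auto simp: mem_cube not_le)
      have "\<bar>snd z * fst z $ i\<bar> \<le> 1 * \<bar>fst z $ i\<bar>"
        unfolding abs_mult using t by (intro mult_right_mono) auto
      also have "\<dots> \<le> q" using True by (simp add: mem_cube)
      finally have "\<bar>(- snd z *\<^sub>R fst z + 1 *\<^sub>R x) $ i\<bar> > p" using i by simp
      then have "- snd z *\<^sub>R fst z + 1 *\<^sub>R x \<notin> cube p" unfolding mem_cube by (meson not_le)
      then show ?thesis using smooth_in_outside[OF f] by simp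
    qed
    have "ray_smear k f x = integral ray_box (\<lambda>z::(real^'n) \<times> real. 0)"
      unfolding smear_def by (rule Henstock_Kurzweil_Integration.integral_cong) (rule z0)
    then show ?thesis by simp
  qed
  then show ?thesis using smooth_ray_smear[OF smooth_inD[OF f] k] by (simp add: smooth_in_def)
qed

lemma flux_smooth_in:
  fixes f :: "real^'n::finite \<Rightarrow> real"
  assumes f: "f \<in> smooth_in (cube p)" and g: "g \<in> smooth_in (cube q)"
  shows "flux f g i \<in> smooth_in (cube (p + q))"
  unfolding flux_def using smooth_in_outside[OF g]
  by (intro ray_smear_smooth_in[OF f flux_kernel_continuous[OF smooth_inD[OF g]]]) auto

lemma partial_deriv_flux:
  fixes f :: "real^'n::finite \<Rightarrow> real"
  assumes "smooth f" "smooth g"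
  shows "partial_deriv j (flux f g i) = flux (partial_deriv j f) g i"
  unfolding flux_def by (rule partial_deriv_ray_smear[OF assms(1) flux_kernel_continuous[OF assms(2)]])

lemma integral_ray_derivative:
  fixes f :: "real^'n::finite \<Rightarrow> real"
  assumes f: "smooth f"
  shows "integral {0..1} (\<lambda>t. \<Sum>i\<in>UNIV. y $ i * partial_deriv i f (x - t *\<^sub>R y)) = f x - f (x - y)"
proof -
  have "((\<lambda>t. - (\<Sum>i\<in>UNIV. y $ i * partial_deriv i f (x - t *\<^sub>R y))) has_integral f (x - 1 *\<^sub>R y) - f (x - 0 *\<^sub>R y)) {0..1}"
  proof (rule fundamental_theorem_of_calculus)
    fix t :: real
    have "((\<lambda>t. x - t *\<^sub>R y) has_derivative (\<lambda>h. - (h *\<^sub>R y))) (at t within {0..1})"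
      by (auto intro!: derivative_eq_intros)
    from has_derivative_compose[OF this smooth_has_derivative[OF f]]
    show "((\<lambda>t. f (x - t *\<^sub>R y)) has_vector_derivative - (\<Sum>i\<in>UNIV. y $ i * partial_deriv i f (x - t *\<^sub>R y))) (at t within {0..1})"
      by (simp add: has_vector_derivative_def inner_vec_def sum_negf[symmetric] sum_distrib_left mult.assoc)
  qed simp
  from has_integral_neg[OF this] have "((\<lambda>t. \<Sum>i\<in>UNIV. y $ i * partial_deriv i f (x - t *\<^sub>R y)) has_integral f x - f (x - y)) {0..1}"
    by simp
  then show ?thesis by (rule integral_unique)
qed

text \<open>Along the segment from x to x - y, the sum of y_i times the i-th derivative of
  \<open>f\<close> is minus the derivative in t. The inner integral is thus f(x) - f(x - y),
  weighted by g(y).\<close>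

lemma flux_divergence:
  fixes f :: "real^'n::finite \<Rightarrow> real"
  assumes f: "smooth f" and g: "g \<in> smooth_in (cube 1)"
  shows "(\<Sum>i\<in>UNIV. partial_deriv i (flux f g i) x) = f x * (LINT y|lborel. g y) - (LINT y|lborel. g y * f (x - y))"
proof -
  note gs = smooth_inD[OF g]
  have cg: "continuous_on S (\<lambda>y. g (h y))" if "continuous_on S h" for S and h :: "'y::topological_space \<Rightarrow> real^'n"
    using that gs by (intro continuous_intros)
  let ?F = "\<lambda>z. \<Sum>i\<in>UNIV. fst z $ i * g (fst z) * partial_deriv i f (- snd z *\<^sub>R fst z + 1 *\<^sub>R x)"
  have cF: "continuous_on ray_box ?F"
    by (intro continuous_intros cg smooth_continuous_on smooth_partial f)
  have "(\<Sum>i\<in>UNIV. partial_deriv i (flux f g i) x) = (\<Sum>i\<in>UNIV. integral ray_box (\<lambda>z. fst z $ i * g (fst z) * partial_deriv i f (- snd z *\<^sub>R fst z + 1 *\<^sub>R x)))"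
    by (simp add: partial_deriv_flux[OF f gs]) (simp add: flux_def smear_def)
  also have "\<dots> = integral ray_box ?F"
    by (intro integral_sum[symmetric] integrable_continuous continuous_intros cg smooth_continuous_on smooth_partial f) auto
  also have "\<dots> = integral (cube 1) (\<lambda>y. integral {0..1} (\<lambda>t. ?F (y, t)))"
    using integral_prod_continuous[OF cF] by (simp add: cube_def)
  also have "(\<lambda>y. integral {0..1} (\<lambda>t. ?F (y, t))) = (\<lambda>y. g y * f x - g y * f (x - y))"
  proof
    fix y
    have "integral {0..1} (\<lambda>t. ?F (y, t)) = integral {0..1} (\<lambda>t. g y * (\<Sum>i\<in>UNIV. y $ i * partial_deriv i f (x - t *\<^sub>R y)))"
      by (simp add: sum_distrib_left ac_simps)
    then show "integral {0..1} (\<lambda>t. ?F (y, t)) = g y * f x - g y * f (x - y)"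
      by (simp add: integral_ray_derivative[OF f] right_diff_distrib)
  qed
  also have "integral (cube 1) (\<lambda>y. g y * f x - g y * f (x - y)) = (LINT y|lborel. g y * f x - g y * f (x - y))"
    unfolding cube_def
    by (intro integral_eq_lborel continuous_intros cg smooth_continuous_on[OF f]) (simp add: smooth_in_outside[OF g, unfolded cube_def])
  also have "\<dots> = (LINT y|lborel. g y * f x) - (LINT y|lborel. g y * f (x - y))"
    by (intro Bochner_Integration.integral_diff smooth_in_integrable[OF g compact_cube] continuous_intros smooth_continuous_on[OF f])
  finally show ?thesis by simp
qed

text \<open>Lets the convolution terms in the divergences of the two fluxes cancel.\<close>

lemma integral_convolution_commute:
  fixes f g :: "real^'n::finite \<Rightarrow> real"
  assumes "smooth f" "smooth g"
  shows "(LINT y|lborel. g y * f (x - y)) = (LINT y|lborel. f y * g (x - y))"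
proof -
  have "smooth (\<lambda>y. g y * f (x + (-1) *\<^sub>R y))" by (intro smooth_mult smooth_affine assms)
  from lborel_integral_affine[OF smooth_borel_measurable[OF this], of "-1" x]
  show ?thesis by (simp add: mult.commute)
qed

text \<open>The coordinates of y are at most 1 on \<open>ray_box\<close>, and only the L^1 norm of
  \<open>g\<close> enters. With a derivative of the mollifier as \<open>f\<close>, this controls the
  derivatives of \<open>flux \<rho> a\<close> by the L^1 norm of \<open>a\<close>.\<close>

lemma flux_bound:
  fixes f :: "real^'n::finite \<Rightarrow> real"
  assumes f: "smooth f" and g: "g \<in> smooth_in (cube 1)" and M: "\<And>x. \<bar>f x\<bar> \<le> M"
  shows "\<bar>flux f g i x\<bar> \<le> M * L1_norm g"
proof -
  note gs = smooth_inD[OF g]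
  have cg: "continuous_on S (\<lambda>y. g (h y))" if "continuous_on S h" for S and h :: "'y::topological_space \<Rightarrow> real^'n"
    using that gs by (intro continuous_intros)
  have M0: "M \<ge> 0" using M[of 0] by linarith
  have "norm (flux f g i x) \<le> integral ray_box (\<lambda>z::(real^'n) \<times> real. M * \<bar>g (fst z)\<bar>)"
    unfolding flux_def smear_def
  proof (rule integral_norm_bound_integral)
    show "(\<lambda>z. fst z $ i * g (fst z) * f (- snd z *\<^sub>R fst z + 1 *\<^sub>R x)) integrable_on ray_box"
      by (intro integrable_continuous continuous_intros cg smooth_continuous_on f)
    show "(\<lambda>z::(real^'n) \<times> real. M * \<bar>g (fst z)\<bar>) integrable_on ray_box"
      by (intro integrable_continuous continuous_intros cg)
    fix z :: "(real^'n) \<times> real" assume "z \<in> ray_box"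
    then have "\<bar>fst z $ i\<bar> \<le> 1"
      by (auto simp: cbox_Pair_eq mem_Times_iff mem_box_cart abs_le_iff minus_le_iff)
    then have "\<bar>fst z $ i\<bar> * \<bar>g (fst z)\<bar> * \<bar>f (- snd z *\<^sub>R fst z + 1 *\<^sub>R x)\<bar> \<le> 1 * \<bar>g (fst z)\<bar> * M"
      by (intro mult_mono M) auto
    then show "norm (fst z $ i * g (fst z) * f (- snd z *\<^sub>R fst z + 1 *\<^sub>R x)) \<le> M * \<bar>g (fst z)\<bar>"
      by (simp add: abs_mult mult.commute)
  qed
  also have "\<dots> = integral (cube 1) (\<lambda>y. M * \<bar>g y\<bar>)"
  proof -
    have "continuous_on ray_box (\<lambda>z::(real^'n) \<times> real. M * \<bar>g (fst z)\<bar>)"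
      by (intro continuous_intros cg)
    from integral_prod_continuous[OF this] show ?thesis by (simp add: cube_def)
  qed
  also have "\<dots> = (LINT y|lborel. M * \<bar>g y\<bar>)"
    unfolding cube_def
    by (intro integral_eq_lborel continuous_intros cg) (simp add: smooth_in_outside[OF g, unfolded cube_def])
  finally show ?thesis by simp
qed

text \<open>When \<open>g\<close> is radial, the flux field is a gradient, so that the \<open>L\<^sup>2\<close> norm of all its
  derivatives is that of its divergence.\<close>

lemma flux_gradient:
  fixes f :: "real^'n::finite \<Rightarrow> real"
  assumes f: "smooth f" and g: "smooth g" and P: "P \<in> smooth_in (cube 1)"
    and grad: "\<And>i. partial_deriv i P = (\<lambda>y. y $ i * g y)"
  shows "partial_deriv i (ray_smear (\<lambda>z. snd z * P (fst z)) f) = flux f g i"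
proof
  fix x
  note Ps = smooth_inD[OF P]
  have cP: "continuous_on S (\<lambda>y. P (h y))" if "continuous_on S h" for S and h :: "'y::topological_space \<Rightarrow> real^'n"
    using that Ps by (intro continuous_intros)
  \<comment> \<open>The segment average as a function of y with \<open>x\<close> frozen. Its
    gradient carries the factor -t, which accounts for the weight \<open>snd z\<close> in the
    potential; an integration by parts in y then replaces \<open>P\<close> by its gradient y
    g(y).\<close>
  define h where "h = smear (cbox 0 1) (\<lambda>t. 1) (\<lambda>t. - t) (\<lambda>t::real. x) f"
  have h: "smooth h" unfolding h_def by (intro smooth_smear f continuous_intros)
  have h': "partial_deriv i h y = - integral {0..1} (\<lambda>t. t * partial_deriv i f (x - t *\<^sub>R y))" for y
  proof -
    have "partial_deriv i h y = smear (cbox 0 1) (\<lambda>t. 1 * - t) (\<lambda>t. - t) (\<lambda>t::real. x) (partial_deriv i f) y"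
      unfolding h_def by (subst partial_deriv_smear[OF f]) (auto intro!: continuous_intros)
    then show ?thesis by (simp add: smear_def)
  qed
  have k: "continuous_on UNIV (\<lambda>z::(real^'n) \<times> real. snd z * P (fst z))"
    by (intro continuous_intros cP)
  have cf: "continuous_on UNIV f" "continuous_on UNIV (partial_deriv i f)"
    using smooth_continuous_on[OF f continuous_on_id] smooth_continuous_on[OF smooth_partial[OF f] continuous_on_id] by auto
  have "partial_deriv i (ray_smear (\<lambda>z. snd z * P (fst z)) f) x
      = integral (cube 1) (\<lambda>y. integral {0..1} (\<lambda>t. t * P y * partial_deriv i f (x - t *\<^sub>R y)))"
    unfolding partial_deriv_ray_smear[OF f k] by (subst ray_smear_iterated[OF cf(2) k]) simp
  also have "\<dots> = integral (cube 1) (\<lambda>y. - (P y * partial_deriv i h y))"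
  proof -
    have "integral {0..1} (\<lambda>t. t * P y * partial_deriv i f (x - t *\<^sub>R y)) = - (P y * partial_deriv i h y)" for y
    proof -
      have "integral {0..1} (\<lambda>t. t * P y * partial_deriv i f (x - t *\<^sub>R y)) = integral {0..1} (\<lambda>t. P y * (t * partial_deriv i f (x - t *\<^sub>R y)))"
        by (simp add: ac_simps)
      then show ?thesis by (simp add: h')
    qed
    then show ?thesis by simp
  qed
  also have "\<dots> = (LINT y|lborel. - (P y * partial_deriv i h y))"
    unfolding cube_def
    by (intro integral_eq_lborel continuous_intros cP smooth_continuous_on smooth_partial h) (simp add: smooth_in_outside[OF P, unfolded cube_def])
  also have "\<dots> = (LINT y|lborel. partial_deriv i P y * h y)"
    using integral_by_parts_partial[OF P compact_cube h, of i] by simp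
  also have "\<dots> = integral (cube 1) (\<lambda>y. partial_deriv i P y * h y)"
    unfolding cube_def
    by (intro integral_eq_lborel[symmetric] continuous_intros smooth_continuous_on smooth_partial h Ps)
      (simp add: smooth_in_outside[OF smooth_in_partial[OF closed_cube P], unfolded cube_def])
  also have "\<dots> = integral (cube 1) (\<lambda>y. integral {0..1} (\<lambda>t. y $ i * g y * f (x - t *\<^sub>R y)))"
    by (simp add: grad h_def smear_def)
  also have "\<dots> = flux f g i x"
    unfolding flux_def by (subst ray_smear_iterated[OF cf(1) flux_kernel_continuous[OF g]]) simp
  finally show "partial_deriv i (ray_smear (\<lambda>z. snd z * P (fst z)) f) x = flux f g i x" .
qed

text \<open>Compose the one-dimensional bump with 1 - |x|^2 / \<delta>^2. The gradient of the result
  is x times a radial function of one sign, namely the derivative of the bump at the same argument,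
  and that function is normalised to give \<rho>.\<close>

lemma radial_mollifier:
  assumes "0 < \<delta>"
  obtains P \<rho> :: "real^'n::finite \<Rightarrow> real"
  where "P \<in> smooth_in (cube \<delta>)" "\<rho> \<in> smooth_in (cube \<delta>)" "(LINT x|lborel. \<rho> x) = 1"
    "\<And>i. partial_deriv i P = (\<lambda>y. y $ i * \<rho> y)"
proof -
  define q where "q = (\<lambda>x::real^'n. 1 - (1 / \<delta>\<^sup>2) * (\<Sum>i\<in>UNIV. (x $ i) ^ 2))"
  have q: "smooth q" unfolding q_def by (intro smooth_intros)
  have q': "partial_deriv i q x = - 2 * x $ i / \<delta>\<^sup>2" for i x
  proof -
    have "(q has_derivative (\<lambda>v. 0 - (1 / \<delta>\<^sup>2) * (\<Sum>i\<in>UNIV. 2 * (v $ i * x $ i)))) (at x)"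
      unfolding q_def
      by (intro derivative_intros has_derivative_mult_right has_derivative_sum)
        (auto intro!: derivative_eq_intros bounded_linear.has_derivative[OF bounded_linear_vec_nth])
    from partial_derivI[OF this] show ?thesis
      by (simp add: axis_def if_distrib if_distribR sum_distrib_left[symmetric] cong: if_cong)
  qed
  have de: "deriv exp_bump t = exp_bump_pow 2 t" for t
  proof -
    have "exp_bump = exp_bump_pow 0" by (auto simp: exp_bump_def exp_bump_pow_def)
    then show ?thesis using DERIV_imp_deriv[OF exp_bump_pow_DERIV[of 0 t]] by (simp add: numeral_2_eq_2)
  qed
  define e where "e = (\<lambda>x. exp_bump_pow 2 (q x))"
  have e: "smooth e"
    using smooth_compose_real[OF q smooth_real_deriv[OF smooth_real_exp_bump]] by (simp add: e_def de)
  have qout: "q x \<le> 0" if out: "x \<notin> cube \<delta>" for x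
  proof -
    from out obtain i where "\<bar>x $ i\<bar> > \<delta>" by (auto simp: mem_cube not_le)
    then have "\<delta>\<^sup>2 \<le> (x $ i)\<^sup>2" using assms by (intro abs_le_square_iff[THEN iffD1]) auto
    also have "\<dots> \<le> (\<Sum>i\<in>UNIV. (x $ i)\<^sup>2)" by (intro member_le_sum) auto
    finally show ?thesis using assms by (simp add: q_def field_simps)
  qed
  have e_in: "e \<in> smooth_in (cube \<delta>)"
    using e qout by (auto simp: smooth_in_def e_def exp_bump_pow_def not_less[symmetric])
  define m where "m = (LINT x|lborel. e x)"
  have "m \<noteq> 0"
  proof
    assume "m = 0"
    have ce: "continuous_on UNIV e" using smooth_continuous_on[OF e continuous_on_id] .
    have "integral (cube \<delta>) e = m"
      unfolding m_def cube_def using smooth_in_outside[OF e_in]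
      by (intro integral_eq_lborel ce) (auto simp: cube_def)
    with \<open>m = 0\<close> have hi: "(e has_integral 0) (cube \<delta>)"
      using integrable_integral[OF integrable_continuous[OF continuous_on_subset[OF ce subset_UNIV]], of "\<chi> i. - \<delta>" "\<chi> i. \<delta>"]
      by (simp add: cube_def)
    have "e 0 = 0"
    proof (rule has_integral_0_cbox_imp_0[of "\<chi> i. - \<delta>" "\<chi> i. \<delta>"])
      show "continuous_on (cbox (\<chi> i. - \<delta>) (\<chi> i. \<delta>)) e" using continuous_on_subset[OF ce subset_UNIV] .
      show "(e has_integral 0) (cbox (\<chi> i. - \<delta>) (\<chi> i. \<delta>))" using hi by (simp add: cube_def)
      show "0 \<le> e x" for x by (simp add: e_def exp_bump_pow_def)
      show "(0::real^'n) \<in> cbox (\<chi> i. - \<delta>) (\<chi> i. \<delta>)" using assms by (simp add: mem_box_cart)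
      have "(0::real^'n) \<in> box (\<chi> i. - \<delta>) (\<chi> i. \<delta>)" using assms by (simp add: mem_box_cart)
      then show "box (\<chi> i. - \<delta>) (\<chi> i. \<delta>) \<noteq> ({} :: (real^'n) set)" by blast
    qed
    then show False by (simp add: e_def q_def exp_bump_pow_def)
  qed
  define \<rho> where "\<rho> = (\<lambda>x. (1 / m) * e x)"
  \<comment> \<open>The factor cancels -2 / \<delta>^2 from the chain rule and carries over the
    normalisation 1 / m of \<rho>.\<close>
  define P where "P = (\<lambda>x. (- \<delta>\<^sup>2 / (2 * m)) * exp_bump (q x))"
  have Q: "smooth (\<lambda>x. exp_bump (q x))" by (rule smooth_compose_real[OF q smooth_real_exp_bump])
  show ?thesis
  proof
    show "P \<in> smooth_in (cube \<delta>)" unfolding P_def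
      by (intro smooth_in_cmult) (use Q qout in \<open>auto simp: smooth_in_def\<close>)
    show "\<rho> \<in> smooth_in (cube \<delta>)" unfolding \<rho>_def by (intro smooth_in_cmult e_in)
    show "(LINT x|lborel. \<rho> x) = 1" using \<open>m \<noteq> 0\<close> by (simp add: \<rho>_def m_def)
    fix i
    have "partial_deriv i P = (\<lambda>x. (- \<delta>\<^sup>2 / (2 * m)) * (e x * (- 2 * x $ i / \<delta>\<^sup>2)))"
      unfolding P_def partial_deriv_cmult[OF Q] partial_deriv_compose_real[OF q smooth_real_exp_bump]
      by (simp add: de e_def q')
    then show "partial_deriv i P = (\<lambda>y. y $ i * \<rho> y)"
      using assms \<open>m \<noteq> 0\<close> by (auto simp: \<rho>_def field_simps fun_eq_iff)
  qed
qed

section \<open>The interior estimate\<close>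

lemma smooth_in_bounded:
  fixes f :: "real^'n::finite \<Rightarrow> real"
  assumes "f \<in> smooth_in K" "compact K"
  obtains M where "M \<ge> 0" "\<And>x. \<bar>f x\<bar> \<le> M"
proof -
  have "compact (f ` K)"
    using smooth_continuous_on[OF smooth_inD[OF assms(1)] continuous_on_id] assms(2) by (rule compact_continuous_image)
  from compact_imp_bounded[OF this] obtain M where "M > 0" and "\<forall>y\<in>f ` K. norm y \<le> M"
    unfolding bounded_pos by blast
  then have M: "M > 0" "\<And>y. y \<in> f ` K \<Longrightarrow> norm y \<le> M" by blast+
  show ?thesis
  proof (rule that[of M])
    show "\<bar>f x\<bar> \<le> M" for x
      using M smooth_in_outside[OF assms(1), of x] by (cases "x \<in> K") auto
  qed (use M in simp)
qed

lemma compact_indicator: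
  fixes K :: "'a::euclidean_space set"
  assumes "compact K"
  shows "integrable lborel (indicator K :: _ \<Rightarrow> real)" and "(LINT x|lborel. indicator K x) = measure lborel K"
  using emeasure_bounded_finite[OF compact_imp_bounded[OF assms]] borel_compact[OF assms]
  by (simp_all add: integrable_indicator_iff)

lemma smooth_in_integrable_square:
  fixes f :: "real^'n::finite \<Rightarrow> real"
  assumes "f \<in> smooth_in K" "compact K"
  shows "integrable lborel (\<lambda>x. (f x)\<^sup>2)"
  unfolding power2_eq_square
  by (rule smooth_in_integrable[OF assms smooth_continuous_on[OF smooth_inD[OF assms(1)] continuous_on_id]])

lemma smooth_in_L1_le_sup:
  fixes f :: "real^'n::finite \<Rightarrow> real"
  assumes f: "f \<in> smooth_in K" and K: "compact K" and M: "\<And>x. \<bar>f x\<bar> \<le> M"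
  shows "L1_norm f \<le> M * measure lborel K"
proof -
  have "L1_norm f \<le> (LINT x|lborel. M * indicator K x)"
    using smooth_in_outside[OF f] M
    by (intro integral_mono integrable_abs smooth_in_integrable1[OF f K] integrable_mult_right compact_indicator K)
      (auto simp: indicator_def)
  then show ?thesis by (simp add: compact_indicator[OF K])
qed

text \<open>From |f| \<le> 1 + f^2 on \<open>K\<close>. This form is linear in the energy, so it
  adds up with other energy bounds without square roots.\<close>

lemma smooth_in_L1_le_L2:
  fixes f :: "real^'n::finite \<Rightarrow> real"
  assumes f: "f \<in> smooth_in K" and K: "compact K"
  shows "L1_norm f \<le> measure lborel K + L2_sq f"
proof -
  have "L1_norm f \<le> (LINT x|lborel. indicator K x + (f x)\<^sup>2)"
  proof (intro integral_mono integrable_abs smooth_in_integrable1[OF f K] Bochner_Integration.integrable_add compact_indicator[OF K]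
      smooth_in_integrable_square[OF f K])
    fix x
    have "0 \<le> (\<bar>f x\<bar> - 1)\<^sup>2 + (f x)\<^sup>2 + 1" by simp
    then have "2 * \<bar>f x\<bar> \<le> 2 * (1 + (f x)\<^sup>2)" by (simp add: power2_diff)
    then show "\<bar>f x\<bar> \<le> indicator K x + (f x)\<^sup>2"
      using smooth_in_outside[OF f, of x] by (cases "x \<in> K") auto
  qed
  also have "\<dots> = measure lborel K + L2_sq f"
    by (subst Bochner_Integration.integral_add) (auto simp: compact_indicator[OF K] smooth_in_integrable_square[OF f K])
  finally show ?thesis .
qed

lemma smooth_in_L1_square_le:
  fixes f :: "real^'n::finite \<Rightarrow> real"
  assumes f: "f \<in> smooth_in K" and K: "compact K"
  shows "(L1_norm f)\<^sup>2 \<le> measure lborel K * L2_sq f"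
proof -
  let ?V = "measure lborel K"
  define A where "A = L1_norm f"
  have i1: "integrable lborel (\<lambda>x. \<bar>f x\<bar>)" by (intro integrable_abs smooth_in_integrable1[OF f K])
  have i2: "integrable lborel (\<lambda>x. (f x)\<^sup>2)" by (rule smooth_in_integrable_square[OF f K])
  \<comment> \<open>Expanding this square is the Cauchy-Schwarz inequality of |f| against the
    indicator of \<open>K\<close>.\<close>
  have "0 \<le> (LINT x|lborel. (?V * \<bar>f x\<bar> - A * indicator K x)\<^sup>2)"
    by (intro integral_nonneg_AE) auto
  also have "(\<lambda>x. (?V * \<bar>f x\<bar> - A * indicator K x)\<^sup>2)
      = (\<lambda>x. ?V\<^sup>2 * (f x)\<^sup>2 - 2 * ?V * A * \<bar>f x\<bar> + A\<^sup>2 * indicator K x)"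
    using smooth_in_outside[OF f]
    by (auto simp: fun_eq_iff indicator_def power2_diff power_mult_distrib)
  also have "(LINT x|lborel. ?V\<^sup>2 * (f x)\<^sup>2 - 2 * ?V * A * \<bar>f x\<bar> + A\<^sup>2 * indicator K x)
      = ?V\<^sup>2 * L2_sq f - 2 * ?V * A * A + A\<^sup>2 * ?V"
    using i1 i2 compact_indicator(1)[OF K] by (simp add: A_def compact_indicator[OF K])
  finally have *: "0 \<le> ?V * (?V * L2_sq f - A\<^sup>2)"
    by (simp add: power2_eq_square algebra_simps)
  show ?thesis
  proof (cases "?V = 0")
    case True
    obtain M where "M \<ge> 0" "\<And>x. \<bar>f x\<bar> \<le> M" using smooth_in_bounded[OF f K] by metis
    from smooth_in_L1_le_sup[OF f K this(2)] True have "A \<le> 0" by (simp add: A_def)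
    moreover have "A \<ge> 0" unfolding A_def by (intro integral_nonneg_AE) auto
    ultimately have "A = 0" by linarith
    then show ?thesis using True unfolding A_def by simp
  next
    case False
    then have "?V > 0" using measure_nonneg[of lborel "K"] by linarith
    with * show ?thesis by (simp add: A_def zero_le_mult_iff)
  qed
qed

section \<open>Functionals that are controlled on derivatives\<close>

definition linear_on_smooth :: "(real^'n::finite) set \<Rightarrow> ((real^'n \<Rightarrow> real) \<Rightarrow> real) \<Rightarrow> bool" where
  "linear_on_smooth K v \<longleftrightarrow>
     (\<forall>f\<in>smooth_in K. \<forall>g\<in>smooth_in K. v (\<lambda>x. f x + g x) = v f + v g) \<and>
     (\<forall>c. \<forall>f\<in>smooth_in K. v (\<lambda>x. c * f x) = c * v f)"

lemma linear_on_smooth_add: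
  "linear_on_smooth K v \<Longrightarrow> f \<in> smooth_in K \<Longrightarrow> g \<in> smooth_in K \<Longrightarrow> v (\<lambda>x. f x + g x) = v f + v g"
  by (simp add: linear_on_smooth_def)

lemma linear_on_smooth_cmult:
  "linear_on_smooth K v \<Longrightarrow> f \<in> smooth_in K \<Longrightarrow> v (\<lambda>x. c * f x) = c * v f"
  by (simp add: linear_on_smooth_def)

lemma linear_on_smooth_diff:
  assumes "linear_on_smooth K v" "f \<in> smooth_in K" "g \<in> smooth_in K"
  shows "v (\<lambda>x. f x - g x) = v f - v g"
  using linear_on_smooth_add[OF assms(1,2) smooth_in_cmult[OF assms(3)], of "-1"]
    linear_on_smooth_cmult[OF assms(1,3), of "-1"] by simp

lemma linear_on_smooth_sum:
  assumes v: "linear_on_smooth K v" and f: "\<And>k. k \<in> A \<Longrightarrow> f k \<in> smooth_in K"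
  shows "v (\<lambda>x. \<Sum>k\<in>A. f k x) = (\<Sum>k\<in>A. v (f k))"
  using f
proof (induction A rule: infinite_finite_induct)
  case (insert a A)
  then show ?case
    using linear_on_smooth_add[OF v, of "f a" "\<lambda>x. \<Sum>k\<in>A. f k x"] smooth_in_sum[of A f K] by simp
qed (use linear_on_smooth_cmult[OF v smooth_in_zero, of 0] in auto)

definition gradient_bound :: "(real^'n::finite) set \<Rightarrow> ((real^'n \<Rightarrow> real) \<Rightarrow> real) \<Rightarrow> real \<Rightarrow> bool" where
  "gradient_bound K v D \<longleftrightarrow>
     (\<forall>\<psi>\<in>smooth_in K. \<forall>i. \<bar>v (partial_deriv i \<psi>)\<bar> \<le> D * grad_L1 \<psi>)"

text \<open>The fluxes are the partial derivatives of one potential, so by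
  \<open>integral_hessian\<close> the double sum is the energy of its Laplacian. That Laplacian is
  \<open>a\<close> minus its convolution with \<rho>, and the convolution is bounded pointwise by
  sup |\<rho>| times the L^1 norm of \<open>a\<close>.\<close>

lemma flux_L2_bound:
  fixes \<rho> :: "real^'n::finite \<Rightarrow> real"
  assumes P: "P \<in> smooth_in (cube \<delta>)" and \<rho>: "\<rho> \<in> smooth_in (cube \<delta>)" and \<delta>: "0 < \<delta>" "\<delta> \<le> 1"
    and \<rho>1: "(LINT x|lborel. \<rho> x) = 1" and grad: "\<And>i. partial_deriv i P = (\<lambda>y. y $ i * \<rho> y)"
  obtains C where "C \<ge> 0"
    "\<And>a. a \<in> smooth_in (cube 1) \<Longrightarrow>
      (\<Sum>i\<in>UNIV. \<Sum>j\<in>UNIV. L2_sq (partial_deriv j (flux a \<rho> i))) \<le> C * L2_sq a"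
proof -
  let ?V = "\<lambda>r. measure lborel (cube r :: (real^'n) set)"
  have sub: "cube \<delta> \<subseteq> (cube 1 :: (real^'n) set)" using \<delta> by (intro cube_mono)
  note P1 = smooth_in_mono[OF P sub] and \<rho>1' = smooth_in_mono[OF \<rho> sub]
  note \<rho>s = smooth_inD[OF \<rho>]
  obtain M where M: "M \<ge> 0" "\<And>x. \<bar>\<rho> x\<bar> \<le> M" using smooth_in_bounded[OF \<rho>] by auto
  \<comment> \<open>With c the convolution, (a - c)^2 \<le> 2 a^2 + 2 c^2. By Cauchy-Schwarz c^2 is
    at most \<open>M\<^sup>2 * ?V 1\<close> times the energy of \<open>a\<close>, and this is
    integrated over a cube of volume \<open>?V (1 + \<delta>)\<close>.\<close>
  define C where "C = 2 + 2 * (M\<^sup>2 * ?V 1) * ?V (1 + \<delta>)"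
  show ?thesis
  proof (rule that[of C])
    show "C \<ge> 0" unfolding C_def by (intro add_nonneg_nonneg mult_nonneg_nonneg) auto
    fix a :: "real^'n \<Rightarrow> real" assume a: "a \<in> smooth_in (cube 1)"
    note as = smooth_inD[OF a]
    define E where "E = L2_sq a"
    have ia: "integrable lborel (\<lambda>x. (a x)\<^sup>2)" by (rule smooth_in_integrable_square[OF a]) simp
    define w where "w = ray_smear (\<lambda>z. snd z * P (fst z)) a"
    have k: "continuous_on UNIV (\<lambda>z::(real^'n) \<times> real. snd z * P (fst z))"
      using smooth_inD[OF P] by (intro continuous_intros)
    have w: "w \<in> smooth_in (cube (1 + \<delta>))"
      unfolding w_def using smooth_in_outside[OF P] by (intro ray_smear_smooth_in[OF a k]) auto
    have dw: "partial_deriv i w = flux a \<rho> i" for i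
      unfolding w_def by (rule flux_gradient[OF as \<rho>s P1 grad])
    define L where "L = (\<lambda>x. \<Sum>i\<in>UNIV. partial_deriv i (partial_deriv i w) x)"
    have ddw: "partial_deriv i (partial_deriv j w) \<in> smooth_in (cube (1 + \<delta>))" for i j
      by (intro smooth_in_partial w closed_cube)
    have L: "L \<in> smooth_in (cube (1 + \<delta>))"
      unfolding L_def by (intro smooth_in_sum ddw)
    have "(\<Sum>i\<in>UNIV. \<Sum>j\<in>UNIV. L2_sq (partial_deriv j (flux a \<rho> i)))
        = (\<Sum>i\<in>UNIV. \<Sum>j\<in>UNIV. LINT x|lborel. partial_deriv j (partial_deriv j w) x * partial_deriv i (partial_deriv i w) x)"
      by (simp add: dw[symmetric] integral_hessian[OF w])
    also have "\<dots> = (LINT x|lborel. (\<Sum>i\<in>UNIV. \<Sum>j\<in>UNIV. partial_deriv j (partial_deriv j w) x * partial_deriv i (partial_deriv i w) x))"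
      by (simp add: Bochner_Integration.integral_sum Bochner_Integration.integrable_sum smooth_in_integrable[OF ddw compact_cube] smooth_continuous_on[OF smooth_inD[OF ddw] continuous_on_id])
    also have "\<dots> = L2_sq L"
      by (simp add: L_def power2_eq_square sum_product mult.commute)
    also have "\<dots> \<le> (LINT x|lborel. 2 * (a x)\<^sup>2 + 2 * (M\<^sup>2 * ?V 1 * E) * indicator (cube (1 + \<delta>)) x)"
    proof (rule integral_mono)
      show "integrable lborel (\<lambda>x. (L x)\<^sup>2)"
        by (rule smooth_in_integrable_square[OF L compact_cube])
      show "integrable lborel (\<lambda>x. 2 * (a x)\<^sup>2 + 2 * (M\<^sup>2 * ?V 1 * E) * indicator (cube (1 + \<delta>)) x)"
        using ia compact_indicator(1)[of "cube (1 + \<delta>) :: (real^'n) set"] by simp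
      fix x :: "real^'n"
      define c where "c = (LINT y|lborel. \<rho> y * a (x - y))"
      have Lx: "L x = a x - c"
        using flux_divergence[OF as \<rho>1', of x] by (simp add: L_def dw c_def \<rho>1)
      have c: "c\<^sup>2 \<le> M\<^sup>2 * ?V 1 * E"
      proof -
        have "c = (LINT y|lborel. a y * \<rho> (x - y))" unfolding c_def by (rule integral_convolution_commute[OF as \<rho>s])
        also have "\<bar>\<dots>\<bar> \<le> (LINT y|lborel. \<bar>a y * \<rho> (x - y)\<bar>)"
          by (rule integral_abs_bound)
        also have "\<dots> \<le> (LINT y|lborel. M * \<bar>a y\<bar>)"
        proof (rule integral_mono)
          have "integrable lborel (\<lambda>y. a y * \<rho> (x - y))"
            by (intro smooth_in_integrable[OF a compact_cube] continuous_intros \<rho>s)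
          then show "integrable lborel (\<lambda>y. \<bar>a y * \<rho> (x - y)\<bar>)" by (rule integrable_abs)
          show "integrable lborel (\<lambda>y. M * \<bar>a y\<bar>)"
            by (intro integrable_mult_right integrable_abs smooth_in_integrable1[OF a compact_cube])
          show "\<bar>a y * \<rho> (x - y)\<bar> \<le> M * \<bar>a y\<bar>" for y
            using mult_right_mono[OF M(2)[of "x - y"], of "\<bar>a y\<bar>"] by (simp add: abs_mult mult.commute)
        qed
        finally have "\<bar>c\<bar> \<le> M * L1_norm a" by simp
        then have "\<bar>c\<bar>\<^sup>2 \<le> (M * L1_norm a)\<^sup>2" by (intro power_mono) auto
        also have "\<dots> \<le> M\<^sup>2 * (?V 1 * E)"
          unfolding power_mult_distrib E_def by (intro mult_left_mono smooth_in_L1_square_le[OF a compact_cube]) auto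
        finally show ?thesis by (simp add: mult.assoc)
      qed
      have "(a x - c)\<^sup>2 + (a x + c)\<^sup>2 = 2 * (a x)\<^sup>2 + 2 * c\<^sup>2"
        by (simp add: power2_sum power2_diff)
      then have "(a x - c)\<^sup>2 \<le> 2 * (a x)\<^sup>2 + 2 * c\<^sup>2"
        using zero_le_power2[of "a x + c"] by linarith
      with c have "(L x)\<^sup>2 \<le> 2 * (a x)\<^sup>2 + 2 * (M\<^sup>2 * ?V 1 * E)" unfolding Lx by linarith
      then show "(L x)\<^sup>2 \<le> 2 * (a x)\<^sup>2 + 2 * (M\<^sup>2 * ?V 1 * E) * indicator (cube (1 + \<delta>)) x"
        using smooth_in_outside[OF L, of x] by (cases "x \<in> cube (1 + \<delta>)") auto
    qed
    also have "\<dots> = C * E"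
      using ia compact_indicator(1)[of "cube (1 + \<delta>) :: (real^'n) set"] by (simp add: compact_indicator[OF compact_cube] E_def C_def algebra_simps)
    finally show "(\<Sum>i\<in>UNIV. \<Sum>j\<in>UNIV. L2_sq (partial_deriv j (flux a \<rho> i))) \<le> C * L2_sq a"
      by (simp add: E_def)
  qed
qed

text \<open>The constant c is \<open>v \<rho>\<close>: once the multiple of \<rho> with the same
  integral is subtracted from \<open>a\<close>, a divergence remains, to which the gradient bound
  applies. \<open>C\<close> is fixed before \<open>v\<close> and \<open>D\<close>, which permits
  rescaling afterwards.\<close>

lemma interior_estimate_unit:
  assumes \<delta>: "0 < \<delta>" "\<delta> \<le> 1"
  obtains C where "C \<ge> 0"
    "\<And>(v :: (real^'n::finite \<Rightarrow> real) \<Rightarrow> real) D. linear_on_smooth (cube (1 + \<delta>)) v \<Longrightarrow> gradient_bound (cube (1 + \<delta>)) v D \<Longrightarrow> D \<ge> 0 \<Longrightarrow>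
      \<exists>c. \<forall>a\<in>smooth_in (cube 1). \<bar>v a - c * (LINT x|lborel. a x)\<bar> \<le> C * D * (1 + L2_sq a)"
proof -
  let ?V = "\<lambda>r. measure lborel (cube r :: (real^'n) set)"
  obtain P \<rho> :: "real^'n \<Rightarrow> real" where P: "P \<in> smooth_in (cube \<delta>)" and \<rho>: "\<rho> \<in> smooth_in (cube \<delta>)"
    and \<rho>1: "(LINT x|lborel. \<rho> x) = 1" and grad: "\<And>i. partial_deriv i P = (\<lambda>y. y $ i * \<rho> y)"
    using radial_mollifier[OF \<delta>(1)] by blast
  obtain C0 where C0: "C0 \<ge> 0" "\<And>a. a \<in> smooth_in (cube 1) \<Longrightarrow>
      (\<Sum>i\<in>UNIV. \<Sum>j\<in>UNIV. L2_sq (partial_deriv j (flux a \<rho> i))) \<le> C0 * L2_sq a"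
    using flux_L2_bound[OF P \<rho> \<delta> \<rho>1 grad] by metis
  note \<rho>s = smooth_inD[OF \<rho>]
  have "\<exists>M. \<forall>x. \<bar>partial_deriv j \<rho> x\<bar> \<le> M" for j
    using smooth_in_bounded[OF smooth_in_partial[OF closed_cube \<rho>] compact_cube] by metis
  then obtain M where M: "\<And>j x. \<bar>partial_deriv j \<rho> x\<bar> \<le> M j" by metis
  define N where "N = real CARD('n)"
  define M' where "M' = (\<Sum>j\<in>UNIV. M j)"
  have M0: "M j \<ge> 0" for j using M[of j 0] by linarith
  then have M': "M' \<ge> 0" unfolding M'_def by (intro sum_nonneg) auto
  define C where "C = N * N * ?V (1 + \<delta>) + C0 + N * M' * ?V (1 + \<delta>) * (?V 1 + 1)"
  have sub1: "cube 1 \<subseteq> (cube (1 + \<delta>) :: (real^'n) set)" and sub\<delta>: "cube \<delta> \<subseteq> (cube (1 + \<delta>) :: (real^'n) set)"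
    and sub\<delta>1: "cube \<delta> \<subseteq> (cube 1 :: (real^'n) set)"
    using \<delta> by (auto intro!: cube_mono)
  show ?thesis
  proof (rule that[of C])
    show "C \<ge> 0" unfolding C_def N_def using C0 M' by (intro add_nonneg_nonneg mult_nonneg_nonneg) auto
    fix v :: "(real^'n \<Rightarrow> real) \<Rightarrow> real" and D
    assume v: "linear_on_smooth (cube (1 + \<delta>)) v" and g: "gradient_bound (cube (1 + \<delta>)) v D" and D: "D \<ge> 0"
    show "\<exists>c. \<forall>a\<in>smooth_in (cube 1). \<bar>v a - c * (LINT x|lborel. a x)\<bar> \<le> C * D * (1 + L2_sq a)"
    proof (intro exI ballI)
      fix a :: "real^'n \<Rightarrow> real" assume a: "a \<in> smooth_in (cube 1)"
      note as = smooth_inD[OF a]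
      define E where "E = L2_sq a"
      have E0: "E \<ge> 0" unfolding E_def by (intro integral_nonneg_AE) auto
      define I where "I = (LINT x|lborel. a x)"
      \<comment> \<open>The two divergences are a - conv and I \<rho> - conv, where conv is the
        convolution of \<open>a\<close> and \<rho>, so their difference is a - I \<rho>.\<close>
      define S where "S = (\<lambda>i x. flux a \<rho> i x - flux \<rho> a i x)"
      have fa: "flux a \<rho> i \<in> smooth_in (cube (1 + \<delta>))" for i by (rule flux_smooth_in[OF a \<rho>])
      have fr: "flux \<rho> a i \<in> smooth_in (cube (1 + \<delta>))" for i using flux_smooth_in[OF \<rho> a] by (simp add: add.commute)
      have S: "S i \<in> smooth_in (cube (1 + \<delta>))" for i unfolding S_def by (rule smooth_in_diff[OF fa fr])
      have S': "partial_deriv j (S i) = (\<lambda>x. partial_deriv j (flux a \<rho> i) x - partial_deriv j (flux \<rho> a i) x)" for i j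
        unfolding S_def by (rule partial_deriv_diff[OF smooth_inD[OF fa] smooth_inD[OF fr]])
      have div: "(\<lambda>x. \<Sum>i\<in>UNIV. partial_deriv i (S i) x) = (\<lambda>x. a x - I * \<rho> x)"
      proof
        fix x
        show "(\<Sum>i\<in>UNIV. partial_deriv i (S i) x) = a x - I * \<rho> x"
          unfolding S' sum_subtractf flux_divergence[OF as smooth_in_mono[OF \<rho> sub\<delta>1]] flux_divergence[OF \<rho>s a]
          by (simp add: integral_convolution_commute[OF as \<rho>s] \<rho>1 I_def)
      qed
      have "v a - v \<rho> * I = v (\<lambda>x. a x - I * \<rho> x)"
        using linear_on_smooth_diff[OF v smooth_in_mono[OF a sub1] smooth_in_cmult[OF smooth_in_mono[OF \<rho> sub\<delta>], of I]]
          linear_on_smooth_cmult[OF v smooth_in_mono[OF \<rho> sub\<delta>], of I] by simp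
      also have "\<dots> = (\<Sum>i\<in>UNIV. v (partial_deriv i (S i)))"
        unfolding div[symmetric] by (intro linear_on_smooth_sum[OF v] smooth_in_partial S closed_cube)
      also have "\<bar>\<dots>\<bar> \<le> (\<Sum>i\<in>UNIV. D * grad_L1 (S i))"
        using g S by (intro order_trans[OF sum_abs] sum_mono) (auto simp: gradient_bound_def)
      \<comment> \<open>The first flux is measured by its energy. In the second one the derivative
        falls on \<rho>, so a sup bound by the L^1 norm of \<open>a\<close> is enough; that norm is
        in turn at most \<open>?V 1 + E\<close>.\<close>
      also have "\<dots> \<le> D * (\<Sum>i\<in>UNIV. \<Sum>j\<in>UNIV. ?V (1 + \<delta>) + L2_sq (partial_deriv j (flux a \<rho> i)) + M j * (?V 1 + E) * ?V (1 + \<delta>))"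
        unfolding sum_distrib_left[symmetric]
      proof (intro mult_left_mono sum_mono D)
        fix i j :: 'n
        have da: "partial_deriv j (flux a \<rho> i) \<in> smooth_in (cube (1 + \<delta>))" by (intro smooth_in_partial fa closed_cube)
        have dr: "partial_deriv j (flux \<rho> a i) \<in> smooth_in (cube (1 + \<delta>))" by (intro smooth_in_partial fr closed_cube)
        have "L1_norm (partial_deriv j (S i)) \<le> (LINT x|lborel. \<bar>partial_deriv j (flux a \<rho> i) x\<bar> + \<bar>partial_deriv j (flux \<rho> a i) x\<bar>)"
          unfolding S'
          by (intro integral_mono integrable_abs Bochner_Integration.integrable_add Bochner_Integration.integrable_diff
              smooth_in_integrable1[OF da] smooth_in_integrable1[OF dr]) auto
        also have "\<dots> = L1_norm (partial_deriv j (flux a \<rho> i)) + L1_norm (partial_deriv j (flux \<rho> a i))"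
          by (intro Bochner_Integration.integral_add integrable_abs smooth_in_integrable1[OF da] smooth_in_integrable1[OF dr]) auto
        also have "L1_norm (partial_deriv j (flux \<rho> a i)) \<le> M j * (?V 1 + E) * ?V (1 + \<delta>)"
        proof (rule smooth_in_L1_le_sup[OF dr compact_cube])
          fix x
          have "\<bar>partial_deriv j (flux \<rho> a i) x\<bar> \<le> M j * L1_norm a"
            unfolding partial_deriv_flux[OF \<rho>s as] by (rule flux_bound[OF smooth_partial[OF \<rho>s] a M])
          also have "\<dots> \<le> M j * (?V 1 + E)"
            unfolding E_def by (intro mult_left_mono smooth_in_L1_le_L2[OF a compact_cube] M0)
          finally show "\<bar>partial_deriv j (flux \<rho> a i) x\<bar> \<le> M j * (?V 1 + E)" .
        qed
        also note smooth_in_L1_le_L2[OF da compact_cube]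
        finally show "L1_norm (partial_deriv j (S i))
            \<le> ?V (1 + \<delta>) + L2_sq (partial_deriv j (flux a \<rho> i)) + M j * (?V 1 + E) * ?V (1 + \<delta>)"
          by simp
      qed
      also have "\<dots> \<le> D * (C * (1 + E))"
      proof (intro mult_left_mono D)
        have "(\<Sum>i\<in>(UNIV::'n set). \<Sum>j\<in>UNIV. ?V (1 + \<delta>) + L2_sq (partial_deriv j (flux a \<rho> i)) + M j * (?V 1 + E) * ?V (1 + \<delta>))
           = N * N * ?V (1 + \<delta>) + (\<Sum>i\<in>UNIV. \<Sum>j\<in>UNIV. L2_sq (partial_deriv j (flux a \<rho> i))) + N * M' * ?V (1 + \<delta>) * (?V 1 + E)"
          by (simp add: sum.distrib N_def M'_def sum_distrib_right[symmetric])
        also have "\<dots> \<le> N * N * ?V (1 + \<delta>) * (1 + E) + C0 * (1 + E) + N * M' * ?V (1 + \<delta>) * ((?V 1 + 1) * (1 + E))"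
        proof (intro add_mono mult_left_mono)
          show "N * N * ?V (1 + \<delta>) \<le> N * N * ?V (1 + \<delta>) * (1 + E)"
            using E0 mult_nonneg_nonneg[of "N * N * ?V (1 + \<delta>)" E] by (simp add: N_def algebra_simps)
          show "(\<Sum>i\<in>UNIV. \<Sum>j\<in>UNIV. L2_sq (partial_deriv j (flux a \<rho> i))) \<le> C0 * (1 + E)"
            using C0(2)[OF a] C0(1) by (simp add: E_def algebra_simps)
          show "?V 1 + E \<le> (?V 1 + 1) * (1 + E)"
            using E0 mult_nonneg_nonneg[OF measure_nonneg[of lborel "cube 1 :: (real^'n) set"] E0] by (simp add: algebra_simps)
          show "0 \<le> N * M' * ?V (1 + \<delta>)" using M' by (simp add: N_def)
        qed
        also have "\<dots> = C * (1 + E)" by (simp add: C_def algebra_simps)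
        finally show "(\<Sum>i\<in>(UNIV::'n set). \<Sum>j\<in>UNIV. ?V (1 + \<delta>) + L2_sq (partial_deriv j (flux a \<rho> i)) + M j * (?V 1 + E) * ?V (1 + \<delta>))
           \<le> C * (1 + E)" .
      qed
      finally show "\<bar>v a - v \<rho> * (LINT x|lborel. a x)\<bar> \<le> C * D * (1 + L2_sq a)"
        by (simp add: I_def E_def ac_simps)
    qed
  qed
qed

section \<open>Approximation by smooth functions and representation of functionals\<close>

text \<open>The notion \<open>measurable_on\<close> is defined by limits of continuous functions off
  a negligible set; the proof passes to it from Lebesgue measurability.\<close>

lemma measurable_limit_continuous:
  fixes h :: "'a::euclidean_space \<Rightarrow> real"
  assumes "h \<in> borel_measurable borel"
  obtains g where "\<And>n::nat. continuous_on UNIV (g n)" "AE x in lborel. (\<lambda>n. g n x) \<longlonglongrightarrow> h x"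
proof -
  have "h \<in> borel_measurable lebesgue"
    by (rule measurable_completion) (simp add: assms)
  then have "h \<in> borel_measurable (lebesgue_on UNIV)" unfolding lebesgue_on_UNIV_eq .
  then have "h measurable_on UNIV"
    using measurable_on_iff_borel_measurable[of UNIV h] by auto
  then have "\<exists>N g. negligible N \<and> (\<forall>n::nat. continuous_on UNIV (g n)) \<and> (\<forall>x. x \<notin> N \<longrightarrow> (\<lambda>n. g n x) \<longlonglongrightarrow> h x)"
    by (simp add: measurable_on_def)
  then obtain N g where N: "negligible N" and g: "\<forall>n::nat. continuous_on UNIV (g n)"
    and lim: "\<forall>x. x \<notin> N \<longrightarrow> (\<lambda>n. g n x) \<longlonglongrightarrow> h x"
    by (elim exE conjE)
  from N have "AE x in lebesgue. x \<notin> N"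
    by (simp add: negligible_iff_null_sets AE_not_in)
  then have "AE x in lborel. x \<notin> N" by (simp add: AE_completion_iff)
  then have "AE x in lborel. (\<lambda>n. g n x) \<longlonglongrightarrow> h x" by (rule AE_mp) (simp add: lim)
  with g show ?thesis by (intro that[of g]) auto
qed

text \<open>Continuous approximants are clamped to [-1, 1], replaced by polynomials with error
  \<open>\<epsilon> n\<close>, divided by \<open>1 + \<epsilon> n\<close> to restore the bound, and
  cut off. A uniform bound with convergence almost everywhere is what dominated convergence asks
  for.\<close>

lemma smooth_approximation_box:
  fixes h :: "real^'n::finite \<Rightarrow> real"
  assumes h: "h \<in> borel_measurable borel" and h1: "\<And>x. \<bar>h x\<bar> \<le> 1"
  obtains \<phi> where "\<And>n::nat. \<phi> n \<in> smooth_in (cbox a b)" "\<And>n x. \<bar>\<phi> n x\<bar> \<le> 1"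
    "AE x in lborel. x \<in> box a b \<longrightarrow> (\<lambda>n. \<phi> n x) \<longlonglongrightarrow> h x"
proof -
  obtain g where g: "\<And>n::nat. continuous_on UNIV (g n)" and lim: "AE x in lborel. (\<lambda>n. g n x) \<longlonglongrightarrow> h x"
    using measurable_limit_continuous[OF h] by blast
  define k where "k = (\<lambda>n x. max (-1) (min 1 (g n x)))"
  define \<epsilon> where "\<epsilon> = (\<lambda>n. inverse (real (Suc n)))"
  have \<epsilon>: "\<epsilon> n > 0" for n by (simp add: \<epsilon>_def)
  have "continuous_on (cbox a b) (k n)" for n
    unfolding k_def by (intro continuous_intros continuous_on_subset[OF g subset_UNIV])
  then have "\<exists>p. real_polynomial_function p \<and> (\<forall>x\<in>cbox a b. \<bar>k n x - p x\<bar> < \<epsilon> n)" for n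
    using Stone_Weierstrass_real_polynomial_function[OF compact_cbox _ \<epsilon>] by metis
  then obtain p where p: "\<And>n. real_polynomial_function (p n)" and pk: "\<And>n x. x \<in> cbox a b \<Longrightarrow> \<bar>k n x - p n x\<bar> < \<epsilon> n"
    by metis
  \<comment> \<open>Powers of 1 - bump tend to 0 wherever the bump is positive. Each cutoff vanishes
    outside the open box, and together they tend to 1 on all of it.\<close>
  define \<eta> where "\<eta> = (\<lambda>n x. 1 - (1 - box_bump a b x) ^ Suc n)"
  define \<phi> where "\<phi> = (\<lambda>n x. \<eta> n x * (inverse (1 + \<epsilon> n) * p n x))"
  have \<eta>0: "\<eta> n x = 0" if "x \<notin> box a b" for n x
    using that box_bump_pos_iff[of a b x] box_bump_nonneg[of a b x] by (simp add: \<eta>_def)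
  have \<eta>1: "0 \<le> \<eta> n x" "\<eta> n x \<le> 1" for n x
    using box_bump_nonneg[of a b x] box_bump_le_1[of a b x] power_le_one[of "1 - box_bump a b x" "Suc n"]
      zero_le_power[of "1 - box_bump a b x" "Suc n"]
    unfolding \<eta>_def by linarith+
  have out: "x \<notin> box a b" if "x \<notin> cbox a b" for x using that box_subset_cbox by blast
  show ?thesis
  proof
    show "\<phi> n \<in> smooth_in (cbox a b)" for n
    proof -
      have "smooth (\<eta> n)" unfolding \<eta>_def by (intro smooth_diff smooth_power smooth_constI smooth_box_bump)
      from smooth_mult[OF this smooth_mult[OF smooth_constI smooth_real_polynomial[OF p[of n]]]]
      have "smooth (\<phi> n)" unfolding \<phi>_def .
      moreover have "\<phi> n x = 0" if "x \<notin> cbox a b" for x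
        unfolding \<phi>_def \<eta>0[OF out[OF that]] by simp
      ultimately show ?thesis unfolding smooth_in_def by blast
    qed
    show "\<bar>\<phi> n x\<bar> \<le> 1" for n x
    proof (cases "x \<in> cbox a b")
      case False
      then show ?thesis using \<eta>0 out by (simp add: \<phi>_def)
    next
      case True
      have "\<bar>k n x\<bar> \<le> 1" by (auto simp: k_def)
      then have "\<bar>p n x\<bar> \<le> 1 + \<epsilon> n" using pk[OF True, of n] by linarith
      then have "inverse (1 + \<epsilon> n) * \<bar>p n x\<bar> \<le> 1" using \<epsilon>[of n] by (simp add: field_simps)
      then have "\<eta> n x * (inverse (1 + \<epsilon> n) * \<bar>p n x\<bar>) \<le> 1 * 1"
        using \<eta>1[of n x] \<epsilon>[of n] by (intro mult_mono) auto
      then show ?thesis using \<eta>1[of n x] \<epsilon>[of n] by (simp add: \<phi>_def abs_mult)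
    qed
    show "AE x in lborel. x \<in> box a b \<longrightarrow> (\<lambda>n. \<phi> n x) \<longlonglongrightarrow> h x"
      using lim
    proof (rule AE_mp, intro AE_I2 impI)
      fix x assume l: "(\<lambda>n. g n x) \<longlonglongrightarrow> h x" and x: "x \<in> box a b"
      have e0: "\<epsilon> \<longlonglongrightarrow> 0" unfolding \<epsilon>_def by (rule LIMSEQ_inverse_real_of_nat)
      have kl: "(\<lambda>n. k n x) \<longlonglongrightarrow> max (-1) (min 1 (h x))"
        unfolding k_def by (intro tendsto_intros l)
      have d: "(\<lambda>n. k n x - p n x) \<longlonglongrightarrow> 0"
      proof (rule Lim_null_comparison[OF _ e0], rule always_eventually, rule allI)
        have "x \<in> cbox a b" using x box_subset_cbox by blast
        then show "norm (k n x - p n x) \<le> \<epsilon> n" for n using pk by (simp add: less_imp_le)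
      qed
      from tendsto_diff[OF kl d] have pl: "(\<lambda>n. p n x) \<longlonglongrightarrow> h x"
        using h1[of x] by (simp add: abs_le_iff)
      have b: "0 < box_bump a b x" "box_bump a b x \<le> 1" using x box_bump_pos_iff box_bump_le_1 by blast+
      have "(\<lambda>n. (1 - box_bump a b x) ^ Suc n) \<longlonglongrightarrow> 0"
        using b by (intro LIMSEQ_Suc LIMSEQ_realpow_zero) auto
      then have \<eta>l: "(\<lambda>n. \<eta> n x) \<longlonglongrightarrow> 1 - 0" unfolding \<eta>_def by (intro tendsto_diff tendsto_const)
      have "(\<lambda>n. \<phi> n x) \<longlonglongrightarrow> (1 - 0) * (inverse (1 + 0) * h x)"
        unfolding \<phi>_def by (intro tendsto_mult tendsto_inverse tendsto_add tendsto_const pl \<eta>l e0) simp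
      then show "(\<lambda>n. \<phi> n x) \<longlonglongrightarrow> h x" by simp
    qed
  qed
qed

lemma AE_box_of_cbox: "AE x in lborel. x \<in> cbox a b \<longrightarrow> x \<in> box a (b::'a::euclidean_space)"
proof -
  have "cbox a b - box a b \<in> null_sets lebesgue"
    using negligible_frontier_interval[of a b] unfolding negligible_iff_null_sets .
  then have "AE x in lebesgue. x \<notin> cbox a b - box a b" by (rule AE_not_in)
  then have "AE x in lborel. x \<notin> cbox a b - box a b" by (simp add: AE_completion_iff)
  then show ?thesis by (rule AE_mp) auto
qed

text \<open>Test functions tending to \<open>sgn g\<close> recover the L^1 norm by dominated
  convergence; the approximation is available in the open box only, but its boundary is a null
  set.\<close>

lemma L1_bound_by_duality:
  fixes g :: "real^'n::finite \<Rightarrow> real"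
  assumes g: "g \<in> borel_measurable borel" and gi: "integrable lborel (\<lambda>x. indicator (cbox a b) x * g x)"
    and B: "\<And>\<phi>. \<phi> \<in> smooth_in (cbox a b) \<Longrightarrow> (\<And>x. \<bar>\<phi> x\<bar> \<le> 1) \<Longrightarrow> \<bar>LINT x|lborel. g x * \<phi> x\<bar> \<le> B"
  shows "(LINT x|lborel. indicator (cbox a b) x * \<bar>g x\<bar>) \<le> B"
proof -
  define h where "h = (\<lambda>x. sgn (g x))"
  have h: "h \<in> borel_measurable borel" unfolding h_def using g by measurable
  obtain \<phi> where \<phi>: "\<And>n::nat. \<phi> n \<in> smooth_in (cbox a b)" and \<phi>1: "\<And>n x. \<bar>\<phi> n x\<bar> \<le> 1"
    and lim: "AE x in lborel. x \<in> box a b \<longrightarrow> (\<lambda>n. \<phi> n x) \<longlonglongrightarrow> h x"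
    using smooth_approximation_box[OF h, of a b] by (force simp: h_def abs_sgn_eq)
  have \<phi>m: "\<phi> n \<in> borel_measurable borel" for n by (rule smooth_borel_measurable[OF smooth_inD[OF \<phi>]])
  let ?g = "\<lambda>x. indicator (cbox a b) x * g x"
  have "(\<lambda>n. LINT x|lborel. ?g x * \<phi> n x) \<longlonglongrightarrow> (LINT x|lborel. ?g x * h x)"
  proof (rule integral_dominated_convergence)
    show "(\<lambda>x. ?g x * h x) \<in> borel_measurable lborel" using g h by measurable
    show "(\<lambda>x. ?g x * \<phi> n x) \<in> borel_measurable lborel" for n using g \<phi>m by measurable
    show "integrable lborel (\<lambda>x. \<bar>?g x\<bar>)" using gi by (rule integrable_abs)
    show "AE x in lborel. (\<lambda>n. ?g x * \<phi> n x) \<longlonglongrightarrow> ?g x * h x"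
      using lim AE_box_of_cbox[of a b]
    proof eventually_elim
      case (elim x)
      show ?case
      proof (cases "x \<in> cbox a b")
        case True
        then show ?thesis using elim by (intro tendsto_mult tendsto_const) blast
      qed simp
    qed
    show "AE x in lborel. norm (?g x * \<phi> n x) \<le> \<bar>?g x\<bar>" for n
      using \<phi>1[of n] by (intro AE_I2) (simp add: abs_mult mult_left_le)
  qed
  moreover have "(LINT x|lborel. ?g x * \<phi> n x) = (LINT x|lborel. g x * \<phi> n x)" for n
    using smooth_in_outside[OF \<phi>[of n]] by (intro Bochner_Integration.integral_cong) (auto simp: indicator_def)
  moreover have "(\<lambda>x. ?g x * h x) = (\<lambda>x. indicator (cbox a b) x * \<bar>g x\<bar>)"
    by (simp add: h_def abs_sgn mult.assoc)
  ultimately have "(\<lambda>n. LINT x|lborel. g x * \<phi> n x) \<longlonglongrightarrow> (LINT x|lborel. indicator (cbox a b) x * \<bar>g x\<bar>)"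
    by simp
  moreover have "(LINT x|lborel. g x * \<phi> n x) \<le> B" for n
  proof -
    have "\<bar>LINT x|lborel. g x * \<phi> n x\<bar> \<le> B" by (rule B[OF \<phi>]) (rule \<phi>1)
    then show ?thesis by linarith
  qed
  ultimately show ?thesis by (intro LIMSEQ_le_const2) blast+
qed

text \<open>The series of absolute values has a finite integral, so it is finite almost
  everywhere.\<close>

lemma AE_summable_of_L1:
  fixes f :: "nat \<Rightarrow> 'a \<Rightarrow> real"
  assumes f: "\<And>k. integrable M (f k)" and s: "summable (\<lambda>k. LINT x|M. \<bar>f k x\<bar>)"
  shows "AE x in M. summable (\<lambda>k. \<bar>f k x\<bar>)"
proof -
  have [measurable]: "f k \<in> borel_measurable M" for k by (rule borel_measurable_integrable[OF f])
  have "(\<integral>\<^sup>+x. (\<Sum>k. ennreal \<bar>f k x\<bar>) \<partial>M) = (\<Sum>k. \<integral>\<^sup>+x. ennreal \<bar>f k x\<bar> \<partial>M)"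
    by (rule nn_integral_suminf) measurable
  also have "\<dots> = (\<Sum>k. ennreal (LINT x|M. \<bar>f k x\<bar>))"
    by (intro suminf_cong nn_integral_eq_integral integrable_abs f) auto
  also have "\<dots> \<noteq> \<infinity>"
    using s by (simp add: ennreal_suminf_neq_top integral_nonneg_AE)
  finally have "AE x in M. (\<Sum>k. ennreal \<bar>f k x\<bar>) \<noteq> \<infinity>"
    by (intro nn_integral_noteq_infinite) auto
  then show ?thesis
  proof (rule AE_mp, intro AE_I2 impI)
    fix x assume "(\<Sum>k. ennreal \<bar>f k x\<bar>) \<noteq> \<infinity>"
    then show "summable (\<lambda>k. \<bar>f k x\<bar>)" by (intro summable_suminf_not_top) auto
  qed
qed

text \<open>Riesz representation without completeness of \<open>L\<^sup>2\<close>: a minimising sequence of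
  \<open>\<phi> \<mapsto> \<integral>\<phi>\<^sup>2 / 2 - l \<phi>\<close> is Cauchy in \<open>L\<^sup>2\<close>, hence in \<open>L\<^sup>1\<close>, and its limit represents \<open>l\<close>.\<close>

lemma smooth_functional_representation:
  fixes l :: "(real^'n::finite \<Rightarrow> real) \<Rightarrow> real"
  assumes K: "compact K" and l: "linear_on_smooth K l"
    and bd: "\<And>\<phi>. \<phi> \<in> smooth_in K \<Longrightarrow> \<bar>l \<phi>\<bar> \<le> B * (1 + L2_sq \<phi>)"
  obtains g where "g \<in> borel_measurable borel" "integrable lborel g"
    "\<And>\<phi>. \<phi> \<in> smooth_in K \<Longrightarrow> l \<phi> = (LINT x|lborel. g x * \<phi> x)"
proof -
  define E where "E = (\<lambda>\<phi>::real^'n \<Rightarrow> real. L2_sq \<phi>)"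
  define J where "J = (\<lambda>\<phi>. E \<phi> / 2 - l \<phi>)"
  define ip where "ip = (\<lambda>\<phi> \<psi> :: real^'n \<Rightarrow> real. LINT x|lborel. \<phi> x * \<psi> x)"
  note [simp] = smooth_in_add[of _ K] smooth_in_cmult[of _ K] smooth_in_diff[of _ K]
  have isq: "integrable lborel (\<lambda>x. (\<phi> x)\<^sup>2)" if "\<phi> \<in> smooth_in K" for \<phi>
    by (rule smooth_in_integrable_square[OF that K])
  have iip: "integrable lborel (\<lambda>x. \<phi> x * \<psi> x)" if "\<phi> \<in> smooth_in K" "\<psi> \<in> smooth_in K" for \<phi> \<psi>
    by (rule smooth_in_integrable[OF that(1) K smooth_continuous_on[OF smooth_inD[OF that(2)] continuous_on_id]])
  have E_comb: "E (\<lambda>x. \<phi> x + t * \<psi> x) = E \<phi> + 2 * t * ip \<phi> \<psi> + t\<^sup>2 * E \<psi>"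
    if "\<phi> \<in> smooth_in K" "\<psi> \<in> smooth_in K" for \<phi> \<psi> t
  proof -
    have "E (\<lambda>x. \<phi> x + t * \<psi> x) = (LINT x|lborel. (\<phi> x)\<^sup>2 + 2 * t * (\<phi> x * \<psi> x) + t\<^sup>2 * (\<psi> x)\<^sup>2)"
      unfolding E_def by (intro Bochner_Integration.integral_cong) (auto simp: power2_sum power_mult_distrib)
    then show ?thesis
      using isq iip that by (simp add: E_def ip_def)
  qed
  have l_comb: "l (\<lambda>x. \<phi> x + t * \<psi> x) = l \<phi> + t * l \<psi>"
    if "\<phi> \<in> smooth_in K" "\<psi> \<in> smooth_in K" for \<phi> \<psi> t
    using that by (simp add: linear_on_smooth_add[OF l] linear_on_smooth_cmult[OF l])
  have E0: "E \<phi> \<ge> 0" for \<phi> unfolding E_def by (intro integral_nonneg_AE) auto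
  define C where "C = max B 1"
  have J_below: "J \<phi> \<ge> - (2 * C\<^sup>2)" if \<phi>: "\<phi> \<in> smooth_in K" for \<phi>
  proof -
    \<comment> \<open>Applying the bound to t \<phi> and dividing by t gives l \<phi> \<le> C / t +
      C t E; this \<open>t\<close> makes the second term equal to the E / 2 in
      \<open>J\<close>.\<close>
    define t where "t = 1 / (2 * C)"
    have C: "C > 0" "B \<le> C" by (auto simp: C_def)
    then have t: "t > 0" by (simp add: t_def)
    have "t * l \<phi> = l (\<lambda>x. t * \<phi> x)" using linear_on_smooth_cmult[OF l \<phi>] by simp
    also have "\<dots> \<le> B * (1 + E (\<lambda>x. t * \<phi> x))"
      using bd[OF smooth_in_cmult[OF \<phi>, of t]] by (simp add: E_def abs_le_iff)
    also have "\<dots> \<le> C * (1 + E (\<lambda>x. t * \<phi> x))" using C E0 by (intro mult_right_mono) auto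
    also have "E (\<lambda>x. t * \<phi> x) = t\<^sup>2 * E \<phi>" by (simp add: E_def power_mult_distrib)
    finally have "l \<phi> \<le> C * (1 + t\<^sup>2 * E \<phi>) / t" using t by (simp add: field_simps)
    also have "\<dots> = 2 * C\<^sup>2 + E \<phi> / 2" using C by (simp add: t_def field_simps power2_eq_square)
    finally show ?thesis by (simp add: J_def)
  qed
  define I where "I = Inf (J ` smooth_in K)"
  have bdd: "bdd_below (J ` smooth_in K)" using J_below by (intro bdd_belowI2) auto
  have I: "I \<le> J \<phi>" if "\<phi> \<in> smooth_in K" for \<phi> unfolding I_def using that bdd by (intro cInf_lower) auto
  \<comment> \<open>Errors 4^(-k) in the functional become 2^(-k) for norms of differences, which is
    summable.\<close>
  have "\<exists>\<phi>\<in>smooth_in K. J \<phi> < I + (1/4) ^ k" for k :: nat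
  proof -
    have "Inf (J ` smooth_in K) < I + (1/4) ^ k" by (simp add: I_def)
    then show ?thesis using cInf_lessD[of "J ` smooth_in K"] smooth_in_zero by blast
  qed
  then obtain \<phi> where \<phi>: "\<And>k::nat. \<phi> k \<in> smooth_in K" and J\<phi>: "\<And>k. J (\<phi> k) < I + (1/4) ^ k" by metis
  define d where "d = (\<lambda>k x. \<phi> (Suc k) x - \<phi> k x)"
  have d: "d k \<in> smooth_in K" for k unfolding d_def using \<phi> by simp
  define V where "V = measure lborel K"
  have Ed: "E (d k) \<le> 8 * (1/4) ^ k" for k
  proof -
    \<comment> \<open>The midpoint of two consecutive terms: by the parallelogram identity the
      energy of the difference is 4 J + 4 J - 8 J at the ends and the midpoint, and \<open>J\<close>
      is nearly minimal at the ends.\<close>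
    define \<psi> where "\<psi> = (\<lambda>x. \<phi> k x + (1/2) * d k x)"
    have \<psi>: "\<psi> \<in> smooth_in K" unfolding \<psi>_def by (intro smooth_in_add smooth_in_cmult \<phi> d)
    have s: "\<phi> (Suc k) = (\<lambda>x. \<phi> k x + 1 * d k x)" by (rule ext) (simp add: d_def)
    have 1: "J \<psi> = (E (\<phi> k) + ip (\<phi> k) (d k) + E (d k) / 4) / 2 - l (\<phi> k) - l (d k) / 2"
      unfolding J_def \<psi>_def E_comb[OF \<phi> d] l_comb[OF \<phi> d] by (simp add: power2_eq_square)
    have 2: "J (\<phi> (Suc k)) = (E (\<phi> k) + 2 * ip (\<phi> k) (d k) + E (d k)) / 2 - l (\<phi> k) - l (d k)"
      unfolding J_def s E_comb[OF \<phi> d] l_comb[OF \<phi> d] by simp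
    have "E (d k) = 4 * J (\<phi> k) + 4 * J (\<phi> (Suc k)) - 8 * J \<psi>"
      unfolding 1 2 by (simp add: J_def field_simps)
    moreover have "J (\<phi> (Suc k)) \<le> I + (1/4) ^ k"
      using J\<phi>[of "Suc k"] power_decreasing[of k "Suc k" "1/4::real"] by linarith
    ultimately show ?thesis using J\<phi>[of k] I[OF \<psi>] by linarith
  qed
  have Ld: "(LINT x|lborel. \<bar>d k x\<bar>) \<le> sqrt (8 * V) * (1/2) ^ k" for k
  proof (rule power2_le_imp_le)
    have "(LINT x|lborel. \<bar>d k x\<bar>)\<^sup>2 \<le> V * E (d k)"
      unfolding V_def E_def by (rule smooth_in_L1_square_le[OF d K])
    also have "\<dots> \<le> V * (8 * (1/4) ^ k)" using Ed by (intro mult_left_mono) (auto simp: V_def)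
    also have "\<dots> = (sqrt (8 * V) * (1/2) ^ k)\<^sup>2"
      by (simp add: power_mult_distrib V_def power_mult[symmetric] mult.commute[of k] power_divide)
        (simp add: power_mult)
    finally show "(LINT x|lborel. \<bar>d k x\<bar>)\<^sup>2 \<le> (sqrt (8 * V) * (1/2) ^ k)\<^sup>2" .
  qed (simp add: V_def)
  have id: "integrable lborel (d k)" for k by (rule smooth_in_integrable1[OF d K])
  have sd: "summable (\<lambda>k. LINT x|lborel. \<bar>d k x\<bar>)"
    by (rule summable_comparison_test'[of "\<lambda>k. sqrt (8 * V) * (1/2) ^ k" 0])
      (use Ld in \<open>auto simp: integral_nonneg_AE intro!: summable_mult summable_geometric\<close>)
  have ae: "AE x in lborel. summable (\<lambda>k. \<bar>d k x\<bar>)" by (rule AE_summable_of_L1[OF id sd])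
  \<comment> \<open>The limit of the minimising sequence, written as a telescoping series.\<close>
  define g where "g = (\<lambda>x. \<phi> 0 x + (\<Sum>k. d k x))"
  have meas: "\<phi> k \<in> borel_measurable borel" "d k \<in> borel_measurable borel" for k
    using smooth_borel_measurable[OF smooth_inD[OF \<phi>]] smooth_borel_measurable[OF smooth_inD[OF d]] by auto
  show ?thesis
  proof
    show "g \<in> borel_measurable borel" unfolding g_def using meas by measurable
    show "integrable lborel g" unfolding g_def
      using integrable_suminf[OF id] ae sd smooth_in_integrable1[OF \<phi> K] by (intro Bochner_Integration.integrable_add) auto
    fix \<psi> assume \<psi>: "\<psi> \<in> smooth_in K"
    obtain M where M: "M \<ge> 0" "\<And>x. \<bar>\<psi> x\<bar> \<le> M" using smooth_in_bounded[OF \<psi> K] by metis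
    have id\<psi>: "integrable lborel (\<lambda>x. d k x * \<psi> x)" for k by (rule iip[OF d \<psi>])
    have ae\<psi>: "AE x in lborel. summable (\<lambda>k. norm (d k x * \<psi> x))"
      using ae by (rule AE_mp) (auto simp: abs_mult intro!: summable_mult2)
    have sd\<psi>: "summable (\<lambda>k. LINT x|lborel. norm (d k x * \<psi> x))"
    proof (rule summable_comparison_test'[OF summable_mult[OF sd, of M], of 0])
      fix k
      have "(LINT x|lborel. norm (d k x * \<psi> x)) \<le> (LINT x|lborel. M * \<bar>d k x\<bar>)"
      proof (rule integral_mono)
        show "integrable lborel (\<lambda>x. norm (d k x * \<psi> x))" by (rule integrable_norm[OF id\<psi>])
        show "integrable lborel (\<lambda>x. M * \<bar>d k x\<bar>)" using id by (intro integrable_mult_right integrable_abs)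
        show "norm (d k x * \<psi> x) \<le> M * \<bar>d k x\<bar>" for x
          using mult_right_mono[OF M(2)[of x], of "\<bar>d k x\<bar>"] by (simp add: abs_mult mult.commute)
      qed
      then show "norm (LINT x|lborel. norm (d k x * \<psi> x)) \<le> M * (LINT x|lborel. \<bar>d k x\<bar>)"
        by (simp add: integral_nonneg_AE)
    qed
    have "(\<lambda>k. ip (\<phi> 0) \<psi> + (\<Sum>j<k. LINT x|lborel. d j x * \<psi> x)) \<longlonglongrightarrow> ip (\<phi> 0) \<psi> + (LINT x|lborel. (\<Sum>k. d k x * \<psi> x))"
      using sums_integral[OF id\<psi> ae\<psi> sd\<psi>] unfolding sums_def by (intro tendsto_intros)
    moreover have "ip (\<phi> 0) \<psi> + (\<Sum>j<k. LINT x|lborel. d j x * \<psi> x) = ip (\<phi> k) \<psi>" for k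
    proof (induction k)
      case (Suc k)
      have "ip (\<phi> (Suc k)) \<psi> = (LINT x|lborel. \<phi> k x * \<psi> x + d k x * \<psi> x)"
        by (simp add: ip_def d_def algebra_simps)
      also have "\<dots> = ip (\<phi> k) \<psi> + (LINT x|lborel. d k x * \<psi> x)"
        unfolding ip_def by (intro Bochner_Integration.integral_add iip \<phi> \<psi> id\<psi>)
      finally show ?case using Suc by simp
    qed simp
    moreover have "ip (\<phi> 0) \<psi> + (LINT x|lborel. (\<Sum>k. d k x * \<psi> x)) = (LINT x|lborel. g x * \<psi> x)"
    proof -
      have "ip (\<phi> 0) \<psi> + (LINT x|lborel. (\<Sum>k. d k x * \<psi> x)) = (LINT x|lborel. \<phi> 0 x * \<psi> x + (\<Sum>k. d k x * \<psi> x))"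
        unfolding ip_def
        by (intro Bochner_Integration.integral_add[symmetric] iip \<phi> \<psi> integrable_suminf[OF id\<psi> ae\<psi> sd\<psi>])
      also have "\<dots> = (LINT x|lborel. g x * \<psi> x)"
      proof (rule integral_cong_AE)
        show "(\<lambda>x. \<phi> 0 x * \<psi> x + (\<Sum>k. d k x * \<psi> x)) \<in> borel_measurable lborel"
          "(\<lambda>x. g x * \<psi> x) \<in> borel_measurable lborel"
          unfolding g_def using meas smooth_borel_measurable[OF smooth_inD[OF \<psi>]] by measurable
        show "AE x in lborel. \<phi> 0 x * \<psi> x + (\<Sum>k. d k x * \<psi> x) = g x * \<psi> x"
          using ae
        proof eventually_elim
          case (elim x)
          then have "summable (\<lambda>k. d k x)" by (rule summable_rabs_cancel)
          then show ?case by (simp add: g_def distrib_right suminf_mult2)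
        qed
      qed
      finally show ?thesis .
    qed
    ultimately have 1: "(\<lambda>k. ip (\<phi> k) \<psi>) \<longlonglongrightarrow> (LINT x|lborel. g x * \<psi> x)" by simp
    have 2: "\<bar>ip (\<phi> k) \<psi> - l \<psi>\<bar> \<le> (1 + E \<psi> / 2) * (1/2) ^ k" for k
    proof -
      \<comment> \<open>\<open>\<phi> k\<close> is minimal up to \<tau>^2. Moving it by s \<psi>
        with s = \<tau> and s = -\<tau> bounds the first variation by a multiple of \<tau>, which is
        the Euler equation in the limit.\<close>
      define \<tau> :: real where "\<tau> = (1/2) ^ k"
      have \<tau>: "\<tau> > 0" "(1/4) ^ k = \<tau> * \<tau>" by (auto simp: \<tau>_def power_mult_distrib[symmetric])
      have *: "- (s * (ip (\<phi> k) \<psi> - l \<psi>)) \<le> \<tau> * \<tau> + s\<^sup>2 * E \<psi> / 2" for s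
      proof -
        have "I \<le> J (\<lambda>x. \<phi> k x + s * \<psi> x)" using \<phi> \<psi> by (intro I) simp
        also have "\<dots> = J (\<phi> k) + s * (ip (\<phi> k) \<psi> - l \<psi>) + s\<^sup>2 * E \<psi> / 2"
          unfolding J_def E_comb[OF \<phi> \<psi>] l_comb[OF \<phi> \<psi>] by (simp add: field_simps)
        finally show ?thesis using J\<phi>[of k] \<tau> by linarith
      qed
      have "\<tau> * \<bar>ip (\<phi> k) \<psi> - l \<psi>\<bar> \<le> \<tau> * ((1 + E \<psi> / 2) * \<tau>)"
        using *[of \<tau>] *[of "- \<tau>"] \<tau>(1) by (simp add: abs_if power2_eq_square algebra_simps)
      then show ?thesis using \<tau>(1) by (simp add: \<tau>_def)
    qed
    have "(\<lambda>k. ip (\<phi> k) \<psi> - l \<psi>) \<longlonglongrightarrow> 0"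
    proof (rule Lim_null_comparison)
      show "\<forall>\<^sub>F k in sequentially. norm (ip (\<phi> k) \<psi> - l \<psi>) \<le> (1 + E \<psi> / 2) * (1/2) ^ k"
        using 2 by (intro always_eventually) simp
      have "(\<lambda>k. (1 + E \<psi> / 2) * (1/2) ^ k) \<longlonglongrightarrow> (1 + E \<psi> / 2) * 0"
        by (intro tendsto_mult tendsto_const LIMSEQ_realpow_zero) auto
      then show "(\<lambda>k. (1 + E \<psi> / 2) * (1/2) ^ k) \<longlonglongrightarrow> 0" by simp
    qed
    then have "(\<lambda>k. ip (\<phi> k) \<psi>) \<longlonglongrightarrow> l \<psi>" by (simp add: LIM_zero_iff)
    with 1 show "l \<psi> = (LINT x|lborel. g x * \<psi> x)" using LIMSEQ_unique by blast
  qed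
qed

section \<open>The interior estimate on arbitrary cubes\<close>

definition cube_at :: "real^'n::finite \<Rightarrow> real \<Rightarrow> (real^'n) set" where
  "cube_at x0 r = cbox (x0 - (\<chi> i. r)) (x0 + (\<chi> i. r))"

lemma mem_cube_at: "x \<in> cube_at x0 r \<longleftrightarrow> (\<forall>i. \<bar>x $ i - x0 $ i\<bar> \<le> r)"
  by (auto simp: cube_at_def mem_box_cart abs_le_iff algebra_simps)

lemma compact_cube_at [simp]: "compact (cube_at x0 r)"
  by (simp add: cube_at_def compact_cbox)

lemma cube_at_mono: "r \<le> s \<Longrightarrow> cube_at x0 r \<subseteq> cube_at x0 s"
  by (meson mem_cube_at order_trans subsetI)

text \<open>Rescaling to the unit cube. The gradient bound is scale invariant, since both of its
  sides contain first derivatives only; \<open>D\<close> is therefore unchanged, and the volume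
  factor r^n appears in front of the constant 1 only.\<close>

lemma interior_estimate:
  assumes \<delta>: "0 < \<delta>" "\<delta> \<le> 1"
  obtains C where "C \<ge> 0"
    "\<And>(u :: (real^'n::finite \<Rightarrow> real) \<Rightarrow> real) D x0 r. r > 0 \<Longrightarrow> D \<ge> 0 \<Longrightarrow>
      linear_on_smooth (cube_at x0 ((1 + \<delta>) * r)) u \<Longrightarrow> gradient_bound (cube_at x0 ((1 + \<delta>) * r)) u D \<Longrightarrow>
      \<exists>c. \<forall>a\<in>smooth_in (cube_at x0 r).
        \<bar>u a - c * (LINT x|lborel. a x)\<bar> \<le> C * D * (r ^ CARD('n) + L2_sq a)"
proof -
  obtain C where C: "C \<ge> 0" and est:
    "\<And>(v :: (real^'n \<Rightarrow> real) \<Rightarrow> real) D. linear_on_smooth (cube (1 + \<delta>)) v \<Longrightarrow> gradient_bound (cube (1 + \<delta>)) v D \<Longrightarrow> D \<ge> 0 \<Longrightarrow>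
      \<exists>c. \<forall>a\<in>smooth_in (cube 1). \<bar>v a - c * (LINT x|lborel. a x)\<bar> \<le> C * D * (1 + L2_sq a)"
    using interior_estimate_unit[OF \<delta>, where 'n = 'n] by metis
  show ?thesis
  proof (rule that[OF C])
    fix u :: "(real^'n \<Rightarrow> real) \<Rightarrow> real" and D x0 and r :: real
    assume r: "r > 0" and D: "D \<ge> 0"
      and lin: "linear_on_smooth (cube_at x0 ((1 + \<delta>) * r)) u" and gb: "gradient_bound (cube_at x0 ((1 + \<delta>) * r)) u D"
    define m where "m = r ^ CARD('n)"
    have m: "m > 0" using r by (simp add: m_def)
    define b where "b = - ((1/r) *\<^sub>R x0)"
    define pull where "pull = (\<lambda>(f :: real^'n \<Rightarrow> real) x. f (b + (1/r) *\<^sub>R x))"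
    have cb: "b + (1/r) *\<^sub>R x \<in> cube s \<longleftrightarrow> x \<in> cube_at x0 (s * r)" for x s
    proof -
      have "(b + (1/r) *\<^sub>R x) $ i = (x $ i - x0 $ i) / r" for i
        using r by (simp add: b_def diff_divide_distrib)
      then show ?thesis using r by (simp add: mem_cube mem_cube_at abs_divide divide_le_eq)
    qed
    have pull_in: "pull f \<in> smooth_in (cube_at x0 (s * r))" if "f \<in> smooth_in (cube s)" for f s
      using that smooth_affine(1)[of f b "1/r"] cb by (auto simp: smooth_in_def pull_def)
    have pull_int: "(LINT x|lborel. F (b + (1/r) *\<^sub>R x)) = m * (LINT x|lborel. F x)"
      if "F \<in> borel_measurable borel" for F :: "real^'n \<Rightarrow> real"
      using lborel_integral_affine[OF that, of "1/r" b] r by (simp add: m_def power_divide field_simps)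
    define v where "v = (\<lambda>f. u (pull f) / m)"
    have "linear_on_smooth (cube (1 + \<delta>)) v"
      unfolding linear_on_smooth_def v_def
    proof (intro conjI ballI allI)
      fix f g :: "real^'n \<Rightarrow> real" and c assume f: "f \<in> smooth_in (cube (1 + \<delta>))"
      show "u (pull (\<lambda>x. c * f x)) / m = c * (u (pull f) / m)"
        using linear_on_smooth_cmult[OF lin pull_in[OF f], of c] by (simp add: pull_def)
      assume g: "g \<in> smooth_in (cube (1 + \<delta>))"
      show "u (pull (\<lambda>x. f x + g x)) / m = u (pull f) / m + u (pull g) / m"
        using linear_on_smooth_add[OF lin pull_in[OF f] pull_in[OF g]] by (simp add: pull_def add_divide_distrib)
    qed
    moreover have "gradient_bound (cube (1 + \<delta>)) v D"
      unfolding gradient_bound_def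
    proof (intro ballI allI)
      fix \<psi> :: "real^'n \<Rightarrow> real" and i assume \<psi>: "\<psi> \<in> smooth_in (cube (1 + \<delta>))"
      note \<psi>s = smooth_inD[OF \<psi>]
      \<comment> \<open>The factor \<open>r\<close> compensates 1 / r from the chain rule, so the
        derivatives of this function are the pulled back derivatives of \<psi>.\<close>
      have in': "(\<lambda>x. r * pull \<psi> x) \<in> smooth_in (cube_at x0 ((1 + \<delta>) * r))" by (intro smooth_in_cmult pull_in \<psi>)
      have pd: "partial_deriv j (\<lambda>x. r * pull \<psi> x) = pull (partial_deriv j \<psi>)" for j
        using partial_deriv_cmult[OF smooth_inD[OF pull_in[OF \<psi>]], of j r] partial_deriv_affine[OF \<psi>s, of j b "1/r"] r
        by (simp add: pull_def)
      have "\<bar>u (pull (partial_deriv i \<psi>))\<bar> \<le> D * (\<Sum>j\<in>UNIV. LINT x|lborel. \<bar>pull (partial_deriv j \<psi>) x\<bar>)"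
        using gb[unfolded gradient_bound_def, rule_format, OF in', of i] unfolding pd .
      also have "(\<Sum>j\<in>UNIV. LINT x|lborel. \<bar>pull (partial_deriv j \<psi>) x\<bar>) = (\<Sum>j\<in>UNIV. m * L1_norm (partial_deriv j \<psi>))"
      proof (rule sum.cong[OF refl])
        fix j
        have "(\<lambda>x. \<bar>partial_deriv j \<psi> x\<bar>) \<in> borel_measurable borel"
          using smooth_borel_measurable[OF smooth_partial[OF \<psi>s, of j]] by measurable
        from pull_int[OF this] show "(LINT x|lborel. \<bar>pull (partial_deriv j \<psi>) x\<bar>) = m * L1_norm (partial_deriv j \<psi>)"
          by (simp add: pull_def)
      qed
      finally show "\<bar>v (partial_deriv i \<psi>)\<bar> \<le> D * grad_L1 \<psi>"
        using m by (simp add: v_def sum_distrib_left[symmetric] abs_divide divide_le_eq mult.commute mult.left_commute)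
    qed
    ultimately obtain c where c: "\<And>a. a \<in> smooth_in (cube 1) \<Longrightarrow>
        \<bar>v a - c * (LINT x|lborel. a x)\<bar> \<le> C * D * (1 + L2_sq a)"
      using est[OF _ _ D] by metis
    show "\<exists>c. \<forall>a\<in>smooth_in (cube_at x0 r). \<bar>u a - c * (LINT x|lborel. a x)\<bar> \<le> C * D * (r ^ CARD('n) + L2_sq a)"
    proof (intro exI ballI)
      fix a assume a: "a \<in> smooth_in (cube_at x0 r)"
      define a' where "a' = (\<lambda>z. a (x0 + r *\<^sub>R z))"
      have pa: "pull a' = a" using r by (auto simp: pull_def a'_def b_def fun_eq_iff scaleR_right_diff_distrib algebra_simps)
      have "a' z = 0" if "z \<notin> cube 1" for z
      proof -
        have "b + (1/r) *\<^sub>R (x0 + r *\<^sub>R z) = z" using r by (simp add: b_def scaleR_right_distrib)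
        then have "x0 + r *\<^sub>R z \<notin> cube_at x0 (1 * r)" using cb[of "x0 + r *\<^sub>R z" 1] that by simp
        then show ?thesis using smooth_in_outside[OF a] by (simp add: a'_def)
      qed
      then have a'_in: "a' \<in> smooth_in (cube 1)"
        using smooth_affine(1)[OF smooth_inD[OF a], of x0 r] by (auto simp: smooth_in_def a'_def)
      have m': "a' \<in> borel_measurable borel" by (rule smooth_borel_measurable[OF smooth_inD[OF a'_in]])
      then have m'': "(\<lambda>x. (a' x)\<^sup>2) \<in> borel_measurable borel" by measurable
      have i1: "(LINT x|lborel. a x) = m * (LINT x|lborel. a' x)"
        using pull_int[OF m'] unfolding pa[symmetric] by (simp add: pull_def)
      have i2: "L2_sq a = m * L2_sq a'"
        using pull_int[OF m''] unfolding pa[symmetric] by (simp add: pull_def)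
      have va: "v a' = u a / m" by (simp add: v_def pa)
      have "\<bar>u a - c * (LINT x|lborel. a x)\<bar> = m * \<bar>v a' - c * (LINT x|lborel. a' x)\<bar>"
      proof -
        have "u a - c * (LINT x|lborel. a x) = m * (v a' - c * (LINT x|lborel. a' x))"
          using m by (simp add: va i1 right_diff_distrib)
        then show ?thesis using m by (simp add: abs_mult)
      qed
      also have "\<dots> \<le> m * (C * D * (1 + L2_sq a'))" using m c[OF a'_in] by (intro mult_left_mono) auto
      also have "\<dots> = C * D * (m + L2_sq a)" unfolding i2 by (simp add: algebra_simps)
      finally show "\<bar>u a - c * (LINT x|lborel. a x)\<bar> \<le> C * D * (r ^ CARD('n) + L2_sq a)"
        by (simp add: m_def)
    qed
  qed
qed

section \<open>From local to global densities\<close>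

lemma partition_of_unity_boxes:
  fixes a b :: "'k \<Rightarrow> real^'n::finite"
  assumes A: "finite A" and K: "compact K" and cov: "K \<subseteq> (\<Union>k\<in>A. box (a k) (b k))"
  obtains \<theta> where "\<And>k. k \<in> A \<Longrightarrow> \<theta> k \<in> smooth_in (cbox (a k) (b k))" "\<And>x. x \<in> K \<Longrightarrow> (\<Sum>k\<in>A. \<theta> k x) = 1"
proof (cases "K = {}")
  case True
  then show ?thesis using that[of "\<lambda>k x. 0"] smooth_in_zero by blast
next
  case False
  define H where "H = (\<lambda>x. \<Sum>k\<in>A. box_bump (a k) (b k) x)"
  have H: "smooth H" unfolding H_def by (intro smooth_sum smooth_box_bump)
  have H0: "H x \<ge> 0" for x unfolding H_def by (intro sum_nonneg box_bump_nonneg)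
  have Hpos: "H x > 0" if x: "x \<in> K" for x
  proof -
    obtain k where k: "k \<in> A" "x \<in> box (a k) (b k)" using cov x by blast
    then have "0 < box_bump (a k) (b k) x" using box_bump_pos_iff by blast
    also have "\<dots> \<le> H x" unfolding H_def using k A by (intro member_le_sum box_bump_nonneg) auto
    finally show ?thesis .
  qed
  obtain x0 where x0: "x0 \<in> K" and min: "\<And>x. x \<in> K \<Longrightarrow> H x0 \<le> H x"
    using continuous_attains_inf[OF K False smooth_continuous_on[OF H continuous_on_id]] by blast
  \<comment> \<open>A denominator that is positive everywhere: the added term is positive exactly
    where \<open>H\<close> is below its minimum over \<open>K\<close>, so it vanishes on
    \<open>K\<close> and there the quotients add up to 1.\<close>
  define G where "G = (\<lambda>x. H x + exp_bump (H x0 - H x))"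
  have G: "smooth G"
    unfolding G_def by (intro smooth_add H smooth_compose_real[OF _ smooth_real_exp_bump] smooth_diff smooth_constI)
  have Gpos: "G x > 0" for x
  proof (cases "H x > 0")
    case True then show ?thesis by (simp add: G_def add_pos_nonneg)
  next
    case False
    then have "H x = 0" using H0[of x] by linarith
    then show ?thesis using Hpos[OF x0] by (simp add: G_def)
  qed
  define \<theta> where "\<theta> = (\<lambda>k x. box_bump (a k) (b k) x * inverse (G x))"
  show ?thesis
  proof
    show "\<theta> k \<in> smooth_in (cbox (a k) (b k))" for k
    proof -
      have "smooth (\<theta> k)" unfolding \<theta>_def using Gpos by (intro smooth_mult smooth_box_bump smooth_inverse G) auto
      moreover have "\<theta> k x = 0" if "x \<notin> cbox (a k) (b k)" for x
      proof -
        have "x \<notin> box (a k) (b k)" using that box_subset_cbox by blast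
        then have "box_bump (a k) (b k) x = 0" using box_bump_pos_iff[of "a k" "b k" x] box_bump_nonneg[of "a k" "b k" x] by linarith
        then show ?thesis by (simp add: \<theta>_def)
      qed
      ultimately show ?thesis unfolding smooth_in_def by blast
    qed
    show "(\<Sum>k\<in>A. \<theta> k x) = 1" if "x \<in> K" for x
    proof -
      have "(\<Sum>k\<in>A. \<theta> k x) = H x * inverse (G x)" by (simp add: \<theta>_def H_def sum_distrib_right)
      also have "G x = H x" using min[OF that] by (simp add: G_def)
      finally show ?thesis using Hpos[OF that] by simp
    qed
  qed
qed

text \<open>The difference of the densities annihilates all test functions in the intersection,
  which is again a box, so duality applies with bound 0.\<close>

lemma local_densities_agree:
  fixes g g' :: "real^'n::finite \<Rightarrow> real"
  assumes g: "g \<in> borel_measurable borel" "integrable lborel g" and g': "g' \<in> borel_measurable borel" "integrable lborel g'"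
    and l: "\<And>\<phi>. \<phi> \<in> smooth_in (cbox a b) \<Longrightarrow> l \<phi> = (LINT x|lborel. g x * \<phi> x)"
    and l': "\<And>\<phi>. \<phi> \<in> smooth_in (cbox a' b') \<Longrightarrow> l \<phi> = (LINT x|lborel. g' x * \<phi> x)"
  shows "AE x in lborel. x \<in> cbox a b \<inter> cbox a' b' \<longrightarrow> g x = g' x"
proof -
  obtain c d where cd: "cbox a b \<inter> cbox a' b' = cbox c d" using Int_interval by blast
  have gi: "integrable lborel (\<lambda>x. indicator (cbox c d) x * (g x - g' x))"
    using integrable_mult_indicator[of "cbox c d" lborel "\<lambda>x. g x - g' x"] g g' by simp
  have "(LINT x|lborel. indicator (cbox c d) x * \<bar>g x - g' x\<bar>) \<le> 0"
  proof (rule L1_bound_by_duality[OF _ gi])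
    show "(\<lambda>x. g x - g' x) \<in> borel_measurable borel" using g g' by measurable
    fix \<phi> :: "real^'n \<Rightarrow> real" assume \<phi>: "\<phi> \<in> smooth_in (cbox c d)" and \<phi>1: "\<And>x. \<bar>\<phi> x\<bar> \<le> 1"
    have \<phi>m: "\<phi> \<in> borel_measurable borel" by (rule smooth_borel_measurable[OF smooth_inD[OF \<phi>]])
    have int: "integrable lborel (\<lambda>x. h x * \<phi> x)" if "integrable lborel h" "h \<in> borel_measurable borel" for h :: "real^'n \<Rightarrow> real"
    proof (rule Bochner_Integration.integrable_bound[OF that(1)])
      show "(\<lambda>x. h x * \<phi> x) \<in> borel_measurable lborel" using that \<phi>m by measurable
      show "AE x in lborel. norm (h x * \<phi> x) \<le> norm (h x)" using \<phi>1 by (intro AE_I2) (simp add: abs_mult mult_left_le)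
    qed
    have "cbox c d \<subseteq> cbox a b" "cbox c d \<subseteq> cbox a' b'" using cd by blast+
    then have "(LINT x|lborel. g x * \<phi> x) = (LINT x|lborel. g' x * \<phi> x)"
      using l[OF smooth_in_mono[OF \<phi>]] l'[OF smooth_in_mono[OF \<phi>]] by simp
    moreover have "(LINT x|lborel. (g x - g' x) * \<phi> x) = (LINT x|lborel. g x * \<phi> x) - (LINT x|lborel. g' x * \<phi> x)"
      unfolding left_diff_distrib by (intro Bochner_Integration.integral_diff int g g')
    ultimately show "\<bar>LINT x|lborel. (g x - g' x) * \<phi> x\<bar> \<le> 0" by simp
  qed
  moreover have "(LINT x|lborel. indicator (cbox c d) x * \<bar>g x - g' x\<bar>) \<ge> 0"
    by (intro integral_nonneg_AE) auto
  ultimately have "(LINT x|lborel. indicator (cbox c d) x * \<bar>g x - g' x\<bar>) = 0" by linarith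
  moreover have "integrable lborel (\<lambda>x. indicator (cbox c d) x * \<bar>g x - g' x\<bar>)"
    using integrable_abs[OF gi] by (simp add: abs_mult)
  ultimately have "AE x in lborel. indicator (cbox c d) x * \<bar>g x - g' x\<bar> = 0"
    by (subst (asm) integral_nonneg_eq_0_iff_AE) auto
  then show ?thesis unfolding cd by (rule AE_mp) (auto simp: indicator_def)
qed

lemma glue_local_densities:
  fixes u :: "(real^'n::finite \<Rightarrow> real) \<Rightarrow> real"
  assumes lin: "\<And>K. compact K \<Longrightarrow> K \<subseteq> \<Omega> \<Longrightarrow> linear_on_smooth K u"
    and cov: "\<Omega> = (\<Union>k::nat. box (a k) (b k))" and sub: "\<And>k. cbox (a k) (b k) \<subseteq> \<Omega>"
    and G: "\<And>k. G k \<in> borel_measurable borel" "\<And>k. integrable lborel (G k)"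
    and rep: "\<And>k \<phi>. \<phi> \<in> smooth_in (cbox (a k) (b k)) \<Longrightarrow> u \<phi> = (LINT x|lborel. G k x * \<phi> x)"
  obtains g where "g \<in> borel_measurable borel"
    "\<And>K. compact K \<Longrightarrow> K \<subseteq> \<Omega> \<Longrightarrow> integrable lborel (\<lambda>x. indicator K x * g x)"
    "\<And>K \<phi>. compact K \<Longrightarrow> K \<subseteq> \<Omega> \<Longrightarrow> \<phi> \<in> smooth_in K \<Longrightarrow> u \<phi> = (LINT x|lborel. g x * \<phi> x)"
proof -
  \<comment> \<open>Using the first box that contains \<open>x\<close> makes the choice, and hence
    \<open>g\<close>, Borel measurable. Off a null set every other box containing \<open>x\<close>
    gives the same value.\<close>
  define g where "g = (\<lambda>x. G (LEAST k. x \<in> box (a k) (b k)) x)"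
  have gm: "g \<in> borel_measurable borel"
    unfolding g_def
  proof (rule measurable_compose_countable[OF G(1)])
    show "(\<lambda>x. LEAST k. x \<in> box (a k) (b k)) \<in> measurable borel (count_space UNIV)"
      by (rule measurable_Least) (auto intro!: pred_sets2)
  qed
  have "AE x in lborel. \<forall>j k. x \<in> cbox (a j) (b j) \<inter> cbox (a k) (b k) \<longrightarrow> G j x = G k x"
    unfolding AE_all_countable by (intro allI local_densities_agree[OF G G rep rep])
  then have agree: "AE x in lborel. \<forall>k. x \<in> cbox (a k) (b k) \<longrightarrow> g x = G k x"
  proof (rule AE_mp, intro AE_I2 impI allI)
    fix x k assume *: "\<forall>j k. x \<in> cbox (a j) (b j) \<inter> cbox (a k) (b k) \<longrightarrow> G j x = G k x" and k: "x \<in> cbox (a k) (b k)"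
    obtain j where "x \<in> box (a j) (b j)" using sub[of k] k cov by blast
    then have "x \<in> box (a (LEAST k. x \<in> box (a k) (b k))) (b (LEAST k. x \<in> box (a k) (b k)))" by (rule LeastI)
    then have "x \<in> cbox (a (LEAST k. x \<in> box (a k) (b k))) (b (LEAST k. x \<in> box (a k) (b k)))" using box_subset_cbox by blast
    with * k show "g x = G k x" unfolding g_def by blast
  qed
  have fin: "\<exists>A. finite A \<and> K \<subseteq> (\<Union>k\<in>A. box (a k) (b k))" if "compact K" "K \<subseteq> \<Omega>" for K
    using compactE_image[OF that(1), of UNIV "\<lambda>k. box (a k) (b k)"] that(2) cov by (metis open_box subset_UNIV)
  show ?thesis
  proof (rule that[OF gm])
    fix K :: "(real^'n) set" assume K: "compact K" "K \<subseteq> \<Omega>"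
    obtain A where A: "finite A" "K \<subseteq> (\<Union>k\<in>A. box (a k) (b k))" using fin[OF K] by blast
    show "integrable lborel (\<lambda>x. indicator K x * g x)"
    proof (rule Bochner_Integration.integrable_bound)
      show "integrable lborel (\<lambda>x. \<Sum>k\<in>A. \<bar>G k x\<bar>)" by (intro Bochner_Integration.integrable_sum integrable_abs G)
      show "(\<lambda>x. indicator K x * g x) \<in> borel_measurable lborel"
        using gm borel_compact[OF K(1)] by measurable
      show "AE x in lborel. norm (indicator K x * g x) \<le> norm (\<Sum>k\<in>A. \<bar>G k x\<bar>)"
        using agree
      proof (rule AE_mp, intro AE_I2 impI)
        fix x assume *: "\<forall>k. x \<in> cbox (a k) (b k) \<longrightarrow> g x = G k x"
        show "norm (indicator K x * g x) \<le> norm (\<Sum>k\<in>A. \<bar>G k x\<bar>)"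
        proof (cases "x \<in> K")
          case True
          then obtain k where k: "k \<in> A" "x \<in> box (a k) (b k)" using A by blast
          then have "g x = G k x" using * box_subset_cbox by blast
          moreover have "\<bar>G k x\<bar> \<le> (\<Sum>k\<in>A. \<bar>G k x\<bar>)" using k A by (intro member_le_sum) auto
          ultimately show ?thesis using True by simp
        qed simp
      qed
    qed
  next
    fix K and \<phi> :: "real^'n \<Rightarrow> real" assume K: "compact K" "K \<subseteq> \<Omega>" and \<phi>: "\<phi> \<in> smooth_in K"
    obtain A where A: "finite A" "K \<subseteq> (\<Union>k\<in>A. box (a k) (b k))" using fin[OF K] by blast
    obtain \<theta> where \<theta>: "\<And>k. k \<in> A \<Longrightarrow> \<theta> k \<in> smooth_in (cbox (a k) (b k))" and \<theta>1: "\<And>x. x \<in> K \<Longrightarrow> (\<Sum>k\<in>A. \<theta> k x) = 1"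
      using partition_of_unity_boxes[OF A(1) K(1) A(2)] by metis
    have in1: "(\<lambda>x. \<theta> k x * \<phi> x) \<in> smooth_in (cbox (a k) (b k))" if "k \<in> A" for k
      by (rule smooth_in_mult[OF \<theta>[OF that] smooth_inD[OF \<phi>]])
    have in2: "(\<lambda>x. \<theta> k x * \<phi> x) \<in> smooth_in K" if "k \<in> A" for k
      using smooth_in_mult[OF \<phi> smooth_inD[OF \<theta>[OF that]]] by (simp add: mult.commute)
    have sum: "\<phi> = (\<lambda>x. \<Sum>k\<in>A. \<theta> k x * \<phi> x)"
    proof
      fix x show "\<phi> x = (\<Sum>k\<in>A. \<theta> k x * \<phi> x)"
        using \<theta>1[of x] smooth_in_outside[OF \<phi>, of x] by (cases "x \<in> K") (auto simp: sum_distrib_right[symmetric])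
    qed
    have int: "integrable lborel (\<lambda>x. G k x * (\<theta> k x * \<phi> x))" if k: "k \<in> A" for k
    proof -
      obtain M where M: "\<And>x. \<bar>\<theta> k x * \<phi> x\<bar> \<le> M" using smooth_in_bounded[OF in1[OF k] compact_cbox] by metis
      show ?thesis
      proof (rule Bochner_Integration.integrable_bound)
        show "integrable lborel (\<lambda>x. M * G k x)" using G by (intro integrable_mult_right)
        show "(\<lambda>x. G k x * (\<theta> k x * \<phi> x)) \<in> borel_measurable lborel"
          using G(1)[of k] smooth_borel_measurable[OF smooth_inD[OF in1[OF k]]] by measurable
        show "AE x in lborel. norm (G k x * (\<theta> k x * \<phi> x)) \<le> norm (M * G k x)"
        proof (rule AE_I2)
          fix x
          have "\<bar>\<theta> k x * \<phi> x\<bar> \<le> \<bar>M\<bar>" using M[of x] by linarith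
          from mult_left_mono[OF this, of "\<bar>G k x\<bar>"]
          show "norm (G k x * (\<theta> k x * \<phi> x)) \<le> norm (M * G k x)" by (simp add: abs_mult mult.commute mult.left_commute)
        qed
      qed
    qed
    have "u \<phi> = u (\<lambda>x. \<Sum>k\<in>A. \<theta> k x * \<phi> x)" using sum by simp
    also have "\<dots> = (\<Sum>k\<in>A. u (\<lambda>x. \<theta> k x * \<phi> x))"
      by (rule linear_on_smooth_sum[OF lin[OF K] in2])
    also have "\<dots> = (\<Sum>k\<in>A. LINT x|lborel. G k x * (\<theta> k x * \<phi> x))"
      by (intro sum.cong refl rep in1)
    also have "\<dots> = (LINT x|lborel. (\<Sum>k\<in>A. G k x * (\<theta> k x * \<phi> x)))"
      by (rule Bochner_Integration.integral_sum[symmetric]) (rule int)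
    also have "\<dots> = (LINT x|lborel. g x * \<phi> x)"
    proof (rule integral_cong_AE)
      show "(\<lambda>x. \<Sum>k\<in>A. G k x * (\<theta> k x * \<phi> x)) \<in> borel_measurable lborel"
        using int by (intro borel_measurable_sum) (rule borel_measurable_integrable)
      show "(\<lambda>x. g x * \<phi> x) \<in> borel_measurable lborel"
        using gm smooth_borel_measurable[OF smooth_inD[OF \<phi>]] by measurable
      show "AE x in lborel. (\<Sum>k\<in>A. G k x * (\<theta> k x * \<phi> x)) = g x * \<phi> x"
        using agree
      proof (rule AE_mp, intro AE_I2 impI)
        fix x assume *: "\<forall>k. x \<in> cbox (a k) (b k) \<longrightarrow> g x = G k x"
        have "G k x * (\<theta> k x * \<phi> x) = g x * (\<theta> k x * \<phi> x)" if "k \<in> A" for k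
          using * smooth_in_outside[OF \<theta>[OF that], of x] by (cases "x \<in> cbox (a k) (b k)") auto
        then have "(\<Sum>k\<in>A. G k x * (\<theta> k x * \<phi> x)) = (\<Sum>k\<in>A. g x * (\<theta> k x * \<phi> x))" by (intro sum.cong) auto
        also have "\<dots> = g x * (\<Sum>k\<in>A. \<theta> k x * \<phi> x)" by (simp add: sum_distrib_left)
        also have "(\<Sum>k\<in>A. \<theta> k x * \<phi> x) = \<phi> x" using fun_cong[OF sum, of x] by simp
        finally show "(\<Sum>k\<in>A. G k x * (\<theta> k x * \<phi> x)) = g x * \<phi> x" .
      qed
    qed
    finally show "u \<phi> = (LINT x|lborel. g x * \<phi> x)" .
  qed
qed

text \<open>Only existence is at stake here: the bound on each cube involves an uncontrolled c. By
  Lindelof countably many cubes suffice, so the exceptional null sets of the local densities unite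
  to a null set.\<close>

lemma density_exists:
  fixes u :: "(real^'n::finite \<Rightarrow> real) \<Rightarrow> real"
  assumes \<Omega>: "open \<Omega>" "\<Omega> \<noteq> {}" and D: "D \<ge> 0"
    and lin: "\<And>K. compact K \<Longrightarrow> K \<subseteq> \<Omega> \<Longrightarrow> linear_on_smooth K u"
    and gb: "\<And>K. compact K \<Longrightarrow> K \<subseteq> \<Omega> \<Longrightarrow> gradient_bound K u D"
  obtains g where "g \<in> borel_measurable borel"
    "\<And>K. compact K \<Longrightarrow> K \<subseteq> \<Omega> \<Longrightarrow> integrable lborel (\<lambda>x. indicator K x * g x)"
    "\<And>K \<phi>. compact K \<Longrightarrow> K \<subseteq> \<Omega> \<Longrightarrow> \<phi> \<in> smooth_in K \<Longrightarrow> u \<phi> = (LINT x|lborel. g x * \<phi> x)"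
proof (rule interior_estimate[OF zero_less_one order_refl, where 'n = 'n])
  note * = that
  fix C :: real
  assume C: "C \<ge> 0" and est:
    "\<And>(u :: (real^'n \<Rightarrow> real) \<Rightarrow> real) D x0 r. r > 0 \<Longrightarrow> D \<ge> 0 \<Longrightarrow>
      linear_on_smooth (cube_at x0 ((1 + 1) * r)) u \<Longrightarrow> gradient_bound (cube_at x0 ((1 + 1) * r)) u D \<Longrightarrow>
      \<exists>c. \<forall>a\<in>smooth_in (cube_at x0 r).
        \<bar>u a - c * (LINT x|lborel. a x)\<bar> \<le> C * D * (r ^ CARD('n) + L2_sq a)"
  have local: "\<exists>g. g \<in> borel_measurable borel \<and> integrable lborel g \<and>
      (\<forall>\<phi>\<in>smooth_in (cube_at x0 r). u \<phi> = (LINT x|lborel. g x * \<phi> x))"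
    if r: "r > 0" and sub: "cube_at x0 (2 * r) \<subseteq> \<Omega>" for x0 r
  proof -
    have s2: "cube_at x0 ((1 + 1) * r) \<subseteq> \<Omega>" using sub by simp
    from est[OF r D lin[OF compact_cube_at s2] gb[OF compact_cube_at s2]]
    obtain c where c: "\<forall>a\<in>smooth_in (cube_at x0 r).
        \<bar>u a - c * (LINT x|lborel. a x)\<bar> \<le> C * D * (r ^ CARD('n) + L2_sq a)"
      by (elim exE)
    define V where "V = measure lborel (cube_at x0 r)"
    have V: "V \<ge> 0" by (simp add: V_def)
    have sub1: "cube_at x0 r \<subseteq> \<Omega>" using sub r cube_at_mono[of r "2 * r" x0] by simp
    \<comment> \<open>Absorbs both terms into a multiple of 1 + E, the form that
      \<open>smooth_functional_representation\<close> takes.\<close>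
    define B where "B = \<bar>c\<bar> * (V + 1) + C * D * (r ^ CARD('n) + 1)"
    have "\<bar>u a\<bar> \<le> B * (1 + L2_sq a)" if a: "a \<in> smooth_in (cube_at x0 r)" for a
    proof -
      define E where "E = L2_sq a"
      have E: "E \<ge> 0" unfolding E_def by (intro integral_nonneg_AE) auto
      have "\<bar>u a\<bar> \<le> \<bar>c\<bar> * \<bar>LINT x|lborel. a x\<bar> + C * D * (r ^ CARD('n) + E)"
        using bspec[OF c a] by (simp add: E_def abs_mult[symmetric])
      also have "\<bar>LINT x|lborel. a x\<bar> \<le> L1_norm a" by (rule integral_abs_bound)
      also have "\<dots> \<le> V + E" unfolding V_def E_def by (rule smooth_in_L1_le_L2[OF a compact_cube_at])
      also have "\<bar>c\<bar> * (V + E) + C * D * (r ^ CARD('n) + E)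
          \<le> \<bar>c\<bar> * ((V + 1) * (1 + E)) + C * D * ((r ^ CARD('n) + 1) * (1 + E))"
        using C D V E r by (intro add_mono mult_left_mono mult_nonneg_nonneg) (auto simp: algebra_simps)
      also have "\<dots> = B * (1 + E)" by (simp add: B_def algebra_simps)
      finally show ?thesis by (simp add: E_def mult_left_mono)
    qed
    from smooth_functional_representation[OF compact_cube_at lin[OF compact_cube_at sub1] this]
    obtain g where "g \<in> borel_measurable borel" "integrable lborel g"
      "\<And>\<phi>. \<phi> \<in> smooth_in (cube_at x0 r) \<Longrightarrow> u \<phi> = (LINT x|lborel. g x * \<phi> x)" by blast
    then show ?thesis by (intro exI[of _ g]) auto
  qed
  \<comment> \<open>The doubled cube inside \<Omega> is the room that the interior estimate takes
    when its margin \<delta> is 1.\<close>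
  define F where "F = {(x0, r). r > 0 \<and> cube_at x0 (2 * r) \<subseteq> \<Omega>}"
  define bx where "bx = (\<lambda>(x0 :: real^'n, r). box (x0 - (\<chi> i. r)) (x0 + (\<chi> i. r)))"
  have memF: "\<exists>r>0. (x, r) \<in> F" if "x \<in> \<Omega>" for x
  proof -
    obtain e where e: "e > 0" "cball x e \<subseteq> \<Omega>" using \<Omega>(1) \<open>x \<in> \<Omega>\<close> open_contains_cball by blast
    define r where "r = e / (2 * real CARD('n))"
    have r: "r > 0" using e by (simp add: r_def)
    have "cube_at x (2 * r) \<subseteq> cball x e"
    proof
      fix y assume "y \<in> cube_at x (2 * r)"
      then have y: "\<bar>(x - y) $ i\<bar> \<le> 2 * r" for i by (simp add: mem_cube_at abs_minus_commute)
      have "norm (x - y) \<le> (\<Sum>i\<in>UNIV. \<bar>(x - y) $ i\<bar>)" by (rule norm_le_l1_cart)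
      also have "\<dots> \<le> (\<Sum>i\<in>(UNIV::'n set). 2 * r)" by (intro sum_mono y)
      also have "\<dots> = e" by (simp add: r_def)
      finally show "y \<in> cball x e" by (simp add: dist_norm)
    qed
    then show ?thesis using r e by (auto simp: F_def)
  qed
  have "\<Union> (bx ` F) = \<Omega>"
  proof (intro equalityI subsetI)
    fix x assume "x \<in> \<Union> (bx ` F)"
    then obtain x0 r where xr: "r > 0" "cube_at x0 (2 * r) \<subseteq> \<Omega>" "x \<in> box (x0 - (\<chi> i. r)) (x0 + (\<chi> i. r))"
      by (auto simp: F_def bx_def)
    have "\<bar>x $ i - x0 $ i\<bar> \<le> 2 * r" for i
    proof -
      have "x0 $ i - r < x $ i" "x $ i < x0 $ i + r" using xr(3) by (simp_all add: mem_box_cart)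
      then show ?thesis using xr(1) by (simp add: abs_le_iff)
    qed
    then have "x \<in> cube_at x0 (2 * r)" by (simp add: mem_cube_at)
    then show "x \<in> \<Omega>" using xr by blast
  next
    fix x assume "x \<in> \<Omega>"
    then obtain r where "r > 0" "(x, r) \<in> F" using memF by blast
    moreover have "x \<in> bx (x, r)" using \<open>r > 0\<close> by (simp add: bx_def mem_box_cart)
    ultimately show "x \<in> \<Union> (bx ` F)" by blast
  qed
  moreover obtain F' where F': "F' \<subseteq> bx ` F" "countable F'" "\<Union>F' = \<Union> (bx ` F)"
    using Lindelof[of "bx ` F"] by (auto simp: bx_def split_beta open_box)
  ultimately have un: "\<Union>F' = \<Omega>" by simp
  then have ne: "F' \<noteq> {}" using \<Omega>(2) by auto
  have "\<exists>p. p \<in> F \<and> from_nat_into F' k = bx p" for k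
    using from_nat_into[OF ne, of k] F'(1) by blast
  then obtain p where p: "\<And>k. p k \<in> F" and pk: "\<And>k. from_nat_into F' k = bx (p k)" by metis
  define a where "a = (\<lambda>k. fst (p k) - (\<chi> i. snd (p k)))"
  define b where "b = (\<lambda>k. fst (p k) + (\<chi> i. snd (p k)))"
  have bxp: "bx (p k) = box (a k) (b k)" for k by (simp add: bx_def a_def b_def split_beta)
  have cbp: "cube_at (fst (p k)) (snd (p k)) = cbox (a k) (b k)" for k by (simp add: cube_at_def a_def b_def)
  have pF: "snd (p k) > 0" "cube_at (fst (p k)) (2 * snd (p k)) \<subseteq> \<Omega>" for k
    using p[of k] by (auto simp: F_def split_beta)
  have cov: "\<Omega> = (\<Union>k. box (a k) (b k))"
  proof -
    have "(\<Union>k. box (a k) (b k)) = \<Union> (range (from_nat_into F'))" by (simp add: pk bxp)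
    then show ?thesis using range_from_nat_into[OF ne F'(2)] un by simp
  qed
  have sub: "cbox (a k) (b k) \<subseteq> \<Omega>" for k
  proof -
    have "cube_at (fst (p k)) (snd (p k)) \<subseteq> cube_at (fst (p k)) (2 * snd (p k))"
      using pF(1)[of k] by (intro cube_at_mono) simp
    then show ?thesis using pF(2)[of k] cbp by blast
  qed
  have "\<exists>G. \<forall>k. G k \<in> borel_measurable borel \<and> integrable lborel (G k) \<and>
      (\<forall>\<phi>\<in>smooth_in (cbox (a k) (b k)). u \<phi> = (LINT x|lborel. G k x * \<phi> x))"
    using local[OF pF] cbp by metis
  then obtain G where G: "\<And>k. G k \<in> borel_measurable borel" "\<And>k. integrable lborel (G k)"
      "\<And>k \<phi>. \<phi> \<in> smooth_in (cbox (a k) (b k)) \<Longrightarrow> u \<phi> = (LINT x|lborel. G k x * \<phi> x)"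
    by metis
  show thesis
  proof (rule glue_local_densities[where u = u and a = a and b = b and G = G, OF _ cov sub G])
    show "linear_on_smooth K u" if "compact K" "K \<subseteq> \<Omega>" for K using lin[OF that] .
    show thesis if "g \<in> borel_measurable borel"
      "\<And>K. compact K \<Longrightarrow> K \<subseteq> \<Omega> \<Longrightarrow> integrable lborel (\<lambda>x. indicator K x * g x)"
      "\<And>K \<phi>. compact K \<Longrightarrow> K \<subseteq> \<Omega> \<Longrightarrow> \<phi> \<in> smooth_in K \<Longrightarrow> u \<phi> = (LINT x|lborel. g x * \<phi> x)" for g
      by (rule *[OF that])
  qed
qed

section \<open>Mean oscillation on cubes without room around them\<close>

definition cell :: "real^'n::finite \<Rightarrow> real \<Rightarrow> (real^'n) set" where
  "cell a s = cbox a (\<chi> i. a $ i + s)"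

lemma mem_cell: "x \<in> cell a s \<longleftrightarrow> (\<forall>i. a $ i \<le> x $ i \<and> x $ i \<le> a $ i + s)"
  by (simp add: cell_def mem_box_cart)

lemma cell_subsetI:
  assumes "\<And>i. a $ i \<le> b $ i \<and> b $ i + t \<le> a $ i + s"
  shows "cell b t \<subseteq> cell a s"
proof
  fix x assume x: "x \<in> cell b t"
  have "a $ i \<le> x $ i \<and> x $ i \<le> a $ i + s" for i
    using assms[of i] x[unfolded mem_cell, rule_format, of i] by linarith
  then show "x \<in> cell a s" by (simp add: mem_cell)
qed

lemma compact_cell [simp]: "compact (cell a s)"
  by (simp add: cell_def compact_cbox)

lemma cell_borel [measurable]: "cell a s \<in> sets borel"
  by (simp add: cell_def)

lemma measure_cell:
  assumes "s \<ge> 0"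
  shows "measure lborel (cell a s :: (real^'n::finite) set) = s ^ CARD('n)"
proof -
  have "a \<in> cell a s" using assms by (simp add: mem_cell)
  then have "cell a s \<noteq> {}" by blast
  then show ?thesis by (simp add: cell_def content_cbox_cart)
qed

abbreviation int_on :: "'a::euclidean_space set \<Rightarrow> ('a \<Rightarrow> real) \<Rightarrow> real" where
  "int_on Q f \<equiv> LINT x|lborel. indicator Q x * f x"

lemma integrable_on_compact_abs_diff:
  fixes g :: "'a::euclidean_space \<Rightarrow> real"
  assumes "compact Q" "integrable lborel (\<lambda>x. indicator Q x * g x)"
  shows "integrable lborel (\<lambda>x. indicator Q x * \<bar>g x - c\<bar>)"
proof -
  have "integrable lborel (\<lambda>x. \<bar>indicator Q x * g x - indicator Q x * c\<bar>)"
    by (intro integrable_abs Bochner_Integration.integrable_diff assms integrable_mult_left compact_indicator)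
  moreover have "(\<lambda>x. \<bar>indicator Q x * g x - indicator Q x * c\<bar>) = (\<lambda>x. indicator Q x * \<bar>g x - c\<bar>)"
    by (auto simp: indicator_def)
  ultimately show ?thesis by simp
qed

lemma integrable_on_compact_subset:
  fixes g :: "'a::euclidean_space \<Rightarrow> real"
  assumes "integrable lborel (\<lambda>x. indicator Q x * g x)" "compact Q'" "Q' \<subseteq> Q"
  shows "integrable lborel (\<lambda>x. indicator Q' x * g x)"
proof -
  have "integrable lborel (\<lambda>x. indicator Q' x *\<^sub>R (indicator Q x * g x))"
    using borel_compact[OF assms(2)] assms(1) by (intro integrable_mult_indicator) auto
  moreover have "(\<lambda>x. indicator Q' x *\<^sub>R (indicator Q x * g x)) = (\<lambda>x. indicator Q' x * g x)"
    using assms(3) by (auto simp: indicator_def fun_eq_iff)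
  ultimately show ?thesis by simp
qed

lemma int_on_const: "compact Q \<Longrightarrow> int_on Q (\<lambda>x. c) = c * measure lborel Q"
  using compact_indicator(2)[of Q] by simp

text \<open>Cells of the grid of mesh \<open>s / N\<close> at the boundary are compared with their neighbours in the
  central cube; they make up a fraction \<open>O(1 / N)\<close> of the volume.\<close>

lemma oscillation_subdivision:
  fixes g :: "real^'n::finite \<Rightarrow> real" and N :: nat
  assumes s: "s > 0" and N: "N \<ge> 4" and h: "h = s / real N"
    and gi: "integrable lborel (\<lambda>x. indicator (cell a s) x * g x)"
    and M: "M \<ge> 0"
    and inner: "int_on (cell (\<chi> i. a $ i + h) (s - 2 * h)) (\<lambda>x. \<bar>g x - c\<bar>) \<le> X"
    and sub: "\<And>b. cell b (2 * h) \<subseteq> cell a s \<Longrightarrow> \<exists>c'. int_on (cell b (2 * h)) (\<lambda>x. \<bar>g x - c'\<bar>) \<le> M * (2 * h) ^ CARD('n)"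
  shows "int_on (cell a s) (\<lambda>x. \<bar>g x - c\<bar>)
    \<le> (1 + real N ^ CARD('n)) * X + (2 * real CARD('n) / real N) * (2 * 2 ^ CARD('n) * M * s ^ CARD('n))"
proof -
  let ?n = "CARD('n)"
  define Z where "Z = cell (\<chi> i. a $ i + h) (s - 2 * h)"
  define R where "R = (\<lambda>k :: 'n \<Rightarrow> nat. cell (\<chi> i. a $ i + real (k i) * h) h)"
  define All where "All = (UNIV :: 'n set) \<rightarrow>\<^sub>E {..<N}"
  \<comment> \<open>Indices from 1 to N - 2 in every coordinate: these cells lie in
    \<open>Z\<close>. The remaining ones have an extreme index in at least one coordinate.\<close>
  define Inn where "Inn = (UNIV :: 'n set) \<rightarrow>\<^sub>E {1..<N - 1}"
  define Bd where "Bd = All - Inn"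
  have h0: "h > 0" using s N by (simp add: h)
  have sN: "s = real N * h" using N by (simp add: h)
  have fin: "finite All" "finite Inn" unfolding All_def Inn_def by (auto intro: finite_PiE)
  have InnAll: "Inn \<subseteq> All" unfolding Inn_def All_def by (intro PiE_mono) auto
  have cardBd: "real (card Bd) \<le> (2 * real ?n / real N) * real N ^ ?n"
  proof -
    have cA: "card All = N ^ ?n" unfolding All_def by (simp add: card_PiE)
    have cI: "card Inn = (N - 2) ^ ?n" unfolding Inn_def using N by (simp add: card_PiE numeral_2_eq_2)
    have "card Bd = N ^ ?n - (N - 2) ^ ?n"
      unfolding Bd_def using card_Diff_subset[OF fin(2) InnAll] cA cI by simp
    then have "real (card Bd) = real N ^ ?n - (real N - 2) ^ ?n"
      using N by (simp add: of_nat_diff power_mono)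
    moreover have "(real N - 2) ^ ?n \<ge> real N ^ ?n * (1 - 2 * real ?n / real N)"
    proof -
      \<comment> \<open>Bernoulli turns the ratio (1 - 2/N)^n of inner cells into the bound 2n/N for
        the proportion of boundary cells.\<close>
      have "1 + real ?n * (- (2 / real N)) \<le> (1 + (- (2 / real N))) ^ ?n"
        using N by (intro Bernoulli_inequality) (simp add: field_simps)
      then have "real N ^ ?n * (1 - 2 * real ?n / real N) \<le> real N ^ ?n * (1 - 2 / real N) ^ ?n"
        by (intro mult_left_mono) (auto simp: field_simps)
      also have "\<dots> = (real N - 2) ^ ?n" using N by (simp add: power_mult_distrib[symmetric] right_diff_distrib)
      finally show ?thesis .
    qed
    ultimately show ?thesis by (simp add: algebra_simps)
  qed
  have Zsub: "Z \<subseteq> cell a s"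
    unfolding Z_def using h0 by (intro cell_subsetI) simp
  have iQ: "integrable lborel (\<lambda>x. indicator Q x * \<bar>g x - t\<bar>)" if "compact Q" "Q \<subseteq> cell a s" for Q t
    using integrable_on_compact_abs_diff[OF that(1) integrable_on_compact_subset[OF gi that]] .
  have nonneg: "int_on Q (\<lambda>x. \<bar>g x - t\<bar>) \<ge> 0" for Q t by (intro integral_nonneg_AE) auto
  have X0: "X \<ge> 0" using inner nonneg[of "cell (\<chi> i. a $ i + h) (s - 2 * h)" c] by linarith
  have Zc: "compact Z" by (simp add: Z_def)
  have Rc: "compact (R k)" for k by (simp add: R_def)
  have mh: "real x * h \<le> real y * h" if "x \<le> y" for x y :: nat using that h0 by (intro mult_right_mono) auto
  have Rsub: "R k \<subseteq> cell a s" if k: "k \<in> All" for k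
    unfolding R_def
  proof (rule cell_subsetI)
    fix i
    have "k i < N" using k by (auto simp: All_def)
    then have "k i + 1 \<le> N" by simp
    from mh[OF this] mh[of 0 "k i"]
    show "a $ i \<le> (\<chi> i. a $ i + real (k i) * h) $ i \<and> (\<chi> i. a $ i + real (k i) * h) $ i + h \<le> a $ i + s"
      by (simp add: sN algebra_simps)
  qed
  have cover: "\<exists>k\<in>All. x \<in> R k" if x: "x \<in> cell a s" for x
  proof -
    have "\<exists>m<N. real m * h \<le> x $ i - a $ i \<and> x $ i - a $ i \<le> real m * h + h" for i
    proof -
      define t where "t = (x $ i - a $ i) / h"
      have t: "0 \<le> t" "t \<le> real N" using x h0 by (auto simp: mem_cell t_def sN field_simps)
      have th: "x $ i - a $ i = t * h" using h0 by (simp add: t_def)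
      show ?thesis
      proof (cases "t < real N")
        case True
        define m where "m = nat \<lfloor>t\<rfloor>"
        have m: "real m \<le> t" "t \<le> real m + 1" using t(1) unfolding m_def by linarith+
        have "m < N" using m True by linarith
        moreover have "real m * h \<le> t * h" "t * h \<le> real m * h + h"
          using m h0 mult_right_mono[of t "real m + 1" h] by (auto simp: algebra_simps)
        ultimately show ?thesis unfolding th by blast
      next
        case False
        then have "t = real N" using t by linarith
        then show ?thesis unfolding th using N h0
          by (intro exI[of _ "N - 1"]) (auto simp: of_nat_diff algebra_simps)
      qed
    qed
    then obtain k where k: "\<And>i. k i < N" "\<And>i. real (k i) * h \<le> x $ i - a $ i" "\<And>i. x $ i - a $ i \<le> real (k i) * h + h"
      by metis
    have "a $ i + real (k i) * h \<le> x $ i \<and> x $ i \<le> a $ i + real (k i) * h + h" for i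
      using k(2)[of i] k(3)[of i] by linarith
    then have "x \<in> R k" by (simp add: R_def mem_cell)
    moreover have "k \<in> All" using k(1) by (auto simp: All_def)
    ultimately show ?thesis by blast
  qed
  have RZ: "R k \<subseteq> Z" if k: "\<And>i. 1 \<le> k i \<and> k i + 2 \<le> N" for k
    unfolding R_def Z_def
  proof (rule cell_subsetI)
    fix i
    show "(\<chi> i. a $ i + h) $ i \<le> (\<chi> i. a $ i + real (k i) * h) $ i \<and>
        (\<chi> i. a $ i + real (k i) * h) $ i + h \<le> (\<chi> i. a $ i + h) $ i + (s - 2 * h)"
      using mh[of 1 "k i"] mh[of "k i + 2" N] k[of i] by (simp add: sN algebra_simps)
  qed
  have bdry: "int_on (R k) (\<lambda>x. \<bar>g x - c\<bar>) \<le> 2 * (M * (2 * h) ^ ?n) + X" if k: "k \<in> Bd" for k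
  proof -
    have kN: "k i < N" for i using k by (auto simp: Bd_def All_def PiE_iff)
    \<comment> \<open>\<open>m\<close> is the lowest index of a block \<open>B\<close> of 2^n cells
      that contains the cell \<open>k\<close>, lowered where the block would leave the grid;
      \<open>p\<close> is the index of a cell of this block that lies in the central cube.\<close>
    define m where "m = (\<lambda>i. min (k i) (N - 2))"
    define p where "p = (\<lambda>i. max 1 (min (k i) (N - 2)))"
    define b where "b = (\<chi> i. a $ i + real (m i) * h)"
    define B where "B = cell b (2 * h)"
    define P where "P = R p"
    have mb: "m i \<le> k i" "k i \<le> m i + 1" "m i \<le> p i" "p i \<le> m i + 1" "m i + 2 \<le> N" "1 \<le> p i" "p i + 2 \<le> N" for i
      using kN[of i] N by (auto simp: m_def p_def)
    have RB: "R q \<subseteq> B" if q: "\<And>i. m i \<le> q i \<and> q i \<le> m i + 1" for q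
      unfolding R_def B_def b_def
    proof (rule cell_subsetI)
      fix i
      show "(\<chi> i. a $ i + real (m i) * h) $ i \<le> (\<chi> i. a $ i + real (q i) * h) $ i \<and>
          (\<chi> i. a $ i + real (q i) * h) $ i + h \<le> (\<chi> i. a $ i + real (m i) * h) $ i + 2 * h"
        using mh[of "m i" "q i"] mh[of "q i" "m i + 1"] q[of i] by (simp add: algebra_simps)
    qed
    have RkB: "R k \<subseteq> B" and PB: "P \<subseteq> B" unfolding P_def using mb by (auto intro!: RB)
    have PZ: "P \<subseteq> Z" unfolding P_def using mb by (intro RZ) blast
    have BQ: "B \<subseteq> cell a s"
      unfolding B_def b_def
    proof (rule cell_subsetI)
      fix i
      show "a $ i \<le> (\<chi> i. a $ i + real (m i) * h) $ i \<and> (\<chi> i. a $ i + real (m i) * h) $ i + 2 * h \<le> a $ i + s"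
        using mh[OF mb(5)[of i]] mh[of 0 "m i"] by (simp add: sN algebra_simps)
    qed
    obtain c' where c': "int_on B (\<lambda>x. \<bar>g x - c'\<bar>) \<le> M * (2 * h) ^ ?n"
      using sub[of b] BQ unfolding B_def by blast
    have Bc: "compact B" by (simp add: B_def)
    have hn: "measure lborel (R q) = h ^ ?n" for q unfolding R_def using h0 by (intro measure_cell) simp
    \<comment> \<open>The constants of the block and of the centre are compared on \<open>P\<close>,
      which lies in both \<open>B\<close> and \<open>Z\<close>.\<close>
    have "\<bar>c' - c\<bar> * h ^ ?n = int_on P (\<lambda>x. \<bar>c' - c\<bar>)"
      using int_on_const[OF Rc, of p "\<bar>c' - c\<bar>"] hn[of p] by (simp add: P_def)
    also have "\<dots> \<le> (LINT x|lborel. indicator B x * \<bar>g x - c'\<bar> + indicator Z x * \<bar>g x - c\<bar>)"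
    proof (rule integral_mono)
      show "integrable lborel (\<lambda>x. indicator P x * \<bar>c' - c\<bar>)"
        using compact_indicator(1)[OF Rc, of p] by (simp add: P_def)
      show "integrable lborel (\<lambda>x. indicator B x * \<bar>g x - c'\<bar> + indicator Z x * \<bar>g x - c\<bar>)"
        by (intro Bochner_Integration.integrable_add iQ Bc BQ Zc Zsub)
      show "indicator P x * \<bar>c' - c\<bar> \<le> indicator B x * \<bar>g x - c'\<bar> + indicator Z x * \<bar>g x - c\<bar>" for x
        using PB PZ by (auto simp: indicator_def)
    qed
    also have "\<dots> = int_on B (\<lambda>x. \<bar>g x - c'\<bar>) + int_on Z (\<lambda>x. \<bar>g x - c\<bar>)"
      by (intro Bochner_Integration.integral_add iQ Bc BQ Zc Zsub)
    finally have 1: "\<bar>c' - c\<bar> * h ^ ?n \<le> M * (2 * h) ^ ?n + X" using c' inner by (simp add: Z_def)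
    have "int_on (R k) (\<lambda>x. \<bar>g x - c\<bar>) \<le> (LINT x|lborel. indicator B x * \<bar>g x - c'\<bar> + indicator (R k) x * \<bar>c' - c\<bar>)"
    proof (rule integral_mono)
      show "integrable lborel (\<lambda>x. indicator (R k) x * \<bar>g x - c\<bar>)" using RkB BQ by (intro iQ Rc) blast
      show "integrable lborel (\<lambda>x. indicator B x * \<bar>g x - c'\<bar> + indicator (R k) x * \<bar>c' - c\<bar>)"
        by (intro Bochner_Integration.integrable_add iQ Bc BQ integrable_mult_left compact_indicator Rc)
      show "indicator (R k) x * \<bar>g x - c\<bar> \<le> indicator B x * \<bar>g x - c'\<bar> + indicator (R k) x * \<bar>c' - c\<bar>" for x
        using RkB by (auto simp: indicator_def)
    qed
    also have "\<dots> = int_on B (\<lambda>x. \<bar>g x - c'\<bar>) + int_on (R k) (\<lambda>x. \<bar>c' - c\<bar>)"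
      by (intro Bochner_Integration.integral_add iQ Bc BQ integrable_mult_left compact_indicator Rc)
    also have "int_on (R k) (\<lambda>x. \<bar>c' - c\<bar>) = \<bar>c' - c\<bar> * h ^ ?n"
      using int_on_const[OF Rc, of k "\<bar>c' - c\<bar>"] hn[of k] by simp
    finally show ?thesis using 1 c' by linarith
  qed
  have "int_on (cell a s) (\<lambda>x. \<bar>g x - c\<bar>)
      \<le> (LINT x|lborel. indicator Z x * \<bar>g x - c\<bar> + (\<Sum>k\<in>Bd. indicator (R k) x * \<bar>g x - c\<bar>))"
  proof (rule integral_mono)
    show "integrable lborel (\<lambda>x. indicator (cell a s) x * \<bar>g x - c\<bar>)" by (intro iQ) auto
    show "integrable lborel (\<lambda>x. indicator Z x * \<bar>g x - c\<bar> + (\<Sum>k\<in>Bd. indicator (R k) x * \<bar>g x - c\<bar>))"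
      using Rsub by (intro Bochner_Integration.integrable_add Bochner_Integration.integrable_sum iQ Zc Zsub Rc) (auto simp: Bd_def)
    fix x
    show "indicator (cell a s) x * \<bar>g x - c\<bar> \<le> indicator Z x * \<bar>g x - c\<bar> + (\<Sum>k\<in>Bd. indicator (R k) x * \<bar>g x - c\<bar>)"
    proof (cases "x \<in> cell a s")
      case True
      have S0: "(\<Sum>k\<in>Bd. indicator (R k) x * \<bar>g x - c\<bar>) \<ge> 0" by (intro sum_nonneg) auto
      obtain k where k: "k \<in> All" "x \<in> R k" using cover[OF True] by blast
      show ?thesis
      proof (cases "k \<in> Inn")
        case True
        have "1 \<le> k i \<and> k i + 2 \<le> N" for i
          using PiE_mem[OF True[unfolded Inn_def], of i] by auto
        then have "x \<in> Z" using RZ k by blast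
        then show ?thesis using S0 \<open>x \<in> cell a s\<close> by simp
      next
        case False
        then have kB: "k \<in> Bd" using k by (simp add: Bd_def)
        have "indicator (R k) x * \<bar>g x - c\<bar> \<le> (\<Sum>k\<in>Bd. indicator (R k) x * \<bar>g x - c\<bar>)"
          using kB fin by (intro member_le_sum) (auto simp: Bd_def)
        then show ?thesis using k \<open>x \<in> cell a s\<close> by (simp add: add_increasing)
      qed
    qed (simp add: sum_nonneg)
  qed
  also have "\<dots> = int_on Z (\<lambda>x. \<bar>g x - c\<bar>) + (\<Sum>k\<in>Bd. int_on (R k) (\<lambda>x. \<bar>g x - c\<bar>))"
  proof -
    have i: "integrable lborel (\<lambda>x. indicator (R k) x * \<bar>g x - c\<bar>)" if "k \<in> Bd" for k
      using Rsub that by (intro iQ Rc) (auto simp: Bd_def)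
    show ?thesis
      by (subst Bochner_Integration.integral_add[OF iQ[OF Zc Zsub] Bochner_Integration.integrable_sum[OF i]])
        (simp_all add: Bochner_Integration.integral_sum[OF i])
  qed
  also have "\<dots> \<le> X + (\<Sum>k\<in>Bd. 2 * (M * (2 * h) ^ ?n) + X)"
    using inner by (intro add_mono sum_mono bdry) (simp_all add: Z_def)
  also have "\<dots> = X + real (card Bd) * X + real (card Bd) * (2 * (M * (2 * h) ^ ?n))"
    by (simp add: algebra_simps)
  also have "\<dots> \<le> X + real N ^ ?n * X + (2 * real ?n / real N) * real N ^ ?n * (2 * (M * (2 * h) ^ ?n))"
  proof -
    have "card Bd \<le> card All" unfolding Bd_def using fin by (intro card_mono) auto
    then have "real (card Bd) \<le> real N ^ ?n" by (simp add: All_def card_PiE)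
    then show ?thesis using X0 M h0 cardBd by (intro add_mono mult_right_mono) auto
  qed
  also have "\<dots> = (1 + real N ^ ?n) * X + (2 * real ?n / real N) * (2 * 2 ^ ?n * M * s ^ ?n)"
    unfolding sN power_mult_distrib by (simp add: algebra_simps)
  finally show ?thesis .
qed

text \<open>The data of a functional with its density, as one predicate: the estimates below fix
  their constant first and then quantify over \<Omega>, \<open>u\<close>, \<open>D\<close> and
  \<open>g\<close>.\<close>

locale smooth_density =
  fixes \<Omega> :: "(real^'n::finite) set" and u :: "(real^'n \<Rightarrow> real) \<Rightarrow> real" and D :: real and g :: "real^'n \<Rightarrow> real"
  assumes open_domain: "open \<Omega>" and D_nonneg: "D \<ge> 0"
    and density_measurable: "g \<in> borel_measurable borel"
    and linear: "compact K \<Longrightarrow> K \<subseteq> \<Omega> \<Longrightarrow> linear_on_smooth K u"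
    and gradient: "compact K \<Longrightarrow> K \<subseteq> \<Omega> \<Longrightarrow> gradient_bound K u D"
    and density_integrable: "compact K \<Longrightarrow> K \<subseteq> \<Omega> \<Longrightarrow> integrable lborel (\<lambda>x. indicator K x * g x)"
    and density: "compact K \<Longrightarrow> K \<subseteq> \<Omega> \<Longrightarrow> \<phi> \<in> smooth_in K \<Longrightarrow> u \<phi> = (LINT x|lborel. g x * \<phi> x)"
begin

lemma integrable_density_mult:
  assumes K: "compact K" "K \<subseteq> \<Omega>" and \<phi>: "\<phi> \<in> smooth_in K"
  shows "integrable lborel (\<lambda>x. g x * \<phi> x)"
proof -
  obtain M where M: "M \<ge> 0" "\<And>x. \<bar>\<phi> x\<bar> \<le> M" using smooth_in_bounded[OF \<phi> K(1)] by metis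
  show ?thesis
  proof (rule Bochner_Integration.integrable_bound)
    show "integrable lborel (\<lambda>x. M * (indicator K x * g x))"
      by (intro integrable_mult_right density_integrable K)
    show "(\<lambda>x. g x * \<phi> x) \<in> borel_measurable lborel"
      using density_measurable smooth_borel_measurable[OF smooth_inD[OF \<phi>]] by measurable
    show "AE x in lborel. norm (g x * \<phi> x) \<le> norm (M * (indicator K x * g x))"
    proof (rule AE_I2)
      fix x
      show "norm (g x * \<phi> x) \<le> norm (M * (indicator K x * g x))"
        using smooth_in_outside[OF \<phi>, of x] mult_right_mono[OF M(2)[of x], of "\<bar>g x\<bar>"] M(1)
        by (cases "x \<in> K") (auto simp: abs_mult mult.commute)
    qed
  qed
qed

lemma integral_density_diff:
  assumes K: "compact K" "K \<subseteq> \<Omega>" and \<phi>: "\<phi> \<in> smooth_in K"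
  shows "(LINT x|lborel. (g x - c) * \<phi> x) = u \<phi> - c * (LINT x|lborel. \<phi> x)"
proof -
  have "(LINT x|lborel. (g x - c) * \<phi> x) = (LINT x|lborel. g x * \<phi> x - c * \<phi> x)"
    by (simp add: left_diff_distrib)
  also have "\<dots> = (LINT x|lborel. g x * \<phi> x) - (LINT x|lborel. c * \<phi> x)"
    by (intro Bochner_Integration.integral_diff integrable_density_mult[OF K \<phi>] integrable_mult_right smooth_in_integrable1[OF \<phi> K(1)])
  finally show ?thesis by (simp add: density[OF K \<phi>])
qed

end

section \<open>Oscillation bounds with one constant for all cells\<close>

lemma cube_at_cell: "cube_at x0 r = cell (x0 - (\<chi> i. r)) (2 * r)"
proof -
  have "x \<in> cube_at x0 r \<longleftrightarrow> x \<in> cell (x0 - (\<chi> i. r)) (2 * r)" for x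
  proof -
    have "\<bar>x $ i - x0 $ i\<bar> \<le> r \<longleftrightarrow> x0 $ i - r \<le> x $ i \<and> x $ i \<le> x0 $ i - r + 2 * r" for i by linarith
    then show ?thesis by (simp add: mem_cube_at mem_cell)
  qed
  then show ?thesis by blast
qed

lemma cell_cube_at: "cell a s = cube_at (a + (\<chi> i. s / 2)) (s / 2)"
proof -
  have "a + (\<chi> i. s / 2) - (\<chi> i. s / 2) = a" by simp
  then show ?thesis by (simp add: cube_at_cell)
qed

text \<open>Duality turns the estimate for the functional into one for the density: if |\<phi>|
  \<le> 1, the energy of \<phi> is at most the volume 2^n r^n.\<close>

lemma interior_oscillation:
  assumes \<delta>: "0 < \<delta>" "\<delta> \<le> 1"
  obtains C where "C \<ge> 0"
    "\<And>\<Omega> (u :: (real^'n::finite \<Rightarrow> real) \<Rightarrow> real) D g x0 r. smooth_density \<Omega> u D g \<Longrightarrow> r > 0 \<Longrightarrow> cube_at x0 ((1 + \<delta>) * r) \<subseteq> \<Omega> \<Longrightarrow>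
      \<exists>c. int_on (cube_at x0 r) (\<lambda>x. \<bar>g x - c\<bar>) \<le> C * D * r ^ CARD('n)"
proof (rule interior_estimate[OF \<delta>, where 'n = 'n])
  fix C :: real
  assume C: "C \<ge> 0" and est:
    "\<And>(u :: (real^'n \<Rightarrow> real) \<Rightarrow> real) D x0 r. r > 0 \<Longrightarrow> D \<ge> 0 \<Longrightarrow>
      linear_on_smooth (cube_at x0 ((1 + \<delta>) * r)) u \<Longrightarrow> gradient_bound (cube_at x0 ((1 + \<delta>) * r)) u D \<Longrightarrow>
      \<exists>c. \<forall>a\<in>smooth_in (cube_at x0 r).
        \<bar>u a - c * (LINT x|lborel. a x)\<bar> \<le> C * D * (r ^ CARD('n) + L2_sq a)"
  show thesis
  proof (rule that[of "C * (1 + 2 ^ CARD('n))"])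
    show "C * (1 + 2 ^ CARD('n)) \<ge> 0" using C by simp
    fix \<Omega> D g x0 r and u :: "(real^'n \<Rightarrow> real) \<Rightarrow> real"
    assume sd: "smooth_density \<Omega> u D g" and r: "r > 0" and sub: "cube_at x0 ((1 + \<delta>) * r) \<subseteq> \<Omega>"
    interpret smooth_density \<Omega> u D g by (rule sd)
    from est[OF r D_nonneg linear[OF compact_cube_at sub] gradient[OF compact_cube_at sub]]
    obtain c where c: "\<forall>a\<in>smooth_in (cube_at x0 r).
        \<bar>u a - c * (LINT x|lborel. a x)\<bar> \<le> C * D * (r ^ CARD('n) + L2_sq a)"
      by (elim exE)
    have "r \<le> (1 + \<delta>) * r" using r \<delta> by simp
    then have sub1: "cube_at x0 r \<subseteq> \<Omega>" using sub cube_at_mono[of r "(1 + \<delta>) * r" x0] by blast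
    have meas: "measure lborel (cube_at x0 r) = 2 ^ CARD('n) * r ^ CARD('n)"
      using r by (simp add: cube_at_cell measure_cell power_mult_distrib)
    have gi: "integrable lborel (\<lambda>x. indicator (cube_at x0 r) x * (g x - c))"
    proof -
      have "integrable lborel (\<lambda>x. indicator (cube_at x0 r) x * g x - indicator (cube_at x0 r) x * c)"
        by (intro Bochner_Integration.integrable_diff density_integrable sub1 compact_cube_at integrable_mult_left compact_indicator)
      then show ?thesis by (simp add: right_diff_distrib)
    qed
    have "int_on (cube_at x0 r) (\<lambda>x. \<bar>g x - c\<bar>) \<le> C * (1 + 2 ^ CARD('n)) * D * r ^ CARD('n)"
      unfolding cube_at_def
    proof (rule L1_bound_by_duality)
      show "(\<lambda>x. g x - c) \<in> borel_measurable borel" using density_measurable by measurable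
      show "integrable lborel (\<lambda>x. indicator (cbox (x0 - (\<chi> i. r)) (x0 + (\<chi> i. r))) x * (g x - c))"
        using gi by (simp add: cube_at_def)
      fix \<phi> assume "\<phi> \<in> smooth_in (cbox (x0 - (\<chi> i. r)) (x0 + (\<chi> i. r)))" and \<phi>1: "\<And>x. \<bar>\<phi> x\<bar> \<le> 1"
      then have \<phi>: "\<phi> \<in> smooth_in (cube_at x0 r)" by (simp add: cube_at_def)
      have sq: "L2_sq \<phi> \<le> measure lborel (cube_at x0 r)"
      proof -
        have "L2_sq \<phi> \<le> (LINT x|lborel. indicator (cube_at x0 r) x)"
        proof (rule integral_mono)
          show "integrable lborel (\<lambda>x. (\<phi> x)\<^sup>2)" by (rule smooth_in_integrable_square[OF \<phi> compact_cube_at])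
          show "integrable lborel (indicator (cube_at x0 r) :: _ \<Rightarrow> real)" by (intro compact_indicator compact_cube_at)
          show "(\<phi> x)\<^sup>2 \<le> indicator (cube_at x0 r) x" for x
            using smooth_in_outside[OF \<phi>, of x] \<phi>1[of x] abs_square_le_1[of "\<phi> x"] by (cases "x \<in> cube_at x0 r") auto
        qed
        then show ?thesis by (simp add: compact_indicator)
      qed
      have "\<bar>LINT x|lborel. (g x - c) * \<phi> x\<bar> \<le> C * D * (r ^ CARD('n) + L2_sq \<phi>)"
        unfolding integral_density_diff[OF compact_cube_at sub1 \<phi>] using bspec[OF c \<phi>] .
      also have "\<dots> \<le> C * D * (r ^ CARD('n) + 2 ^ CARD('n) * r ^ CARD('n))"
        using C D_nonneg sq meas by (intro mult_left_mono add_mono) auto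
      also have "\<dots> = C * (1 + 2 ^ CARD('n)) * D * r ^ CARD('n)" by (simp add: algebra_simps)
      finally show "\<bar>LINT x|lborel. (g x - c) * \<phi> x\<bar> \<le> C * (1 + 2 ^ CARD('n)) * D * r ^ CARD('n)" .
    qed
    then show "\<exists>c. int_on (cube_at x0 r) (\<lambda>x. \<bar>g x - c\<bar>) \<le> C * (1 + 2 ^ CARD('n)) * D * r ^ CARD('n)" ..
  qed
qed

text \<open>A closed cell has positive distance to the complement of \<Omega>, so its subcells below
  some size have room. From there the bound climbs by doubling the size, with the same
  \<open>K\<close> at every stage; no finiteness of a supremum has to be known in advance.\<close>

lemma oscillation_bound:
  obtains K where "K \<ge> 0"
    "\<And>\<Omega> (u :: (real^'n::finite \<Rightarrow> real) \<Rightarrow> real) D g a s. smooth_density \<Omega> u D g \<Longrightarrow> s > 0 \<Longrightarrow> cell a s \<subseteq> \<Omega> \<Longrightarrow>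
      \<exists>c. int_on (cell a s) (\<lambda>x. \<bar>g x - c\<bar>) \<le> K * D * s ^ CARD('n)"
proof -
  let ?n = "CARD('n)"
  \<comment> \<open>Chosen so that the factor (2n/N) (2 2^n) of
    \<open>oscillation_subdivision\<close> is exactly 1/2.\<close>
  define N where "N = ?n * 2 ^ (?n + 3)"
  have n1: "?n \<ge> 1" by (simp add: Suc_leI)
  have "(16::nat) \<le> 1 * 2 ^ (1 + 3)" by simp
  also have "\<dots> \<le> N" unfolding N_def using n1 by (intro mult_mono power_increasing) auto
  finally have N16: "16 \<le> N" .
  \<comment> \<open>Dropping the outer layer of a grid of N^n cells leaves a side of N - 2 meshes,
    and 1 + \<delta> = N / (N - 2) enlarges it back to the whole.\<close>
  define \<delta> where "\<delta> = 2 / (real N - 2)"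
  have \<delta>: "0 < \<delta>" "\<delta> \<le> 1" using N16 by (auto simp: \<delta>_def field_simps)
  show thesis
  proof (rule interior_oscillation[OF \<delta>, where 'n = 'n])
    fix C :: real
    assume C: "C \<ge> 0" and osc: "\<And>\<Omega> (u :: (real^'n \<Rightarrow> real) \<Rightarrow> real) D g x0 r. smooth_density \<Omega> u D g \<Longrightarrow> r > 0 \<Longrightarrow> cube_at x0 ((1 + \<delta>) * r) \<subseteq> \<Omega> \<Longrightarrow>
      \<exists>c. int_on (cube_at x0 r) (\<lambda>x. \<bar>g x - c\<bar>) \<le> C * D * r ^ ?n"
    \<comment> \<open>Half of \<open>K\<close> is the cost (1 + N^n) C of the central part; the
      other half is left for the boundary cells.\<close>
    define K where "K = 2 * ((1 + real N ^ ?n) * C)"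
    have KC: "C \<le> K"
    proof -
      have "1 * C \<le> (2 * (1 + real N ^ ?n)) * C" using C by (intro mult_right_mono) auto
      then show ?thesis by (simp add: K_def algebra_simps)
    qed
    show thesis
    proof (rule that[of K])
      show "K \<ge> 0" using C KC by linarith
      fix \<Omega> D g and a :: "real^'n" and s :: real and u :: "(real^'n \<Rightarrow> real) \<Rightarrow> real"
      assume sd: "smooth_density \<Omega> u D g" and s: "s > 0" and sub: "cell a s \<subseteq> \<Omega>"
      interpret smooth_density \<Omega> u D g by (rule sd)
      define Q where "Q = cell a s"
      have room: "\<exists>c. int_on (cell b t) (\<lambda>x. \<bar>g x - c\<bar>) \<le> C * D * t ^ ?n"
        if t: "t > 0" and sub: "cell (\<chi> i. b $ i - \<delta> * t / 2) ((1 + \<delta>) * t) \<subseteq> \<Omega>" for b :: "real^'n" and t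
      proof -
        define x0 where "x0 = b + (\<chi> i. t / 2)"
        have "cube_at x0 ((1 + \<delta>) * (t / 2)) = cell (\<chi> i. b $ i - \<delta> * t / 2) ((1 + \<delta>) * t)"
        proof -
          have "x0 - (\<chi> i. (1 + \<delta>) * (t / 2)) = (\<chi> i. b $ i - \<delta> * t / 2)"
            by (simp add: x0_def vec_eq_iff field_simps)
          then show ?thesis unfolding cube_at_cell by simp
        qed
        then obtain c where c: "int_on (cube_at x0 (t / 2)) (\<lambda>x. \<bar>g x - c\<bar>) \<le> C * D * (t / 2) ^ ?n"
          using osc[OF sd, of "t / 2" x0] t sub by auto
        have "C * D * (t / 2) ^ ?n \<le> C * D * t ^ ?n"
          using C D_nonneg t by (intro mult_left_mono power_mono) auto
        then show ?thesis using c unfolding cell_cube_at x0_def by (intro exI[of _ c]) linarith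
      qed
      obtain e where e: "e > 0" "(\<Union>x\<in>Q. cball x e) \<subseteq> \<Omega>"
        using compact_subset_open_imp_cball_epsilon_subset[of Q \<Omega>] open_domain sub by (auto simp: Q_def)
      \<comment> \<open>For t \<le> s1 the enlarged cell deviates from its corner \<open>b\<close>
        by at most 2t in each of the n coordinates, hence by at most \<open>e\<close> in
        norm.\<close>
      define s1 where "s1 = e / (2 * real ?n)"
      have s1: "s1 > 0" using e n1 by (simp add: s1_def)
      have main: "\<exists>c. int_on (cell b t) (\<lambda>x. \<bar>g x - c\<bar>) \<le> K * D * t ^ ?n"
        if "cell b t \<subseteq> Q" "t > 0" "t \<le> s1 * 2 ^ j" for b t j
        using that
      proof (induction j arbitrary: b t)
        case 0
        have "b \<in> cell b t" using 0 by (simp add: mem_cell)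
        then have bQ: "b \<in> Q" using 0 by blast
        have dt: "\<delta> * t \<le> t" "\<delta> * t \<ge> 0" using \<delta> 0 by (auto simp: mult_left_le_one_le)
        have "cell (\<chi> i. b $ i - \<delta> * t / 2) ((1 + \<delta>) * t) \<subseteq> cball b e"
        proof
          fix y assume y: "y \<in> cell (\<chi> i. b $ i - \<delta> * t / 2) ((1 + \<delta>) * t)"
          have "\<bar>(b - y) $ i\<bar> \<le> 2 * t" for i
          proof -
            have "b $ i - \<delta> * t / 2 \<le> y $ i" "y $ i \<le> b $ i - \<delta> * t / 2 + (1 + \<delta>) * t"
              using y by (auto simp: mem_cell)
            then have "b $ i - \<delta> * t / 2 \<le> y $ i" "y $ i \<le> b $ i + t + \<delta> * t / 2"
              by (simp_all add: algebra_simps)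
            then show ?thesis using dt by (simp add: abs_le_iff)
          qed
          then have "norm (b - y) \<le> (\<Sum>i\<in>(UNIV::'n set). 2 * t)"
            by (intro order_trans[OF norm_le_l1_cart] sum_mono)
          also have "\<dots> = 2 * real ?n * t" by simp
          also have "\<dots> \<le> 2 * real ?n * s1" using 0 by (intro mult_left_mono) auto
          also have "\<dots> = e" using n1 by (simp add: s1_def)
          finally show "y \<in> cball b e" by (simp add: dist_norm)
        qed
        also have "\<dots> \<subseteq> \<Omega>" using e bQ by blast
        finally obtain c where "int_on (cell b t) (\<lambda>x. \<bar>g x - c\<bar>) \<le> C * D * t ^ ?n" using room 0 by blast
        moreover have "C * D * t ^ ?n \<le> K * D * t ^ ?n" using KC D_nonneg 0 by (intro mult_right_mono) auto
        ultimately show ?case by (intro exI[of _ c]) linarith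
      next
        case (Suc j)
        define h where "h = t / real N"
        have h: "h > 0" "t = real N * h" using Suc.prems N16 by (auto simp: h_def)
        have bQ: "cell b t \<subseteq> \<Omega>" using Suc.prems sub by (simp add: Q_def)
        \<comment> \<open>The enlargement of the central cell by 1 + \<delta> is
          \<open>cell b t\<close> itself, so the centre has room however close
          \<open>cell b t\<close> is to the boundary.\<close>
        have inner: "\<exists>c. int_on (cell (\<chi> i. b $ i + h) (t - 2 * h)) (\<lambda>x. \<bar>g x - c\<bar>) \<le> C * D * (t - 2 * h) ^ ?n"
        proof (rule room)
          have "t - 2 * h = (real N - 2) * h" unfolding h(2) by (simp add: algebra_simps)
          then show "t - 2 * h > 0" using h N16 by simp
          have "\<delta> * (t - 2 * h) = 2 * h" using N16 \<open>t - 2 * h = _\<close> by (simp add: \<delta>_def)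
          then have "(\<chi> i. (\<chi> i. b $ i + h) $ i - \<delta> * (t - 2 * h) / 2) = b" "(1 + \<delta>) * (t - 2 * h) = t"
            by (simp_all add: vec_eq_iff distrib_right)
          then show "cell (\<chi> i. (\<chi> i. b $ i + h) $ i - \<delta> * (t - 2 * h) / 2) ((1 + \<delta>) * (t - 2 * h)) \<subseteq> \<Omega>"
            using bQ by simp
        qed
        then obtain c where c: "int_on (cell (\<chi> i. b $ i + h) (t - 2 * h)) (\<lambda>x. \<bar>g x - c\<bar>) \<le> C * D * (t - 2 * h) ^ ?n" ..
        have "C * D * (t - 2 * h) ^ ?n \<le> C * D * t ^ ?n"
        proof (intro mult_left_mono power_mono)
          have "2 * h \<le> real N * h" using h N16 by (intro mult_right_mono) auto
          then show "0 \<le> t - 2 * h" using h by linarith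
        qed (use h C D_nonneg in auto)
        then have c': "int_on (cell (\<chi> i. b $ i + h) (t - 2 * h)) (\<lambda>x. \<bar>g x - c\<bar>) \<le> C * D * t ^ ?n" using c by linarith
        \<comment> \<open>The blocks have side 2h \<le> t/2 because N \<ge> 4, so they fall under
          the previous stage of the induction.\<close>
        have small: "2 * h \<le> s1 * 2 ^ j"
        proof -
          have "4 * h \<le> real N * h" using h N16 by (intro mult_right_mono) auto
          then have "4 * h \<le> s1 * 2 ^ Suc j" using h Suc.prems by linarith
          then show ?thesis by simp
        qed
        have subcells: "\<exists>c'. int_on (cell b' (2 * h)) (\<lambda>x. \<bar>g x - c'\<bar>) \<le> (K * D) * (2 * h) ^ ?n"
          if "cell b' (2 * h) \<subseteq> cell b t" for b'
        proof (rule Suc.IH)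
          show "cell b' (2 * h) \<subseteq> Q" using that Suc.prems by blast
        qed (use h small in auto)
        have N4: "N \<ge> 4" using N16 by simp
        have KD: "K * D \<ge> 0" using C KC D_nonneg by simp
        have "int_on (cell b t) (\<lambda>x. \<bar>g x - c\<bar>)
          \<le> (1 + real N ^ ?n) * (C * D * t ^ ?n) + (2 * real ?n / real N) * (2 * 2 ^ ?n * (K * D) * t ^ ?n)"
          by (rule oscillation_subdivision[OF Suc.prems(2) N4 h_def density_integrable[OF compact_cell bQ] KD c' subcells])
        also have "(2 * real ?n / real N) * (2 * 2 ^ ?n * (K * D) * t ^ ?n) = (1/2) * (K * D * t ^ ?n)"
          using n1 by (simp add: N_def power_add field_simps)
        also have "(1 + real N ^ ?n) * (C * D * t ^ ?n) = (1/2) * (K * D * t ^ ?n)"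
          by (simp add: K_def)
        finally show ?case by (intro exI[of _ c]) linarith
      qed
      obtain j where "s / s1 < 2 ^ j" using real_arch_pow[of 2 "s / s1"] by auto
      then have "s \<le> s1 * 2 ^ j" using s1 by (simp add: divide_less_eq mult.commute)
      then show "\<exists>c. int_on (cell a s) (\<lambda>x. \<bar>g x - c\<bar>) \<le> K * D * s ^ ?n"
        using main[of a s j] s by (simp add: Q_def)
    qed
  qed
qed

text \<open>The mean differs from any c by at most the average of |g - c|, so passing to the mean
  costs a factor 2.\<close>

lemma mean_oscillation_bound:
  obtains K where "K \<ge> 0"
    "\<And>\<Omega> (u :: (real^'n::finite \<Rightarrow> real) \<Rightarrow> real) D g a s. smooth_density \<Omega> u D g \<Longrightarrow> s > 0 \<Longrightarrow> cell a s \<subseteq> \<Omega> \<Longrightarrow>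
      int_on (cell a s) (\<lambda>x. \<bar>g x - int_on (cell a s) g / s ^ CARD('n)\<bar>) \<le> K * D * s ^ CARD('n)"
proof (rule oscillation_bound[where 'n = 'n])
  fix K :: real
  assume K: "K \<ge> 0" and osc: "\<And>\<Omega> (u :: (real^'n \<Rightarrow> real) \<Rightarrow> real) D g a s. smooth_density \<Omega> u D g \<Longrightarrow> s > 0 \<Longrightarrow> cell a s \<subseteq> \<Omega> \<Longrightarrow>
      \<exists>c. int_on (cell a s) (\<lambda>x. \<bar>g x - c\<bar>) \<le> K * D * s ^ CARD('n)"
  show thesis
  proof (rule that[of "2 * K"])
    show "2 * K \<ge> 0" using K by simp
    fix \<Omega> D g and a :: "real^'n" and s :: real and u :: "(real^'n \<Rightarrow> real) \<Rightarrow> real"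
    assume sd: "smooth_density \<Omega> u D g" and s: "s > 0" and sub: "cell a s \<subseteq> \<Omega>"
    interpret smooth_density \<Omega> u D g by (rule sd)
    define Q where "Q = cell a s"
    have Q: "compact Q" "Q \<subseteq> \<Omega>" using sub by (auto simp: Q_def)
    note gi = density_integrable[OF Q]
    note gd = integrable_on_compact_abs_diff[OF Q(1) gi]
    define m where "m = s ^ CARD('n)"
    have m: "m > 0" using s by (simp add: m_def)
    have meas: "measure lborel Q = m" using s by (simp add: Q_def m_def measure_cell)
    obtain c where c: "int_on Q (\<lambda>x. \<bar>g x - c\<bar>) \<le> K * D * m"
      using osc[OF sd s sub] by (auto simp: Q_def m_def)
    define A where "A = int_on Q g / m"
    have "int_on Q g - c * m = (LINT x|lborel. indicator Q x * g x - indicator Q x * c)"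
      using gi compact_indicator[OF Q(1)] by (simp add: meas)
    also have "\<dots> = int_on Q (\<lambda>x. g x - c)" by (simp add: right_diff_distrib)
    also have "\<bar>\<dots>\<bar> \<le> (LINT x|lborel. \<bar>indicator Q x * (g x - c)\<bar>)" by (rule integral_abs_bound)
    finally have "\<bar>int_on Q g - c * m\<bar> \<le> K * D * m" using c by (simp add: abs_mult)
    moreover have "int_on Q g - c * m = (A - c) * m" using m by (simp add: A_def left_diff_distrib)
    ultimately have Ac: "\<bar>c - A\<bar> * m \<le> K * D * m" using m by (simp add: abs_mult abs_minus_commute)
    have "int_on Q (\<lambda>x. \<bar>g x - A\<bar>) \<le> (LINT x|lborel. indicator Q x * \<bar>g x - c\<bar> + indicator Q x * \<bar>c - A\<bar>)"
    proof (rule integral_mono)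
      show "integrable lborel (\<lambda>x. indicator Q x * \<bar>g x - A\<bar>)" by (rule gd)
      show "integrable lborel (\<lambda>x. indicator Q x * \<bar>g x - c\<bar> + indicator Q x * \<bar>c - A\<bar>)"
        by (intro Bochner_Integration.integrable_add gd integrable_mult_left compact_indicator Q)
    qed (auto simp: indicator_def)
    also have "\<dots> = int_on Q (\<lambda>x. \<bar>g x - c\<bar>) + int_on Q (\<lambda>x. \<bar>c - A\<bar>)"
      by (intro Bochner_Integration.integral_add gd integrable_mult_left compact_indicator Q)
    also have "int_on Q (\<lambda>x. \<bar>c - A\<bar>) = \<bar>c - A\<bar> * m" using int_on_const[OF Q(1), of "\<bar>c - A\<bar>"] meas by simp
    finally show "int_on (cell a s) (\<lambda>x. \<bar>g x - int_on (cell a s) g / s ^ CARD('n)\<bar>) \<le> 2 * K * D * s ^ CARD('n)"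
      using c Ac by (simp add: Q_def m_def A_def)
  qed
qed

text \<open>Given the oscillation bound around some c, only c has to be estimated. A bump \<theta>
  stretched to the cell has integral equal to the volume m, so c m is u \<theta> minus the integral
  of (g - c) \<theta>. Stretching by s \<ge> 1 does not increase derivatives, hence |u \<theta>| is
  at most a multiple of D m.\<close>

lemma large_cube_bound:
  assumes W: "W \<ge> 0"
  obtains K where "K \<ge> 0"
    "\<And>\<Omega> (u :: (real^'n::finite \<Rightarrow> real) \<Rightarrow> real) D g a s. smooth_density \<Omega> u D g \<Longrightarrow> s \<ge> 1 \<Longrightarrow> cell a s \<subseteq> \<Omega> \<Longrightarrow>
      (\<And>\<phi>. \<phi> \<in> smooth_in (cell a s) \<Longrightarrow>
        \<bar>u \<phi>\<bar> \<le> D * (L1_norm \<phi> + W * grad_L1 \<phi>)) \<Longrightarrow>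
      int_on (cell a s) (\<lambda>x. \<bar>g x\<bar>) \<le> K * D * s ^ CARD('n)"
proof (rule oscillation_bound[where 'n = 'n])
  fix K :: real
  assume K: "K \<ge> 0" and osc: "\<And>\<Omega> (u :: (real^'n \<Rightarrow> real) \<Rightarrow> real) D g a s. smooth_density \<Omega> u D g \<Longrightarrow> s > 0 \<Longrightarrow> cell a s \<subseteq> \<Omega> \<Longrightarrow>
      \<exists>c. int_on (cell a s) (\<lambda>x. \<bar>g x - c\<bar>) \<le> K * D * s ^ CARD('n)"
  obtain P \<rho> :: "real^'n \<Rightarrow> real" where \<rho>: "\<rho> \<in> smooth_in (cube (1/2))" and \<rho>1: "(LINT x|lborel. \<rho> x) = 1"
    using radial_mollifier[of "1/2", where 'n = 'n] by (metis half_gt_zero zero_less_one)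
  obtain M where M: "M \<ge> 0" "\<And>x. \<bar>\<rho> x\<bar> \<le> M" using smooth_in_bounded[OF \<rho> compact_cube] by metis
  define L where "L = L1_norm \<rho> + W * grad_L1 \<rho>"
  have L: "L \<ge> 0" unfolding L_def using W by (intro add_nonneg_nonneg mult_nonneg_nonneg sum_nonneg integral_nonneg_AE) auto
  show thesis
  proof (rule that[of "K + (L + M * K)"])
    show "K + (L + M * K) \<ge> 0" using K L M by simp
    fix \<Omega> D g and a :: "real^'n" and s :: real and u :: "(real^'n \<Rightarrow> real) \<Rightarrow> real"
    assume sd: "smooth_density \<Omega> u D g" and s1: "s \<ge> 1" and sub: "cell a s \<subseteq> \<Omega>"
      and bd: "\<And>\<phi>. \<phi> \<in> smooth_in (cell a s) \<Longrightarrow>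
        \<bar>u \<phi>\<bar> \<le> D * (L1_norm \<phi> + W * grad_L1 \<phi>)"
    interpret smooth_density \<Omega> u D g by (rule sd)
    have s: "s > 0" using s1 by linarith
    define Q where "Q = cell a s"
    have Q: "compact Q" "Q \<subseteq> \<Omega>" using sub by (auto simp: Q_def)
    note gi = density_integrable[OF Q]
    note gd = integrable_on_compact_abs_diff[OF Q(1) gi]
    define m where "m = s ^ CARD('n)"
    have m: "m > 0" using s by (simp add: m_def)
    have meas: "measure lborel Q = m" using s by (simp add: Q_def m_def measure_cell)
    obtain c where c: "int_on Q (\<lambda>x. \<bar>g x - c\<bar>) \<le> K * D * m"
      using osc[OF sd s sub] by (auto simp: Q_def m_def)
    \<comment> \<open>The map x to b + x/s takes \<open>cell a s\<close> onto
      \<open>cube (1/2)\<close>, which contains the support of \<rho>.\<close>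
    define b where "b = (\<chi> i. - (a $ i + s / 2) / s)"
    define \<theta> where "\<theta> = (\<lambda>x. \<rho> (b + (1/s) *\<^sub>R x))"
    have \<rho>s: "smooth \<rho>" by (rule smooth_inD[OF \<rho>])
    have scale: "(LINT x|lborel. F (b + (1/s) *\<^sub>R x)) = m * (LINT x|lborel. F x)"
      if "F \<in> borel_measurable borel" for F :: "real^'n \<Rightarrow> real"
      using lborel_integral_affine[OF that, of "1/s" b] s by (simp add: m_def power_divide field_simps)
    have \<theta>: "\<theta> \<in> smooth_in Q"
    proof -
      have "\<theta> x = 0" if "x \<notin> Q" for x
      proof -
        have "\<exists>i. \<not> (a $ i \<le> x $ i \<and> x $ i \<le> a $ i + s)" using that unfolding Q_def mem_cell by blast
        then obtain i where i: "\<not> (a $ i \<le> x $ i \<and> x $ i \<le> a $ i + s)" ..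
        have e: "(b + (1/s) *\<^sub>R x) $ i = (x $ i - (a $ i + s / 2)) / s" by (simp add: b_def diff_divide_distrib add_divide_distrib)
        have "\<bar>x $ i - (a $ i + s / 2)\<bar> > s / 2" using i by linarith
        then have "\<bar>(b + (1/s) *\<^sub>R x) $ i\<bar> > 1/2" unfolding e using s by (simp add: abs_divide less_divide_eq)
        then have "b + (1/s) *\<^sub>R x \<notin> cube (1/2)" unfolding mem_cube by (meson not_le)
        then show ?thesis using smooth_in_outside[OF \<rho>] by (simp add: \<theta>_def)
      qed
      then show ?thesis using smooth_affine(1)[OF \<rho>s, of b "1/s"] by (auto simp: smooth_in_def \<theta>_def)
    qed
    have \<theta>1: "(LINT x|lborel. \<theta> x) = m"
      unfolding \<theta>_def using scale[OF smooth_borel_measurable[OF \<rho>s]] \<rho>1 by simp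
    have \<theta>M: "\<bar>\<theta> x\<bar> \<le> M" for x unfolding \<theta>_def by (rule M(2))
    have u\<theta>: "\<bar>u \<theta>\<bar> \<le> D * (m * L)"
    proof -
      have "L1_norm \<theta> = m * L1_norm \<rho>"
      proof -
        have "(\<lambda>x. \<bar>\<rho> x\<bar>) \<in> borel_measurable borel" using smooth_borel_measurable[OF \<rho>s] by measurable
        from scale[OF this] show ?thesis by (simp add: \<theta>_def)
      qed
      moreover have "L1_norm (partial_deriv j \<theta>) \<le> m * L1_norm (partial_deriv j \<rho>)" for j
      proof -
        have "(\<lambda>x. \<bar>partial_deriv j \<rho> x\<bar>) \<in> borel_measurable borel"
          using smooth_borel_measurable[OF smooth_partial[OF \<rho>s, of j]] by measurable
        from scale[OF this]
        have "L1_norm (partial_deriv j \<theta>) = (1 / s) * (m * L1_norm (partial_deriv j \<rho>))"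
          using s by (simp add: \<theta>_def partial_deriv_affine[OF \<rho>s] abs_mult)
        also have "\<dots> \<le> 1 * (m * L1_norm (partial_deriv j \<rho>))"
          using s1 m by (intro mult_right_mono mult_nonneg_nonneg integral_nonneg_AE) auto
        finally show ?thesis by simp
      qed
      then have "grad_L1 \<theta> \<le> m * grad_L1 \<rho>"
        unfolding sum_distrib_left by (intro sum_mono)
      from mult_left_mono[OF this W]
      have "W * grad_L1 \<theta> \<le> m * (W * grad_L1 \<rho>)"
        by (simp add: ac_simps)
      ultimately have "L1_norm \<theta> + W * grad_L1 \<theta> \<le> m * L"
        by (simp add: L_def distrib_left)
      then have "D * (L1_norm \<theta> + W * grad_L1 \<theta>) \<le> D * (m * L)"
        by (intro mult_left_mono D_nonneg)
      then show ?thesis using bd[of \<theta>] \<theta> unfolding Q_def by linarith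
    qed
    have "\<bar>c\<bar> * m = \<bar>c * (LINT x|lborel. \<theta> x)\<bar>" using m by (simp add: \<theta>1 abs_mult)
    also have "c * (LINT x|lborel. \<theta> x) = u \<theta> - (LINT x|lborel. (g x - c) * \<theta> x)"
      using integral_density_diff[OF Q \<theta>, of c] by simp
    also have "\<bar>\<dots>\<bar> \<le> \<bar>u \<theta>\<bar> + \<bar>LINT x|lborel. (g x - c) * \<theta> x\<bar>" by (rule abs_triangle_ineq4)
    also have "\<bar>LINT x|lborel. (g x - c) * \<theta> x\<bar> \<le> (LINT x|lborel. \<bar>(g x - c) * \<theta> x\<bar>)" by (rule integral_abs_bound)
    also have "\<dots> \<le> (LINT x|lborel. M * (indicator Q x * \<bar>g x - c\<bar>))"
    proof (rule integral_mono)
      have "integrable lborel (\<lambda>x. g x * \<theta> x - c * \<theta> x)"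
        by (intro Bochner_Integration.integrable_diff integrable_density_mult[OF Q \<theta>] integrable_mult_right smooth_in_integrable1[OF \<theta> Q(1)])
      then have "integrable lborel (\<lambda>x. (g x - c) * \<theta> x)" by (simp add: left_diff_distrib)
      then show "integrable lborel (\<lambda>x. \<bar>(g x - c) * \<theta> x\<bar>)" by (rule integrable_abs)
      show "integrable lborel (\<lambda>x. M * (indicator Q x * \<bar>g x - c\<bar>))" by (intro integrable_mult_right gd)
      show "\<bar>(g x - c) * \<theta> x\<bar> \<le> M * (indicator Q x * \<bar>g x - c\<bar>)" for x
        using smooth_in_outside[OF \<theta>, of x] mult_right_mono[OF \<theta>M[of x], of "\<bar>g x - c\<bar>"]
        by (cases "x \<in> Q") (auto simp: abs_mult mult.commute)
    qed
    also have "\<dots> \<le> M * (K * D * m)" using c M by (simp add: mult_left_mono)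
    finally have cm: "\<bar>c\<bar> * m \<le> (L + M * K) * D * m" using u\<theta> by (simp add: algebra_simps)
    have "int_on Q (\<lambda>x. \<bar>g x\<bar>) \<le> (LINT x|lborel. indicator Q x * \<bar>g x - c\<bar> + indicator Q x * \<bar>c\<bar>)"
    proof (rule integral_mono)
      show "integrable lborel (\<lambda>x. indicator Q x * \<bar>g x\<bar>)" using gd[of 0] by simp
      show "integrable lborel (\<lambda>x. indicator Q x * \<bar>g x - c\<bar> + indicator Q x * \<bar>c\<bar>)"
        by (intro Bochner_Integration.integrable_add gd integrable_mult_left compact_indicator Q)
    qed (auto simp: indicator_def)
    also have "\<dots> = int_on Q (\<lambda>x. \<bar>g x - c\<bar>) + int_on Q (\<lambda>x. \<bar>c\<bar>)"
      by (intro Bochner_Integration.integral_add gd integrable_mult_left compact_indicator Q)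
    also have "int_on Q (\<lambda>x. \<bar>c\<bar>) = \<bar>c\<bar> * m" using int_on_const[OF Q(1), of "\<bar>c\<bar>"] meas by simp
    also have "int_on Q (\<lambda>x. \<bar>g x - c\<bar>) + \<bar>c\<bar> * m \<le> (K + (L + M * K)) * D * m"
      using c cm by (simp add: algebra_simps)
    finally show "int_on (cell a s) (\<lambda>x. \<bar>g x\<bar>) \<le> (K + (L + M * K)) * D * s ^ CARD('n)"
      by (simp add: Q_def m_def)
  qed
qed

section \<open>Functionals in the space of exponent one\<close>

text \<open>Ensures that \<open>enn2real\<close> of this norm is the norm itself and not the default
  value 0 at infinity.\<close>

lemma d_norm_finite:
  fixes \<Omega> :: "(real^'n::{finite,linorder}) set"
  assumes "u \<in> d_space k \<Omega>"
  shows "d_norm k \<Omega> u < \<infinity>"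
proof -
  obtain C where C: "C > 0"
    "\<forall>\<Phi>\<in>test_forms k \<Omega>. \<forall>I. card I = k \<longrightarrow> \<bar>u (\<Phi> I)\<bar> \<le> C * form_Upsilon1_norm k \<Omega> \<Phi>"
    using assms unfolding d_space_def by blast
  have "d_norm k \<Omega> u \<le> ennreal C"
    unfolding d_norm_def
  proof (rule SUP_least)
    fix p assume p: "p \<in> {(\<Phi>, I :: 'n set). \<Phi> \<in> test_forms k \<Omega> \<and> form_Upsilon1_norm k \<Omega> \<Phi> \<le> 1 \<and> card I = k}"
    obtain \<Phi> I where pe: "p = (\<Phi>, I)" by (cases p)
    have *: "\<Phi> \<in> test_forms k \<Omega>" "form_Upsilon1_norm k \<Omega> \<Phi> \<le> 1" "card I = k" using p unfolding pe by auto
    have "\<bar>u (\<Phi> I)\<bar> \<le> C * form_Upsilon1_norm k \<Omega> \<Phi>" using C(2) * by blast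
    also have "\<dots> \<le> C * 1" using C(1) * by (intro mult_left_mono) auto
    finally show "(case p of (\<Phi>, I) \<Rightarrow> ennreal \<bar>u (\<Phi> I)\<bar>) \<le> ennreal C"
      by (simp add: pe ennreal_leI)
  qed
  then show ?thesis by (rule order_le_less_trans) simp
qed

lemma d_norm_bound:
  assumes u: "u \<in> d_space k \<Omega>" and \<Phi>: "\<Phi> \<in> test_forms k \<Omega>" "form_Upsilon1_norm k \<Omega> \<Phi> \<le> 1" and I: "card I = k"
  shows "\<bar>u (\<Phi> I)\<bar> \<le> enn2real (d_norm k \<Omega> u)"
proof -
  have "(case (\<Phi>, I) of (\<Phi>, I) \<Rightarrow> ennreal \<bar>u (\<Phi> I)\<bar>) \<le> d_norm k \<Omega> u"
    unfolding d_norm_def by (rule SUP_upper) (use \<Phi> I in simp)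
  then have "ennreal \<bar>u (\<Phi> I)\<bar> \<le> d_norm k \<Omega> u" by simp
  then have "enn2real (ennreal \<bar>u (\<Phi> I)\<bar>) \<le> enn2real (d_norm k \<Omega> u)"
    using d_norm_finite[OF u] by (intro enn2real_mono) auto
  then show ?thesis by simp
qed

lemma lebesgue_integral_on_eq_lborel:
  fixes F :: "'a::euclidean_space \<Rightarrow> real"
  assumes "F \<in> borel_measurable borel" "\<And>x. x \<notin> \<Omega> \<Longrightarrow> F x = 0"
  shows "(LINT x:\<Omega>|lebesgue. F x) = (LINT x|lborel. F x)"
proof -
  have "(\<lambda>x. indicator \<Omega> x *\<^sub>R F x) = F" using assms(2) by (auto simp: indicator_def fun_eq_iff)
  then show ?thesis
    using assms(1) by (simp add: set_lebesgue_integral_def integral_completion)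
qed

lemma smooth_in_abs_integral:
  fixes f :: "real^'n::finite \<Rightarrow> real"
  assumes "f \<in> smooth_in K" "K \<subseteq> \<Omega>"
  shows "(LINT x:\<Omega>|lebesgue. \<bar>f x\<bar>) = L1_norm f"
proof (rule lebesgue_integral_on_eq_lborel)
  show "(\<lambda>x. \<bar>f x\<bar>) \<in> borel_measurable borel"
    using smooth_borel_measurable[OF smooth_inD[OF assms(1)]] by measurable
  show "\<bar>f x\<bar> = 0" if "x \<notin> \<Omega>" for x
    using smooth_in_outside[OF assms(1), of x] assms(2) that by auto
qed

lemma form_L1_norm_1: "form_L1_norm 1 \<Omega> \<Phi> = (\<Sum>i\<in>UNIV. LINT x:\<Omega>|lebesgue. \<bar>\<Phi> {i} x\<bar>)"
proof -
  have "{I :: 'a set. card I = 1} = range (\<lambda>i. {i})"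
    by (auto simp: card_1_singleton_iff)
  moreover have "inj (\<lambda>i :: 'a. {i})" by (simp add: inj_def)
  ultimately show ?thesis
    unfolding form_L1_norm_def by (simp add: sum.reindex)
qed

text \<open>The norm of \<open>u\<close> is a supremum over forms of norm at most 1, and this
  restores homogeneity. For S = 0 normalisation is impossible, but then every t > 0 is admissible,
  which forces v = 0.\<close>

lemma homogeneous_bound:
  fixes v :: real
  assumes "\<And>t. t > 0 \<Longrightarrow> t * S \<le> 1 \<Longrightarrow> t * v \<le> D" and "S \<ge> 0" "v \<ge> 0" "D \<ge> 0"
  shows "v \<le> D * S"
proof (cases "S = 0")
  case True
  show ?thesis
  proof (rule ccontr)
    assume "\<not> v \<le> D * S"
    then have "v > 0" using True by simp
    then have "(D + 1) / v * v \<le> D" using assms True by (intro assms(1)) auto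
    then show False using \<open>v > 0\<close> by simp
  qed
next
  case False
  then have "1 / S * v \<le> D" using assms by (intro assms(1)) auto
  then show ?thesis using False assms(2) by (simp add: field_simps)
qed

text \<open>The form d\<psi>, with \<open>the_elem\<close> reading off the index of a singleton. As
  d(d\<psi>) = 0, its norm has no contribution from the exterior derivative.\<close>

lemma exact_form_norm:
  fixes \<psi> :: "real^'n::{finite,linorder} \<Rightarrow> real"
  assumes \<psi>: "\<psi> \<in> smooth_in K" and K: "compact K" "K \<subseteq> \<Omega>"
  defines "\<Phi> \<equiv> \<lambda>I. partial_deriv (the_elem I) \<psi>"
  shows "\<Phi> \<in> test_forms 1 \<Omega>"
    and "form_Upsilon1_norm 1 \<Omega> \<Phi> = grad_L1 \<psi>"
proof -
  note p = smooth_in_partial[OF compact_imp_closed[OF K(1)] \<psi>]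
  show "\<Phi> \<in> test_forms 1 \<Omega>"
    unfolding test_forms_def \<Phi>_def using smooth_in_test_functions[OF K p] by simp
  have "ext_deriv \<Phi> J x = 0" if J: "card J = 1 + 1" for J x
  proof -
    obtain p q where pq: "J = {p, q}" "p < q"
    proof -
      from J obtain p q where "J = {p, q}" "p \<noteq> q" by (auto simp: card_2_iff numeral_2_eq_2[symmetric])
      then show ?thesis using that[of p q] that[of q p] by (cases "p < q") (auto simp: insert_commute)
    qed
    \<comment> \<open>For J = {p, q} with p < q the signs are plus for p and minus for q, so the two
      mixed derivatives cancel.\<close>
    have "{i \<in> J. i < p} = {}" "{i \<in> J. i < q} = {p}" and J': "J - {p} = {q}" "J - {q} = {p}"
      using pq by auto
    then have c: "card {i \<in> J. i < p} = 0" "card {i \<in> J. i < q} = 1" by simp_all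
    have "(\<Sum>j\<in>J. F j) = F p + F q" for F :: "'n \<Rightarrow> real" using pq by simp
    then show ?thesis
      using partial_deriv_commute[OF smooth_inD[OF \<psi>], of p q x]
      unfolding ext_deriv_def by (simp add: c J' \<Phi>_def)
  qed
  then have "form_L1_norm (1 + 1) \<Omega> (ext_deriv \<Phi>) = 0"
    unfolding form_L1_norm_def by (intro sum.neutral ballI) (simp add: set_lebesgue_integral_def)
  moreover have "form_L1_norm 1 \<Omega> \<Phi> = grad_L1 \<psi>"
    unfolding form_L1_norm_1 \<Phi>_def by (simp add: smooth_in_abs_integral[OF p K(2)])
  ultimately show "form_Upsilon1_norm 1 \<Omega> \<Phi> = grad_L1 \<psi>"
    by (simp add: form_Upsilon1_norm_def)
qed

lemma single_component_form_norm:
  fixes \<phi> :: "real^'n::{finite,linorder} \<Rightarrow> real" and i0 :: 'n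
  assumes \<phi>: "\<phi> \<in> smooth_in K" and K: "compact K" "K \<subseteq> \<Omega>"
  defines "\<Phi> \<equiv> \<lambda>I. if I = {i0} then \<phi> else (\<lambda>x. 0)"
  shows "\<Phi> \<in> test_forms 1 \<Omega>"
    and "form_Upsilon1_norm 1 \<Omega> \<Phi>
      \<le> L1_norm \<phi> + 2 ^ CARD('n) * grad_L1 \<phi>"
proof -
  have \<Phi>in: "\<Phi> I \<in> smooth_in K" for I unfolding \<Phi>_def using \<phi> smooth_in_zero by auto
  note C = compact_imp_closed[OF K(1)]
  note p = smooth_in_partial[OF C \<phi>]
  show "\<Phi> \<in> test_forms 1 \<Omega>"
    unfolding test_forms_def using smooth_in_test_functions[OF K \<Phi>in] by simp
  have "(LINT x:\<Omega>|lebesgue. \<bar>\<Phi> {i} x\<bar>) = (if i = i0 then LINT x|lborel. \<bar>\<phi> x\<bar> else 0)" for i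
    using smooth_in_abs_integral[OF \<phi> K(2)] by (simp add: \<Phi>_def set_lebesgue_integral_def)
  then have 1: "form_L1_norm 1 \<Omega> \<Phi> = L1_norm \<phi>"
    unfolding form_L1_norm_1 by simp
  define S where "S = grad_L1 \<phi>"
  have S0: "S \<ge> 0" unfolding S_def by (intro sum_nonneg integral_nonneg_AE) auto
  have ext: "(LINT x:\<Omega>|lebesgue. \<bar>ext_deriv \<Phi> J x\<bar>) \<le> S" for J
  proof -
    have in': "ext_deriv \<Phi> J \<in> smooth_in K"
      unfolding ext_deriv_def[abs_def] by (intro smooth_in_sum smooth_in_cmult smooth_in_partial C \<Phi>in)
    have "(LINT x:\<Omega>|lebesgue. \<bar>ext_deriv \<Phi> J x\<bar>) = (LINT x|lborel. \<bar>ext_deriv \<Phi> J x\<bar>)"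
      by (rule smooth_in_abs_integral[OF in' K(2)])
    also have "\<dots> \<le> (LINT x|lborel. (\<Sum>j\<in>UNIV. \<bar>partial_deriv j \<phi> x\<bar>))"
    proof (rule integral_mono)
      show "integrable lborel (\<lambda>x. \<bar>ext_deriv \<Phi> J x\<bar>)" by (intro integrable_abs smooth_in_integrable1[OF in' K(1)])
      show "integrable lborel (\<lambda>x. \<Sum>j\<in>UNIV. \<bar>partial_deriv j \<phi> x\<bar>)"
        by (intro Bochner_Integration.integrable_sum integrable_abs smooth_in_integrable1[OF p K(1)])
      fix x
      have "\<bar>ext_deriv \<Phi> J x\<bar> \<le> (\<Sum>j\<in>J. \<bar>(- 1) ^ card {i \<in> J. i < j} * partial_deriv j (\<Phi> (J - {j})) x\<bar>)"
        unfolding ext_deriv_def by (rule sum_abs)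
      also have "\<dots> \<le> (\<Sum>j\<in>J. \<bar>partial_deriv j \<phi> x\<bar>)"
        by (intro sum_mono) (simp add: abs_mult power_abs \<Phi>_def partial_deriv_const)
      also have "\<dots> \<le> (\<Sum>j\<in>UNIV. \<bar>partial_deriv j \<phi> x\<bar>)" by (intro sum_mono2) auto
      finally show "\<bar>ext_deriv \<Phi> J x\<bar> \<le> (\<Sum>j\<in>UNIV. \<bar>partial_deriv j \<phi> x\<bar>)" .
    qed
    also have "\<dots> = S"
      unfolding S_def by (intro Bochner_Integration.integral_sum integrable_abs smooth_in_integrable1[OF p K(1)])
    finally show ?thesis .
  qed
  have "form_L1_norm (1 + 1) \<Omega> (ext_deriv \<Phi>) \<le> (\<Sum>J | card (J :: 'n set) = 1 + 1. S)"
    unfolding form_L1_norm_def by (intro sum_mono ext)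
  also have "\<dots> = real (card {J :: 'n set. card J = 1 + 1}) * S" by simp
  \<comment> \<open>A crude count: two-element index sets are among all 2^n subsets.\<close>
  also have "\<dots> \<le> 2 ^ CARD('n) * S"
  proof (intro mult_right_mono S0)
    have "card {J :: 'n set. card J = 1 + 1} \<le> card (Pow (UNIV :: 'n set))"
      by (intro card_mono) auto
    also have "\<dots> = 2 ^ CARD('n)" by (simp add: card_Pow)
    finally show "real (card {J :: 'n set. card J = 1 + 1}) \<le> 2 ^ CARD('n)"
      by (metis of_nat_le_iff of_nat_numeral of_nat_power)
  qed
  finally show "form_Upsilon1_norm 1 \<Omega> \<Phi>
      \<le> L1_norm \<phi> + 2 ^ CARD('n) * grad_L1 \<phi>"
    using 1 by (simp add: form_Upsilon1_norm_def S_def)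
qed

lemma distribution_linear:
  assumes "u \<in> distributions \<Omega>" "compact K" "K \<subseteq> \<Omega>"
  shows "linear_on_smooth K u"
  using assms(1) smooth_in_test_functions[OF assms(2,3)]
  unfolding linear_on_smooth_def distributions_def by blast

lemma d_space_gradient_bound:
  fixes \<Omega> :: "(real^'n::{finite,linorder}) set"
  assumes u: "u \<in> d_space 1 \<Omega>" and K: "compact K" "K \<subseteq> \<Omega>"
  shows "gradient_bound K u (enn2real (d_norm 1 \<Omega> u))"
  unfolding gradient_bound_def
proof (intro ballI allI)
  fix \<psi> :: "real^'n::{finite,linorder} \<Rightarrow> real" and i assume \<psi>: "\<psi> \<in> smooth_in K"
  have lin: "linear_on_smooth K u" using distribution_linear[OF _ K] u by (simp add: d_space_def)
  note p = smooth_in_partial[OF compact_imp_closed[OF K(1)] \<psi>]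
  show "\<bar>u (partial_deriv i \<psi>)\<bar> \<le> enn2real (d_norm 1 \<Omega> u) * grad_L1 \<psi>"
  proof (rule homogeneous_bound)
    fix t :: real assume t: "t > 0" "t * grad_L1 \<psi> \<le> 1"
    have pd: "partial_deriv j (\<lambda>x. t * \<psi> x) = (\<lambda>x. t * partial_deriv j \<psi> x)" for j
      by (rule partial_deriv_cmult[OF smooth_inD[OF \<psi>]])
    note f = exact_form_norm[OF smooth_in_cmult[OF \<psi>, of t] K]
    have "form_Upsilon1_norm 1 \<Omega> (\<lambda>I. partial_deriv (the_elem I) (\<lambda>x. t * \<psi> x)) \<le> 1"
      unfolding f(2) unfolding pd using t by (simp add: abs_mult sum_distrib_left)
    from d_norm_bound[OF u f(1) this, of "{i}"]
    have "\<bar>u (\<lambda>x. t * partial_deriv i \<psi> x)\<bar> \<le> enn2real (d_norm 1 \<Omega> u)" by (simp add: pd)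
    then show "t * \<bar>u (partial_deriv i \<psi>)\<bar> \<le> enn2real (d_norm 1 \<Omega> u)"
      using t(1) by (simp add: linear_on_smooth_cmult[OF lin p] abs_mult)
  qed (auto intro!: sum_nonneg integral_nonneg_AE)
qed

text \<open>Exact forms only yield test functions of integral 0, which cannot detect the mean of the
  density. A form with a single component can, at the price of all first derivatives of
  \<phi>.\<close>

lemma d_space_zero_order_bound:
  fixes \<Omega> :: "(real^'n::{finite,linorder}) set"
  assumes u: "u \<in> d_space 1 \<Omega>" and K: "compact K" "K \<subseteq> \<Omega>" and \<phi>: "\<phi> \<in> smooth_in K"
  shows "\<bar>u \<phi>\<bar> \<le> enn2real (d_norm 1 \<Omega> u) *
    (L1_norm \<phi> + 2 ^ CARD('n) * grad_L1 \<phi>)"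
proof (rule homogeneous_bound)
  have lin: "linear_on_smooth K u" using distribution_linear[OF _ K] u by (simp add: d_space_def)
  fix t :: real assume t: "t > 0"
    "t * (L1_norm \<phi> + 2 ^ CARD('n) * grad_L1 \<phi>) \<le> 1"
  have pd: "partial_deriv j (\<lambda>x. t * \<phi> x) = (\<lambda>x. t * partial_deriv j \<phi> x)" for j
    by (rule partial_deriv_cmult[OF smooth_inD[OF \<phi>]])
  \<comment> \<open>An arbitrary coordinate: the estimate of the form norm is the same for each of
    them.\<close>
  define i0 :: 'n where "i0 = undefined"
  note f = single_component_form_norm[OF smooth_in_cmult[OF \<phi>, of t] K, of i0]
  note f(2)
  also have "(LINT x|lborel. \<bar>t * \<phi> x\<bar>) + 2 ^ CARD('n) * (\<Sum>j\<in>UNIV. LINT x|lborel. \<bar>partial_deriv j (\<lambda>x. t * \<phi> x) x\<bar>) \<le> 1"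
    unfolding pd using t by (simp add: abs_mult sum_distrib_left[symmetric] algebra_simps)
  finally have "form_Upsilon1_norm 1 \<Omega> (\<lambda>I. if I = {i0} then \<lambda>x. t * \<phi> x else (\<lambda>x. 0)) \<le> 1" .
  from d_norm_bound[OF u f(1) this, of "{i0}"]
  have "\<bar>u (\<lambda>x. t * \<phi> x)\<bar> \<le> enn2real (d_norm 1 \<Omega> u)" by simp
  then show "t * \<bar>u \<phi>\<bar> \<le> enn2real (d_norm 1 \<Omega> u)"
    using t(1) by (simp add: linear_on_smooth_cmult[OF lin \<phi>] abs_mult)
qed (auto intro!: add_nonneg_nonneg mult_nonneg_nonneg sum_nonneg integral_nonneg_AE)

section \<open>Averages over cells and the final estimate\<close>

lemma average_cell:
  fixes f :: "real^'n::finite \<Rightarrow> real"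
  assumes "f \<in> borel_measurable borel" "s > 0"
  shows "average (cell a s) f = int_on (cell a s) f / s ^ CARD('n)"
proof -
  have "(LINT x:cell a s|lebesgue. f x) = int_on (cell a s) f"
    unfolding set_lebesgue_integral_def using assms(1) by (subst integral_completion) auto
  then show ?thesis
    using assms(2) by (simp add: average_def measure_completion measure_cell)
qed

lemma bmo_norm_le:
  fixes g :: "real^'n::finite \<Rightarrow> real"
  assumes g: "g \<in> borel_measurable borel"
    and osc: "\<And>a s. s > 0 \<Longrightarrow> cell a s \<subseteq> \<Omega> \<Longrightarrow>
      int_on (cell a s) (\<lambda>x. \<bar>g x - int_on (cell a s) g / s ^ CARD('n)\<bar>) \<le> A * s ^ CARD('n)"
    and large: "\<And>a s. s \<ge> 1 \<Longrightarrow> cell a s \<subseteq> \<Omega> \<Longrightarrow> int_on (cell a s) (\<lambda>x. \<bar>g x\<bar>) \<le> B * s ^ CARD('n)"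
  shows "bmo_norm \<Omega> g \<le> ennreal A + ennreal B"
  unfolding bmo_norm_def
proof (intro add_mono SUP_least)
  fix Q assume "Q \<in> {Q \<in> cubes_in \<Omega>. measure lebesgue Q \<le> 1}"
  then obtain a s where Q: "s > 0" "Q = cell a s" "cell a s \<subseteq> \<Omega>" by (auto simp: cubes_in_def cell_def)
  have "(\<lambda>x. \<bar>g x - average Q g\<bar>) \<in> borel_measurable borel" using g by measurable
  then have "average Q (\<lambda>x. \<bar>g x - average Q g\<bar>) \<le> A"
    using osc[OF Q(1,3)] Q(1) by (simp add: Q(2) average_cell g pos_divide_le_eq)
  then show "ennreal (average Q (\<lambda>x. \<bar>g x - average Q g\<bar>)) \<le> ennreal A" by (rule ennreal_leI)
next
  fix Q assume "Q \<in> {Q \<in> cubes_in \<Omega>. measure lebesgue Q > 1}"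
  then obtain a s where Q: "s > 0" "Q = cell a s" "cell a s \<subseteq> \<Omega>" and m: "measure lebesgue Q > 1"
    by (auto simp: cubes_in_def cell_def)
  \<comment> \<open>Volume above 1 forces side at least 1, the range in which \<open>large\<close>
    is available.\<close>
  have "s ^ CARD('n) > 1" using m Q(1) by (simp add: Q(2) measure_completion measure_cell)
  then have "s \<ge> 1" using power_le_one[of s "CARD('n)"] Q(1) by linarith
  have "(\<lambda>x. \<bar>g x\<bar>) \<in> borel_measurable borel" using g by measurable
  then have "average Q (\<lambda>x. \<bar>g x\<bar>) \<le> B"
    using large[OF \<open>s \<ge> 1\<close> Q(3)] Q(1) by (simp add: Q(2) average_cell pos_divide_le_eq)
  then show "ennreal (average Q (\<lambda>x. \<bar>g x\<bar>)) \<le> ennreal B" by (rule ennreal_leI)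
qed

theorem theorem1p7:
  fixes \<Omega> :: "(real^'n::{finite,linorder}) set"
  assumes "bounded \<Omega>" and "lipschitz_domain \<Omega>"
  shows "\<exists>C::real. C > 0 \<and>
    (\<forall>u\<in>d_space 1 \<Omega>. \<exists>g\<in>bmo_space \<Omega>.
       represents \<Omega> g u \<and> bmo_norm \<Omega> g \<le> ennreal C * d_norm 1 \<Omega> u)"
proof -
  have \<Omega>: "open \<Omega>" "\<Omega> \<noteq> {}" using assms(2) by (auto simp: lipschitz_domain_def)
  have W: "(2::real) ^ CARD('n) \<ge> 0" by simp
  show ?thesis
  proof (rule mean_oscillation_bound[where 'n = 'n])
    fix A :: real
    assume A: "A \<ge> 0" and osc:
      "\<And>\<Omega> (u :: (real^'n::{finite,linorder} \<Rightarrow> real) \<Rightarrow> real) D g a s. smooth_density \<Omega> u D g \<Longrightarrow> s > 0 \<Longrightarrow> cell a s \<subseteq> \<Omega> \<Longrightarrow>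
        int_on (cell a s) (\<lambda>x. \<bar>g x - int_on (cell a s) g / s ^ CARD('n)\<bar>) \<le> A * D * s ^ CARD('n)"
    show ?thesis
    proof (rule large_cube_bound[OF W, where 'n = 'n])
      fix B :: real
      assume B: "B \<ge> 0" and large:
        "\<And>\<Omega> (u :: (real^'n::{finite,linorder} \<Rightarrow> real) \<Rightarrow> real) D g a s. smooth_density \<Omega> u D g \<Longrightarrow> s \<ge> 1 \<Longrightarrow> cell a s \<subseteq> \<Omega> \<Longrightarrow>
          (\<And>\<phi>. \<phi> \<in> smooth_in (cell a s) \<Longrightarrow>
            \<bar>u \<phi>\<bar> \<le> D * (L1_norm \<phi> + 2 ^ CARD('n) * grad_L1 \<phi>)) \<Longrightarrow>
          int_on (cell a s) (\<lambda>x. \<bar>g x\<bar>) \<le> B * D * s ^ CARD('n)"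
      show ?thesis
      proof (intro exI conjI ballI)
        \<comment> \<open>\<open>A\<close> and \<open>B\<close> were obtained before
          \<open>u\<close>, so the constant is uniform; the summand 1 keeps it positive even if both
          vanish.\<close>
        show "A + B + 1 > 0" using A B by simp
        fix u assume u: "u \<in> d_space 1 \<Omega>"
        define D where "D = enn2real (d_norm 1 \<Omega> u)"
        have D: "D \<ge> 0" "d_norm 1 \<Omega> u = ennreal D"
          using d_norm_finite[OF u] by (auto simp: D_def less_top)
        have ud: "u \<in> distributions \<Omega>" using u by (simp add: d_space_def)
        have "\<exists>g. smooth_density \<Omega> u D g"
        proof (rule density_exists[OF \<Omega> D(1)])
          show lin: "linear_on_smooth K u" and gb: "gradient_bound K u D" if "compact K" "K \<subseteq> \<Omega>" for K
            using distribution_linear[OF ud that] d_space_gradient_bound[OF u that] by (simp_all add: D_def)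
          fix g :: "real^'n::{finite,linorder} \<Rightarrow> real"
          assume g: "g \<in> borel_measurable borel"
            "\<And>K. compact K \<Longrightarrow> K \<subseteq> \<Omega> \<Longrightarrow> integrable lborel (\<lambda>x. indicator K x * g x)"
            "\<And>K \<phi>. compact K \<Longrightarrow> K \<subseteq> \<Omega> \<Longrightarrow> \<phi> \<in> smooth_in K \<Longrightarrow> u \<phi> = (LINT x|lborel. g x * \<phi> x)"
          have "smooth_density \<Omega> u D g" by unfold_locales (fact \<Omega>(1) D(1) g lin gb)+
          then show "\<exists>g. smooth_density \<Omega> u D g" by (rule exI[of "smooth_density \<Omega> u D" g])
        qed
        then obtain g where sd: "smooth_density \<Omega> u D g" by (elim exE)
        note gm = smooth_density.density_measurable[OF sd] and gi = smooth_density.density_integrable[OF sd]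
          and rep = smooth_density.density[OF sd]
        have "bmo_norm \<Omega> g \<le> ennreal (A * D) + ennreal (B * D)"
        proof (rule bmo_norm_le[OF gm])
          show "int_on (cell a s) (\<lambda>x. \<bar>g x - int_on (cell a s) g / s ^ CARD('n)\<bar>) \<le> A * D * s ^ CARD('n)"
            if "s > 0" "cell a s \<subseteq> \<Omega>" for a s by (rule osc[OF sd that])
          show "int_on (cell a s) (\<lambda>x. \<bar>g x\<bar>) \<le> B * D * s ^ CARD('n)" if "s \<ge> 1" "cell a s \<subseteq> \<Omega>" for a s
            by (rule large[OF sd that]) (unfold D_def, rule d_space_zero_order_bound[OF u compact_cell that(2)])
        qed
        also have "\<dots> = ennreal (A * D + B * D)"
          using A B D(1) by (intro ennreal_plus[symmetric]) auto
        also have "\<dots> \<le> ennreal ((A + B + 1) * D)"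
          using D(1) by (intro ennreal_leI) (simp add: algebra_simps)
        also have "\<dots> = ennreal (A + B + 1) * d_norm 1 \<Omega> u"
          unfolding D(2) using A B D(1) by (intro ennreal_mult) auto
        finally have bmo: "bmo_norm \<Omega> g \<le> ennreal (A + B + 1) * d_norm 1 \<Omega> u" .
        have "bmo_norm \<Omega> g < \<infinity>"
          using bmo unfolding D(2) by (rule order_le_less_trans) (simp add: ennreal_mult_less_top)
        moreover have "g \<in> L1_loc \<Omega>"
        proof -
          have "set_integrable lebesgue K g" if "compact K" "K \<subseteq> \<Omega>" for K
            using gi[OF that] integrable_completion[of "\<lambda>x. indicator K x * g x" lborel] borel_compact[OF that(1)] gm
            by (simp add: set_integrable_def)
          then show ?thesis by (simp add: L1_loc_def)
        qed
        ultimately have "g \<in> bmo_space \<Omega>" by (simp add: bmo_space_def)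
        moreover have "represents \<Omega> g u"
          unfolding represents_def
        proof
          fix \<phi> assume \<phi>: "\<phi> \<in> test_functions \<Omega>"
          have K: "compact (closure {x. \<phi> x \<noteq> 0})" "closure {x. \<phi> x \<noteq> 0} \<subseteq> \<Omega>" using \<phi> by (auto simp: test_functions_def)
          note \<phi>' = test_functions_smooth_in[OF \<phi>]
          have "(LINT x:\<Omega>|lebesgue. g x * \<phi> x) = (LINT x|lborel. g x * \<phi> x)"
          proof (rule lebesgue_integral_on_eq_lborel)
            show "(\<lambda>x. g x * \<phi> x) \<in> borel_measurable borel"
              using gm smooth_borel_measurable[OF smooth_inD[OF \<phi>']] by measurable
            show "g x * \<phi> x = 0" if "x \<notin> \<Omega>" for x
              using smooth_in_outside[OF \<phi>', of x] K(2) that by auto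
          qed
          then show "u \<phi> = (LINT x:\<Omega>|lebesgue. g x * \<phi> x)" using rep[OF K \<phi>'] by simp
        qed
        ultimately show "\<exists>g\<in>bmo_space \<Omega>. represents \<Omega> g u \<and> bmo_norm \<Omega> g \<le> ennreal (A + B + 1) * d_norm 1 \<Omega> u"
          using bmo by blast
      qed
    qed
  qed
qed

end
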